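(* Let $\Sigma$ be a finite alphabet of constant symbols with $\star\notin\Sigma$ and let $O\in\mathrm{Matr}_\Sigma(\mathcal O)$ be an observation. Then $\mathcal L(O)\in\mathrm{coNL}$ (co-nondeterministic logarithmic space). If moreover $O$ is a deterministic wiring, then $\mathcal L(O)\in\mathrm{L}$ (deterministic logarithmic space).
   Context: Terms: first-order terms built from an infinite set of variables, a binary function symbol $\bullet$ written infix (not associative; by convention right-associating, $t\bullet u\bullet v:=t\bullet(u\bullet v)$), infinitely many constant symbols including a distinguished constant $\star$, and for each $n\ge1$ at least one $n$-ary function symbol. $\mathrm{var}(t)$ is the set of variables of $t$; $t$ is closed if $\mathrm{var}(t)=\emptyset$. The height $h(t)$ is the maximal distance from the root to a node in the tree of $t$; the height of an occurrence of a variable in $t$ is its distance from the root. A renaming is a bijective substitution mapping variables to variables. A flow is a pair of terms written $t\leftarrow u$ with $\mathrm{var}(t)\subseteq\mathrm{var}(u)$, considered up to renaming ($t\leftarrow u=t\alpha\leftarrow u\alpha$ for every renaming $\alpha$). A fact is a flow $t\leftarrow\star$ (so $t$ is closed). The product of flows $u\leftarrow v$ and $t\leftarrow w$ (representatives chosen with disjoint variable sets) is defined iff $v$ and $t$ are unifiable, and then equals $u\theta\leftarrow w\theta$ with $\theta$ a most general unifier of $v,t$. A wiring is a finite set of flows, written as a formal sum $f_1+\dots+f_n$, with $0$ the empty wiring; the product of wirings is $FG=\{fg: f\in F, g\in G, fg\text{ defined}\}$ and $F^n$ is the $n$-fold product. For a fact $\mathbf u$, $F\mathbf u$ denotes the wiring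 $F\{\mathbf u\}$ (a set of facts). $F$ is nilpotent if $F^n=0$ for some $n\in\mathbb N$. $F$ is deterministic if $|F\mathbf u|\le 1$ for every fact $\mathbf u$. A flow $t\leftarrow u$ is balanced if for every variable $x$, all occurrences of $x$ in $t$ and in $u$ have the same height; a wiring is balanced if all its flows are; $\mathcal B$ denotes the set of balanced wirings. A semiring here means a set of wirings containing $0$ and closed under finite sums (unions) and products. Tensor product of flows (variables renamed apart): $(u\leftarrow v)\otimes(t\leftarrow w):=u\bullet t\leftarrow v\bullet w$; extended to wirings by $(\sum_i f_i)\otimes(\sum_j g_j)=\sum_{i,j}f_i\otimes g_j$, and to semirings by $\mathcal A\otimes\mathcal B=\{\sum_i F_i\otimes G_i: F_i\in\mathcal A, G_i\in\mathcal B\}$; $\otimes$ on semirings is also right-associating. For a set $E$ of closed terms, $\mathcal C(E)=\{\sum_i t_i\leftarrow u_i: t_i,u_i\in E\}$ (finite sums). For a set of symbols $\mathbf S$ and semiring $\mathcal A$, $\mathcal R_{\mathbf S}(\mathcal A)$ is the set of wirings of $\mathcal A$ not using symbols of $\mathbf S$. Fix disjoint infinite sets of constants $\mathbf P$ (position constants) and $\mathbf S$ (states), a unary function symbol $\mathrm M$, and constants $\mathrm L,\mathrm R$. The observation semiring is $\mathcal O:=\mathcal C(\mathbf S)\otimes\mathcal R_{\mathbf P}(\mathcal B)$. For a set of constants $\Sigma$ (with $\star\notin\Sigma$) and semiring $\mathcal A$, $\mathrm{Matr}_\Sigma(\mathcal A):=\mathcal C(\Sigma\cup\{\star\})\otimes\mathcal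 C(\{\mathrm L,\mathrm R\})\otimes\mathcal A$. An observation over $\Sigma$ is any element of $\mathrm{Matr}_\Sigma(\mathcal O)$. Word representation: write $t\rightleftarrows u$ for the wiring $t\leftarrow u+u\leftarrow t$. For a word $W=c_1\cdots c_n$ over $\Sigma$ and pairwise distinct $p=(p_0,\dots,p_n)\in\mathbf P^{n+1}$, set $p_{n+1}=p_0$, $c_0=c_{n+1}=\star$, and, with $x,y$ variables, $\bar W_p=\sum_{i=0}^n\big(c_i\bullet\mathrm L\bullet x\bullet y\bullet\mathrm M(p_i)\ \rightleftarrows\ c_{i+1}\bullet\mathrm R\bullet x\bullet y\bullet\mathrm M(p_{i+1})\big)$. The language of an observation $O$ is $\mathcal L(O)=\{W\in\Sigma^*:\ O\bar W_p\text{ is nilpotent for every such }p\}$. Complexity is measured in the length of the input word $W$. *)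

theory Defs
  imports Complex_Main
begin

text \<open>Function symbols. Constants: Star (the distinguished constant), Cst n (generic
constants), PosC n (the position constants P), StC n (the states S), Lsym, Rsym.
Msym is the unary symbol M, Bul is the binary symbol (written infix in the paper),
and Fn n k is the k-th function symbol of arity n+1.\<close>

datatype fsym = Star | Cst nat | PosC nat | StC nat | Lsym | Rsym | Msym | Bul | Fn nat nat

fun arity :: "fsym \<Rightarrow> nat" where
  "arity Msym = 1"
| "arity Bul = 2"
| "arity (Fn n k) = Suc n"
| "arity _ = 0"

datatype trm = Var nat | App fsym "trm list"

fun wf_trm :: "trm \<Rightarrow> bool" where
  "wf_trm (Var x) = True"
| "wf_trm (App f ts) = (length ts = arity f \<and> (\<forall>t\<in>set ts. wf_trm t))"

fun vars :: "trm \<Rightarrow> nat set" where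
  "vars (Var x) = {x}"
| "vars (App f ts) = \<Union> (vars ` set ts)"

fun syms :: "trm \<Rightarrow> fsym set" where
  "syms (Var x) = {}"
| "syms (App f ts) = insert f (\<Union> (syms ` set ts))"

fun occ_heights :: "trm \<Rightarrow> nat \<Rightarrow> nat set" where
  "occ_heights (Var y) x = (if x = y then {0} else {})"
| "occ_heights (App f ts) x = Suc ` (\<Union> t\<in>set ts. occ_heights t x)"

fun subst :: "(nat \<Rightarrow> trm) \<Rightarrow> trm \<Rightarrow> trm" where
  "subst \<sigma> (Var x) = \<sigma> x"
| "subst \<sigma> (App f ts) = App f (map (subst \<sigma>) ts)"

definition ren :: "(nat \<Rightarrow> nat) \<Rightarrow> trm \<Rightarrow> trm" where
  "ren \<rho> t = subst (\<lambda>x. Var (\<rho> x)) t"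

definition const :: "fsym \<Rightarrow> trm" where
  "const c = App c []"

definition bul :: "trm \<Rightarrow> trm \<Rightarrow> trm" where
  "bul t u = App Bul [t, u]"

definition closed :: "trm \<Rightarrow> bool" where
  "closed t \<longleftrightarrow> vars t = {}"

definition unifier :: "(nat \<Rightarrow> trm) \<Rightarrow> trm \<Rightarrow> trm \<Rightarrow> bool" where
  "unifier \<theta> s t \<longleftrightarrow> subst \<theta> s = subst \<theta> t"

definition is_mgu :: "(nat \<Rightarrow> trm) \<Rightarrow> trm \<Rightarrow> trm \<Rightarrow> bool" where
  "is_mgu \<theta> s t \<longleftrightarrow> unifier \<theta> s t \<and>
     (\<forall>\<sigma>. unifier \<sigma> s t \<longrightarrow> (\<exists>\<tau>. \<forall>x. \<sigma> x = subst \<tau> (\<theta> x)))"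

text \<open>A flow t <- u is represented by a pair (t,u) (a representative of its class
up to renaming); a wiring is a finite set of such representatives. All notions
below (product, nilpotency, determinism, membership in the semirings) are
invariant under the choice of representatives.\<close>

type_synonym flow = "trm \<times> trm"
type_synonym wiring = "flow set"

definition is_flow :: "flow \<Rightarrow> bool" where
  "is_flow f \<longleftrightarrow> wf_trm (fst f) \<and> wf_trm (snd f) \<and> vars (fst f) \<subseteq> vars (snd f)"

definition flow_vars :: "flow \<Rightarrow> nat set" where
  "flow_vars f = vars (fst f) \<union> vars (snd f)"

definition flow_renaming :: "flow \<Rightarrow> flow \<Rightarrow> bool" where
  "flow_renaming f g \<longleftrightarrow> (\<exists>\<rho>. bij \<rho> \<and> g = (ren \<rho> (fst f), ren \<rho> (snd f)))"

text \<open>Product of flows (u <- v)(t <- w) = u\<theta> <- w\<theta>, \<theta> an mgu of v and t, representatives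
with disjoint variables. We collect all results over all choices (they are all
renamings of each other); the set is empty iff the product is undefined.\<close>
definition flow_prod :: "flow \<Rightarrow> flow \<Rightarrow> flow set" where
  "flow_prod f g = {(subst \<theta> (fst f), subst \<theta> w') | \<theta> \<rho> t' w'.
      bij \<rho> \<and> t' = ren \<rho> (fst g) \<and> w' = ren \<rho> (snd g) \<and>
      (vars t' \<union> vars w') \<inter> flow_vars f = {} \<and> is_mgu \<theta> (snd f) t'}"

definition wprod :: "wiring \<Rightarrow> wiring \<Rightarrow> wiring" where
  "wprod F G = (\<Union>f\<in>F. \<Union>g\<in>G. flow_prod f g)"

text \<open>wpow F n is the (n+1)-fold product F^(n+1).\<close>
fun wpow :: "wiring \<Rightarrow> nat \<Rightarrow> wiring" where
  "wpow F 0 = F"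
| "wpow F (Suc n) = wprod F (wpow F n)"

definition nilpotent :: "wiring \<Rightarrow> bool" where
  "nilpotent F \<longleftrightarrow> (\<exists>n. wpow F n = {})"

definition fact :: "trm \<Rightarrow> flow" where
  "fact t = (t, const Star)"

definition deterministic :: "wiring \<Rightarrow> bool" where
  "deterministic F \<longleftrightarrow> (\<forall>u. wf_trm u \<and> closed u \<longrightarrow>
      (\<forall>a\<in>wprod F {fact u}. \<forall>b\<in>wprod F {fact u}. a = b))"

definition wiring_equiv :: "wiring \<Rightarrow> wiring \<Rightarrow> bool" where
  "wiring_equiv F G \<longleftrightarrow> (\<forall>f\<in>F. \<exists>g\<in>G. flow_renaming f g) \<and> (\<forall>g\<in>G. \<exists>f\<in>F. flow_renaming g f)"

definition balanced :: "flow \<Rightarrow> bool" where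
  "balanced f \<longleftrightarrow> (\<forall>x. \<forall>h1\<in>occ_heights (fst f) x \<union> occ_heights (snd f) x.
      \<forall>h2\<in>occ_heights (fst f) x \<union> occ_heights (snd f) x. h1 = h2)"

definition balanced_wirings :: "wiring set" where
  "balanced_wirings = {F. finite F \<and> (\<forall>f\<in>F. is_flow f \<and> balanced f)}"

definition restrict_syms :: "fsym set \<Rightarrow> wiring set \<Rightarrow> wiring set" where
  "restrict_syms S A = {F\<in>A. \<forall>f\<in>F. (syms (fst f) \<union> syms (snd f)) \<inter> S = {}}"

text \<open>Tensor of flows; the variables are renamed apart canonically (even / odd).\<close>
definition ftensor :: "flow \<Rightarrow> flow \<Rightarrow> flow" where
  "ftensor f g = (bul (ren (\<lambda>x. 2*x) (fst f)) (ren (\<lambda>x. 2*x+1) (fst g)),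
                  bul (ren (\<lambda>x. 2*x) (snd f)) (ren (\<lambda>x. 2*x+1) (snd g)))"

definition wtensor :: "wiring \<Rightarrow> wiring \<Rightarrow> wiring" where
  "wtensor F G = {ftensor f g | f g. f \<in> F \<and> g \<in> G}"

definition stensor :: "wiring set \<Rightarrow> wiring set \<Rightarrow> wiring set" where
  "stensor A B = {\<Union> (set (map (\<lambda>(F, G). wtensor F G) l)) | l. set l \<subseteq> A \<times> B}"

definition Csemi :: "fsym set \<Rightarrow> wiring set" where
  "Csemi E = {F. finite F \<and> F \<subseteq> (const ` E) \<times> (const ` E)}"

definition obs_semiring :: "wiring set" where
  "obs_semiring = stensor (Csemi (range StC))
     (restrict_syms (range PosC) balanced_wirings)"

definition Matr :: "fsym set \<Rightarrow> wiring set \<Rightarrow> wiring set" where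
  "Matr Sig A = stensor (Csemi (insert Star Sig)) (stensor (Csemi {Lsym, Rsym}) A)"

definition observations :: "fsym set \<Rightarrow> wiring set" where
  "observations Sig = {Ob. finite Ob \<and> (\<exists>Ob'\<in>Matr Sig obs_semiring. wiring_equiv Ob Ob')}"

definition biflow :: "trm \<Rightarrow> trm \<Rightarrow> wiring" where
  "biflow t u = {(t, u), (u, t)}"

definition wordrep :: "fsym list \<Rightarrow> nat list \<Rightarrow> wiring" where
  "wordrep W p = (let n = length W;
      c = (\<lambda>i. if i = 0 \<or> i = n + 1 then Star else W ! (i - 1));
      q = (\<lambda>i. if i = n + 1 then p ! 0 else p ! i);
      tm = (\<lambda>i d. bul (const (c i)) (bul (const d) (bul (Var 0) (bul (Var 1)
               (App Msym [const (PosC (q i))])))))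
    in \<Union>i\<in>{0..n}. biflow (tm i Lsym) (tm (i + 1) Rsym))"

definition lang :: "fsym set \<Rightarrow> wiring \<Rightarrow> fsym list set" where
  "lang Sig Ob = {W. set W \<subseteq> Sig \<and>
     (\<forall>p. length p = length W + 1 \<and> distinct p \<longrightarrow> nilpotent (wprod Ob (wordrep W p)))}"

datatype inp = LEnd | REnd | Sym fsym

text \<open>A (nondeterministic) Turing machine with a two-way read-only input tape
(with end markers) and one work tape; states and work symbols are natural numbers,
0 is the blank. A transition (q', g', d, e) writes g', moves the input head by d
and the work head by e.\<close>
record tm =
  states :: "nat set"
  init :: nat
  acc :: nat
  alph :: "nat set"
  delta :: "nat \<Rightarrow> inp \<Rightarrow> nat \<Rightarrow> (nat \<times> nat \<times> int \<times> int) set"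

definition valid_tm :: "tm \<Rightarrow> bool" where
  "valid_tm M \<longleftrightarrow> finite (states M) \<and> init M \<in> states M \<and> acc M \<in> states M \<and>
     finite (alph M) \<and> 0 \<in> alph M \<and>
     (\<forall>q a g. \<forall>(q', g', d, e)\<in>delta M q a g.
        q' \<in> states M \<and> g' \<in> alph M \<and> d \<in> {-1, 0, 1} \<and> e \<in> {-1, 0, 1})"

definition deterministic_tm :: "tm \<Rightarrow> bool" where
  "deterministic_tm M \<longleftrightarrow> (\<forall>q a g. \<forall>x\<in>delta M q a g. \<forall>y\<in>delta M q a g. x = y)"

type_synonym config = "nat \<times> nat \<times> (nat \<Rightarrow> nat) \<times> nat"

definition read_inp :: "fsym list \<Rightarrow> nat \<Rightarrow> inp" where
  "read_inp w i = (if i = 0 then LEnd else if i \<le> length w then Sym (w ! (i - 1)) else REnd)"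

definition step :: "tm \<Rightarrow> fsym list \<Rightarrow> config \<Rightarrow> config \<Rightarrow> bool" where
  "step M w c c' \<longleftrightarrow> (case c of (q, i, T, j) \<Rightarrow> case c' of (q', i', T', j') \<Rightarrow>
      (\<exists>g' d e. (q', g', d, e) \<in> delta M q (read_inp w i) (T j) \<and>
         i' = min (length w + 1) (nat (int i + d)) \<and> T' = T(j := g') \<and> j' = nat (int j + e)))"

definition init_config :: "tm \<Rightarrow> config" where
  "init_config M = (init M, 0, \<lambda>_. 0, 0)"

definition reachable :: "tm \<Rightarrow> fsym list \<Rightarrow> config \<Rightarrow> bool" where
  "reachable M w c \<longleftrightarrow> (step M w)\<^sup>*\<^sup>* (init_config M) c"

definition accepts :: "tm \<Rightarrow> fsym list \<Rightarrow> bool" where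
  "accepts M w \<longleftrightarrow> (\<exists>c. reachable M w c \<and> fst c = acc M)"

definition halts :: "tm \<Rightarrow> fsym list \<Rightarrow> bool" where
  "halts M w \<longleftrightarrow> wfP (\<lambda>c' c. reachable M w c \<and> step M w c c')"

definition log_space :: "tm \<Rightarrow> nat \<Rightarrow> fsym list \<Rightarrow> bool" where
  "log_space M k w \<longleftrightarrow> (\<forall>q i T j. reachable M w (q, i, T, j) \<longrightarrow>
      real j \<le> real k * log 2 (real (length w) + 2))"

definition in_NL :: "fsym set \<Rightarrow> fsym list set \<Rightarrow> bool" where
  "in_NL Sig Lg \<longleftrightarrow> Lg \<subseteq> lists Sig \<and> (\<exists>M k. valid_tm M \<and>
     (\<forall>w\<in>lists Sig. log_space M k w \<and> halts M w \<and> (w \<in> Lg \<longleftrightarrow> accepts M w)))"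

definition in_L :: "fsym set \<Rightarrow> fsym list set \<Rightarrow> bool" where
  "in_L Sig Lg \<longleftrightarrow> Lg \<subseteq> lists Sig \<and> (\<exists>M k. valid_tm M \<and> deterministic_tm M \<and>
     (\<forall>w\<in>lists Sig. log_space M k w \<and> halts M w \<and> (w \<in> Lg \<longleftrightarrow> accepts M w)))"

definition in_coNL :: "fsym set \<Rightarrow> fsym list set \<Rightarrow> bool" where
  "in_coNL Sig Lg \<longleftrightarrow> Lg \<subseteq> lists Sig \<and> in_NL Sig (lists Sig - Lg)"

end

theory Submission
  imports Defs
begin

text \<open>
  Nilpotency of a wiring is emptiness of some power of the relation formed by all instances of its
  flows. In the relation of \<open>O W\<close> a step moves the active position constant cyclically by one and
  then applies a flow of \<open>O\<close>. Since the flows are balanced, every term occurring in a chain may be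
  truncated at a fixed height, so it suffices to consider boundedly many skeletons, each filled with
  boundedly many position constants: a vertex is a control state together with a fixed number of
  pointers into the word. Since \<open>O\<close> does not mention position constants, a step depends only on the
  skeleton, on equalities between pointers and on the letters at the pointers. Hence \<open>O W\<close> fails to be
  nilpotent iff this graph contains a walk as long as its number of vertices.

  A machine with finitely many pointers searches for such a walk: it enumerates all start vertices and
  walks, nondeterministically if the graph branches, while counting steps with further pointers.
  Failing to find a walk is acceptance by the same machine when the graph is functional. Pointers are
  stored in binary on tracks of the work tape. The Turing machine runs through the input,
  incrementing a counter and comparing it with all pointers at once, and thereby learns the letters
  under the pointers and which of them coincide; every counter operation is one sweep over the tape.
\<close>

section \<open>Unification and nilpotency\<close>

text \<open>The language quantifies over all choices \<open>p\<close> of position constants, but the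
  walk condition \<open>long_walk\<close> does not mention \<open>p\<close>; the answer for one
  choice is therefore the answer for all. A deterministic observation does not make the vertex graph
  functional, because one term has many presentations by a skeleton with pointers. Hence
  \<open>pick\<close> keeps a single transition per reading, and \<open>adequate\<close> says that
  no decoded term is lost in this way. Termination and acceptance are carried together by
  \<open>outcome\<close>, which is derivable only where all runs, cut at the accepting state, are
  finite. This is why the search is a countdown: once it has started, each step before the last
  lowers one clock, even after a walk got stuck. Vertices only point to positions of the word, so
  truncation has to remove the position constants outside \<open>p\<close> too.\<close>

lemma subst_subst: "subst \<tau> (subst \<sigma> t) = subst (\<lambda>x. subst \<tau> (\<sigma> x)) t"
  by (induction t) auto

lemma subst_Var [simp]: "subst Var t = t"
  by (induction t) (auto simp: map_idI)

lemma subst_cong_vars: "(\<And>x. x \<in> vars t \<Longrightarrow> \<sigma> x = \<tau> x) \<Longrightarrow> subst \<sigma> t = subst \<tau> t"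
proof (induction t)
  case (App f ts)
  have "subst \<sigma> u = subst \<tau> u" if "u \<in> set ts" for u
    using that App.prems by (intro App.IH) auto
  then show ?case by simp
qed simp

lemma subst_eq_on_vars: "subst \<sigma> t = subst \<tau> t \<Longrightarrow> x \<in> vars t \<Longrightarrow> \<sigma> x = \<tau> x"
  by (induction t) (auto 0 3)

lemma finite_vars [simp]: "finite (vars t)"
  by (induction t) auto

lemma vars_subst: "vars (subst \<sigma> t) = (\<Union>x\<in>vars t. vars (\<sigma> x))"
  by (induction t) auto

lemma subst_closed: "closed t \<Longrightarrow> subst \<sigma> t = t"
  using subst_cong_vars[of t \<sigma> Var] by (simp add: closed_def)

lemma subst_ren: "subst \<sigma> (ren \<rho> t) = subst (\<lambda>x. \<sigma> (\<rho> x)) t"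
  by (simp add: ren_def subst_subst)

lemma ren_closed: "closed t \<Longrightarrow> ren \<rho> t = t"
  by (simp add: ren_def subst_closed)

lemma vars_ren: "vars (ren \<rho> t) = \<rho> ` vars t"
  by (auto simp: ren_def vars_subst)

lemma size_occurs: "x \<in> vars t \<Longrightarrow> size (\<sigma> x) \<le> size (subst \<sigma> t)"
proof (induction t)
  case (App f ts)
  then obtain t where t: "t \<in> set ts" "x \<in> vars t" by auto
  then have "size (subst \<sigma> t) \<le> size_list size (map (subst \<sigma>) ts)"
    by (intro size_list_estimation'[of "subst \<sigma> t"]) auto
  then show ?case using App.IH[OF t] by simp
qed simp

text \<open>A variable strictly inside \<open>t\<close> would make the instance of \<open>t\<close>
  larger than the value it has to equal.\<close>

lemma occurs_check:
  assumes "x \<in> vars t" "\<sigma> x = subst \<sigma> t"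
  shows "t = Var x"
proof (cases t)
  case (App f ts)
  then obtain u where u: "u \<in> set ts" "x \<in> vars u" using assms by auto
  have "size (\<sigma> x) \<le> size (subst \<sigma> u)" using size_occurs[OF u(2)] .
  also have "\<dots> \<le> size_list size (map (subst \<sigma>) ts)"
    using u(1) by (intro size_list_estimation'[of "subst \<sigma> u"]) auto
  also have "\<dots> < size (subst \<sigma> t)" using App by simp
  finally show ?thesis using assms by simp
qed (use assms in auto)

text \<open>Unification is run on lists of equations, since decomposing an equation between two
  applications produces one equation per argument.\<close>

definition unifies :: "(nat \<Rightarrow> trm) \<Rightarrow> (trm \<times> trm) list \<Rightarrow> bool" where
  "unifies \<sigma> es \<longleftrightarrow> (\<forall>(s, t)\<in>set es. subst \<sigma> s = subst \<sigma> t)"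

definition evars :: "(trm \<times> trm) list \<Rightarrow> nat set" where
  "evars es = (\<Union>(s, t)\<in>set es. vars s \<union> vars t)"

definition has_mgu :: "(trm \<times> trm) list \<Rightarrow> bool" where
  "has_mgu es \<longleftrightarrow> (\<exists>\<theta>. unifies \<theta> es \<and>
     (\<forall>\<sigma>. unifies \<sigma> es \<longrightarrow> (\<exists>\<tau>. \<forall>x. \<sigma> x = subst \<tau> (\<theta> x))))"

lemma finite_evars [simp]: "finite (evars es)"
  by (auto simp: evars_def)

lemma has_mgu_cong: "has_mgu es \<Longrightarrow> (\<And>\<sigma>. unifies \<sigma> es \<longleftrightarrow> unifies \<sigma> es') \<Longrightarrow> has_mgu es'"
  by (simp add: has_mgu_def)

definition elim :: "nat \<Rightarrow> trm \<Rightarrow> (trm \<times> trm) list \<Rightarrow> (trm \<times> trm) list" where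
  "elim x t es = map (\<lambda>(s, u). (subst (Var(x := t)) s, subst (Var(x := t)) u)) es"

lemma subst_upd: "\<sigma> x = subst \<sigma> t \<Longrightarrow> subst \<sigma> (subst (Var(x := t)) s) = subst \<sigma> s"
  unfolding subst_subst by (intro subst_cong_vars) auto

lemma unifies_elim: "\<sigma> x = subst \<sigma> t \<Longrightarrow> unifies \<sigma> (elim x t es) \<longleftrightarrow> unifies \<sigma> es"
  by (auto simp: unifies_def elim_def subst_upd split_beta)

text \<open>The unifier is \<open>x := t\<close> followed by a most general unifier of the rest. Any
  unifier \<open>\<sigma>\<close> of the whole list absorbs \<open>x := t\<close>, so the factor
  found for the rest works again.\<close>

lemma has_mgu_elim:
  assumes "x \<notin> vars t" "has_mgu (elim x t es)"
  shows "has_mgu ((Var x, t) # es)"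
proof -
  obtain \<theta> where \<theta>: "unifies \<theta> (elim x t es)"
    "\<And>\<sigma>. unifies \<sigma> (elim x t es) \<Longrightarrow> \<exists>\<tau>. \<forall>y. \<sigma> y = subst \<tau> (\<theta> y)"
    using assms by (auto simp: has_mgu_def)
  define \<theta>' where "\<theta>' y = subst \<theta> ((Var(x := t)) y)" for y
  have s: "subst \<theta>' u = subst \<theta> (subst (Var(x := t)) u)" for u
    by (simp add: subst_subst \<theta>'_def[abs_def])
  have t: "subst (Var(x := t)) t = t"
    using assms by (subst subst_cong_vars[of t _ Var]) auto
  have "unifies \<theta>' ((Var x, t) # es)"
    using \<theta>(1) by (auto simp: unifies_def elim_def s t \<theta>'_def)
  moreover have "\<exists>\<tau>. \<forall>y. \<sigma> y = subst \<tau> (\<theta>' y)" if u: "unifies \<sigma> ((Var x, t) # es)" for \<sigma>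
  proof -
    have eq: "\<sigma> x = subst \<sigma> t" and "unifies \<sigma> es" using u by (auto simp: unifies_def)
    then obtain \<tau> where \<tau>: "\<And>y. \<sigma> y = subst \<tau> (\<theta> y)" using \<theta>(2) by (metis unifies_elim)
    have "subst \<tau> (\<theta>' y) = subst \<sigma> ((Var(x := t)) y)" for y
      by (simp add: \<theta>'_def subst_subst \<tau>[abs_def])
    then have "subst \<tau> (\<theta>' y) = \<sigma> y" for y using eq by simp
    then show ?thesis by metis
  qed
  ultimately show ?thesis unfolding has_mgu_def by blast
qed

lemma evars_elim: "x \<notin> vars t \<Longrightarrow> evars (elim x t es) \<subseteq> (vars t \<union> evars es) - {x}"
  by (auto simp: evars_def elim_def vars_subst split: if_splits prod.splits)

text \<open>The measure is lexicographic: eliminating a variable lowers the number of variables;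
  decomposing an application or dropping a trivial equation adds no variable and lowers the total
  size. The \<open>Suc\<close> per equation pays for dropping an equation between equal
  variables.\<close>

lemma mgu_list_exists: "\<exists>\<sigma>. unifies \<sigma> es \<Longrightarrow> has_mgu es"
proof (induction es rule: wf_induct[OF wf_measures[of "[\<lambda>es. card (evars es), \<lambda>es. sum_list (map (\<lambda>(s, t). Suc (size s + size t)) es)]"]])
  case (1 es)
  then obtain \<sigma> where \<sigma>: "unifies \<sigma> es" by auto
  have IH: "has_mgu es'"
    if "card (evars es') < card (evars es) \<or> (card (evars es') \<le> card (evars es)
       \<and> sum_list (map (\<lambda>(s, t). Suc (size s + size t)) es') < sum_list (map (\<lambda>(s, t). Suc (size s + size t)) es))"
      "unifies \<tau> es'" for es' \<tau>
    using 1(1)[rule_format, of es'] that by (auto simp: order.order_iff_strict)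
  show ?case
  proof (cases es)
    case Nil
    then show ?thesis unfolding has_mgu_def unifies_def
      by (intro exI[of _ Var]) (metis empty_iff list.set(1) subst.simps(1))
  next
    case (Cons e es0)
    obtain s t where e: "e = (s, t)" by force
    have mono: "card (evars es1) \<le> card (evars es)" if "evars es1 \<subseteq> evars es" for es1
      using that by (intro card_mono) auto
    have \<sigma>0: "unifies \<sigma> es0" "subst \<sigma> s = subst \<sigma> t" using \<sigma> by (auto simp: unifies_def Cons e)
    have var: "has_mgu ((Var x, u) # es0)" if xu: "{s, t} = {Var x, u}" for x u
    proof (cases "u = Var x")
      case True
      have "has_mgu es0"
        using \<sigma>0 mono[of es0] by (intro IH) (auto simp: Cons e evars_def)
      then show ?thesis by (rule has_mgu_cong) (auto simp: unifies_def True)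
    next
      case False
      have eq: "\<sigma> x = subst \<sigma> u" using xu \<sigma>0 by (auto simp: doubleton_eq_iff)
      then have x: "x \<notin> vars u" using occurs_check False by metis
      have "evars (elim x u es0) \<subset> evars es"
        using evars_elim[OF x, of es0] xu by (auto simp: Cons e evars_def doubleton_eq_iff)
      then have "has_mgu (elim x u es0)"
        using \<sigma>0 by (intro IH[of _ \<sigma>]) (auto simp: unifies_elim[OF eq] psubset_card_mono)
      then show ?thesis by (rule has_mgu_elim[OF x])
    qed
    show ?thesis
    proof (cases s)
      case (Var x)
      then show ?thesis using var[of x t] by (simp add: Cons e)
    next
      case s: (App f ss)
      show ?thesis
      proof (cases t)
        case (Var x)
        have "has_mgu ((Var x, s) # es0)" using var[of x s] Var by auto
        then show ?thesis by (rule has_mgu_cong) (auto simp: unifies_def Cons e Var)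
      next
        case t: (App g ts)
        have fg: "f = g" "map (subst \<sigma>) ss = map (subst \<sigma>) ts" using \<sigma>0 s t by auto
        then have len: "length ss = length ts" by (metis length_map)
        let ?es = "zip ss ts @ es0"
        have eqv: "unifies \<tau> ?es \<longleftrightarrow> unifies \<tau> es" for \<tau>
          using len by (force simp: unifies_def Cons e s t fg list_eq_iff_nth_eq set_zip)
        have "evars ?es \<subseteq> evars es"
          by (auto simp: evars_def Cons e s t dest: set_zip_leftD set_zip_rightD)
        moreover have "sum_list (map (\<lambda>(s, t). Suc (size s + size t)) (zip ss ts)) \<le> size_list size ss + size_list size ts"
          using len by (induction ss ts rule: list_induct2) auto
        ultimately have "has_mgu ?es"
          using \<sigma> eqv mono by (intro IH[of _ \<sigma>]) (auto simp: Cons e s t)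
        then show ?thesis using eqv has_mgu_cong by blast
      qed
    qed
  qed
qed

lemma mgu_exists: "unifier \<sigma> s t \<Longrightarrow> \<exists>\<theta>. is_mgu \<theta> s t"
  using mgu_list_exists[of "[(s, t)]"]
  by (auto simp: has_mgu_def unifies_def is_mgu_def unifier_def)

section \<open>Instances of flows, products and nilpotency\<close>

definition inst :: "wiring \<Rightarrow> (trm \<times> trm) set" where
  "inst F = {(subst \<sigma> t, subst \<sigma> u) | \<sigma> t u. (t, u) \<in> F}"

lemma finite_disjoint_renaming:
  fixes A B :: "nat set"
  assumes "finite A" "finite B"
  shows "\<exists>\<rho>. bij \<rho> \<and> \<rho> ` A \<inter> B = {}"
proof -
  obtain N where N: "\<forall>x\<in>A \<union> B. x < N"
    using assms finite_nat_set_iff_bounded[of "A \<union> B"] by auto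
  \<comment> \<open>A renaming must be a bijection of all of \<open>nat\<close>: swap the blocks
    \<open>[0, N)\<close> and \<open>[N, 2 * N)\<close>.\<close>
  define \<rho> where "\<rho> x = (if x < N then x + N else if x < 2 * N then x - N else x)" for x
  have "\<rho> (\<rho> x) = x" for x by (auto simp: \<rho>_def)
  then have "bij \<rho>" by (metis bijI')
  moreover have "\<rho> ` A \<inter> B = {}" using N by (force simp: \<rho>_def)
  ultimately show ?thesis by blast
qed

text \<open>Composable instances of two flows give a unifier of \<open>v\<close> and the renamed
  \<open>t\<close>; as it factors through a most general one, the composite is an instance of the
  product.\<close>

lemma inst_wprod: "inst (wprod F G) = inst F O inst G"
proof (intro equalityI subrelI)
  fix a c assume "(a, c) \<in> inst (wprod F G)"
  then obtain \<tau> f g \<theta> \<rho> where *: "f \<in> F" "g \<in> G" "is_mgu \<theta> (snd f) (ren \<rho> (fst g))"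
    "a = subst \<tau> (subst \<theta> (fst f))" "c = subst \<tau> (subst \<theta> (ren \<rho> (snd g)))"
    by (auto simp: inst_def wprod_def flow_prod_def)
  have "(a, subst \<tau> (subst \<theta> (snd f))) \<in> inst F"
    unfolding inst_def *(4) subst_subst using *(1) by (cases f) auto
  moreover have "(subst \<tau> (subst \<theta> (ren \<rho> (fst g))), c) \<in> inst G"
    unfolding inst_def *(5) subst_subst subst_ren using *(2) by (cases g) auto
  ultimately show "(a, c) \<in> inst F O inst G"
    using *(3) by (auto simp: is_mgu_def unifier_def)
next
  fix a c assume "(a, c) \<in> inst F O inst G"
  then obtain \<sigma> \<sigma>' u v t w where *: "(u, v) \<in> F" "(t, w) \<in> G" "subst \<sigma> v = subst \<sigma>' t"
    "a = subst \<sigma> u" "c = subst \<sigma>' w"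
    by (auto simp: inst_def)
  obtain \<rho> where \<rho>: "bij \<rho>" "\<rho> ` (vars t \<union> vars w) \<inter> flow_vars (u, v) = {}"
    using finite_disjoint_renaming[of "vars t \<union> vars w" "flow_vars (u, v)"]
    by (auto simp: flow_vars_def)
  \<comment> \<open>\<open>\<sigma>2\<close> glues the two substitutions, which is consistent
    because the renamed variables avoid those of the left flow.\<close>
  define \<sigma>2 where "\<sigma>2 x = (if x \<in> flow_vars (u, v) then \<sigma> x else \<sigma>' (inv \<rho> x))" for x
  have inv: "inv \<rho> (\<rho> x) = x" for x using \<rho>(1) by (simp add: bij_is_inj)
  have l: "subst \<sigma>2 u = subst \<sigma> u" "subst \<sigma>2 v = subst \<sigma> v"
    by (auto intro!: subst_cong_vars simp: \<sigma>2_def flow_vars_def)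
  have r: "subst \<sigma>2 (ren \<rho> t) = subst \<sigma>' t" "subst \<sigma>2 (ren \<rho> w) = subst \<sigma>' w"
    using \<rho>(2) by (fastforce intro!: subst_cong_vars simp: subst_ren \<sigma>2_def inv)+
  have uni: "unifier \<sigma>2 v (ren \<rho> t)" using * l r by (simp add: unifier_def)
  then obtain \<theta> where \<theta>: "is_mgu \<theta> v (ren \<rho> t)" using mgu_exists by blast
  then obtain \<tau> where \<tau>: "\<And>x. \<sigma>2 x = subst \<tau> (\<theta> x)" using uni by (auto simp: is_mgu_def)
  have "(subst \<theta> u, subst \<theta> (ren \<rho> w)) \<in> flow_prod (u, v) (t, w)"
    unfolding flow_prod_def using \<theta> \<rho> by (auto simp: vars_ren image_Un)
  then have "(subst \<theta> u, subst \<theta> (ren \<rho> w)) \<in> wprod F G" using * by (auto simp: wprod_def)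
  moreover have "a = subst \<tau> (subst \<theta> u)" "c = subst \<tau> (subst \<theta> (ren \<rho> w))"
    using * l r by (simp_all add: subst_subst \<tau>[abs_def, symmetric])
  ultimately show "(a, c) \<in> inst (wprod F G)" unfolding inst_def by blast
qed

lemma inst_eq_empty: "inst F = {} \<longleftrightarrow> F = {}"
  by (auto simp: inst_def)

lemma inst_wpow: "inst (wpow F n) = inst F ^^ Suc n"
proof (induction n)
  case (Suc n)
  then show ?case by (metis inst_wprod relpow.simps(2) relpow_commute wpow.simps(2))
qed simp

lemma nilpotent_iff: "nilpotent F \<longleftrightarrow> (\<exists>n. inst F ^^ Suc n = {})"
  unfolding nilpotent_def by (metis inst_wpow inst_eq_empty)

text \<open>Since \<open>a\<close> is closed, a unifier of \<open>u\<close> with \<open>a\<close> is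
  fixed on the variables of \<open>u\<close>, hence on those of \<open>t\<close>; the output is
  therefore the very fact that the product in the definition of determinism yields.\<close>

lemma deterministic_inst:
  assumes det: "deterministic F" and flow: "\<forall>f\<in>F. is_flow f" and a: "wf_trm a" "closed a"
    and "(x, a) \<in> inst F" "(y, a) \<in> inst F"
  shows "x = y"
proof -
  have "(x, const Star) \<in> wprod F {fact a}" if x: "(x, a) \<in> inst F" for x
  proof -
    obtain \<sigma> t u where *: "(t, u) \<in> F" "x = subst \<sigma> t" "a = subst \<sigma> u"
      using x by (auto simp: inst_def)
    then have "unifier \<sigma> u a" using a by (simp add: unifier_def subst_closed)
    then obtain \<theta> where \<theta>: "is_mgu \<theta> u a" using mgu_exists by blast
    then have "subst \<theta> u = subst \<sigma> u" using * a by (simp add: is_mgu_def unifier_def subst_closed)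
    moreover have "vars t \<subseteq> vars u" using bspec[OF flow *(1)] by (simp add: is_flow_def)
    ultimately have "subst \<theta> t = x"
      unfolding *(2) by (intro subst_cong_vars) (metis subst_eq_on_vars subsetD)
    moreover have c: "closed (const Star)" by (simp add: closed_def const_def)
    ultimately have "(x, const Star) \<in> flow_prod (t, u) (fact a)"
      unfolding flow_prod_def using \<theta> a c
      by (auto simp: fact_def ren_closed subst_closed intro!: exI[of _ \<theta>] exI[of _ id])
        (simp_all add: closed_def)
    then show ?thesis using *(1) by (auto simp: wprod_def)
  qed
  then show ?thesis using assms unfolding deterministic_def by blast
qed

section \<open>Pointer machines\<close>

datatype move = Stay | Up | Down

text \<open>Pointers range over the \<open>n + 1\<close> positions of the cyclic word, where
  \<open>0\<close> is read as the left end marker; the moves wrap around just as the word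
  representation identifies position \<open>n + 1\<close> with position \<open>0\<close>.\<close>

fun mv :: "nat \<Rightarrow> move \<Rightarrow> nat \<Rightarrow> nat" where
  "mv n Stay x = x"
| "mv n Up x = (if x = n then 0 else Suc x)"
| "mv n Down x = (if x = 0 then n else x - 1)"

type_synonym instr = "(nat \<times> move) list"
type_synonym info = "(inp \<times> bool list) list"
type_synonym 's prog = "'s \<Rightarrow> info \<Rightarrow> ('s \<times> instr) set"

definition info :: "fsym list \<Rightarrow> nat list \<Rightarrow> info" where
  "info w v = map (\<lambda>x. (read_inp w x, map (\<lambda>y. y = x) v)) v"

definition upd :: "nat \<Rightarrow> instr \<Rightarrow> nat list \<Rightarrow> nat list" where
  "upd n ops v = map (\<lambda>(k, m). mv n m (v ! k)) ops"

definition pstep :: "'s prog \<Rightarrow> fsym list \<Rightarrow> 's \<times> nat list \<Rightarrow> 's \<times> nat list \<Rightarrow> bool" where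
  "pstep \<delta> w x y \<longleftrightarrow> (\<exists>ops. (fst y, ops) \<in> \<delta> (fst x) (info w (snd x)) \<and>
     snd y = upd (length w) ops (snd x))"

text \<open>Derivability states that every run, cut at \<open>sacc\<close>, is finite; the Boolean
  tells whether some run reaches \<open>sacc\<close>. The function \<open>h\<close> collects the
  verdicts of the successors.\<close>

inductive outcome :: "'s prog \<Rightarrow> 's \<Rightarrow> fsym list \<Rightarrow> 's \<times> nat list \<Rightarrow> bool \<Rightarrow> bool"
  for \<delta> sacc w where
  outcome_acc: "outcome \<delta> sacc w (sacc, v) True"
| outcome_step: "s \<noteq> sacc \<Longrightarrow> (\<And>y. pstep \<delta> w (s, v) y \<Longrightarrow> outcome \<delta> sacc w y (h y)) \<Longrightarrow>
     b = (\<exists>y. pstep \<delta> w (s, v) y \<and> h y) \<Longrightarrow> outcome \<delta> sacc w (s, v) b"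

lemma pstepE:
  assumes "pstep \<delta> w (s, v) y"
  obtains s' ops where "(s', ops) \<in> \<delta> s (info w v)" "y = (s', upd (length w) ops v)"
  using assms by (cases y) (auto simp: pstep_def)

lemma mv_le: "x \<le> n \<Longrightarrow> mv n m x \<le> n"
  by (cases m) auto

section \<open>Logarithmic-space simulation of pointer machines\<close>

fun bval :: "bool list \<Rightarrow> nat" where
  "bval [] = 0"
| "bval (b # bs) = of_bool b + 2 * bval bs"

lemma bval_less: "bval bs < 2 ^ length bs"
  by (induction bs) auto

lemma bval_inj: "length bs = length cs \<Longrightarrow> bval bs = bval cs \<longleftrightarrow> bs = cs"
proof (induction bs cs rule: list_induct2)
  case (Cons b bs c cs)
  then show ?case by (cases b; cases c; simp; presburger)
qed simp

lemma bval_append: "bval (bs @ cs) = bval bs + 2 ^ length bs * bval cs"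
  by (induction bs) (auto simp: algebra_simps)

lemma bval_replicate_False [simp]: "bval (replicate n False) = 0"
  by (induction n) auto

text \<open>The tape is a list of bit columns; row \<open>k\<close> is a binary number with its
  least significant bit in cell \<open>0\<close>.\<close>

definition track :: "nat \<Rightarrow> bool list list \<Rightarrow> bool list" where
  "track k cols = map (\<lambda>col. col ! k) cols"

lemma track_simps [simp]:
  "track k [] = []" "track k (c # cs) = c ! k # track k cs" "length (track k cs) = length cs"
  "track k (cs @ ds) = track k cs @ track k ds"
  by (auto simp: track_def)

text \<open>\<open>Rew\<close> rewinds the input head. \<open>ScanR\<close>, \<open>ScanL\<close>
  and \<open>Chk\<close> form a loop over the input positions: increment the counter and compare,
  return and record the letter for the pointers that agreed, test for the end of the input.
  \<open>UpdR\<close> and \<open>UpdL\<close> rewrite all pointer tracks. The Boolean of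
  \<open>ScanR\<close> is the carry; the Boolean lists are agreement flags, or carries in
  \<open>UpdR\<close>.\<close>

datatype 's ctrl = Start | Acc | Rew 's | ScanR 's info bool "bool list" | ScanL 's info "bool list"
  | Chk 's info "bool list" | UpdR 's instr "bool list" | UpdL 's

type_synonym 's action = "'s ctrl \<times> bool list option \<times> int \<times> int"

definition tape :: "(bool list option \<Rightarrow> nat) \<Rightarrow> bool list list \<Rightarrow> nat \<Rightarrow> nat" where
  "tape g cols j = g (if j < length cols then Some (cols ! j) else None)"

definition put :: "bool list list \<Rightarrow> nat \<Rightarrow> bool list option \<Rightarrow> bool list list" where
  "put cols j x = (case x of None \<Rightarrow> cols | Some c \<Rightarrow> if j < length cols then cols[j := c] else cols @ [c])"

lemma tape_put:
  assumes "j \<le> length cols" "x = None \<longrightarrow> j = length cols"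
  shows "(tape g cols)(j := g x) = tape g (put cols j x)"
  using assms by (fastforce simp: tape_def put_def nth_append split: option.split)

section \<open>The simulating Turing machine\<close>

locale simulation =
  fixes \<delta> :: "'s prog" and S :: "'s set" and K :: nat and sini sacc :: 's and Sig :: "fsym set"
  assumes finite_S: "finite S" and sini: "sini \<in> S" and sacc: "sacc \<in> S"
    and finite_Sig: "finite Sig"
    and prog: "s \<in> S \<Longrightarrow> (s', ops) \<in> \<delta> s rd \<Longrightarrow>
      s' \<in> S \<and> length ops = K \<and> fst ` set ops \<subseteq> {..<K}"
begin

definition cells :: "bool list option set" where
  "cells = insert None (Some ` {c. length c = K + 2})"

definition infos :: "info set" where
  "infos = {rd. set rd \<subseteq> insert LEnd (Sym ` Sig) \<times> {es. length es = K} \<and> length rd = K}"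

definition instrs :: "instr set" where
  "instrs = {ops. set ops \<subseteq> {..<K + 2} \<times> {Stay, Up, Down} \<and> length ops = K}"

definition ctrls :: "'s ctrl set" where
  "ctrls = {Start, Acc} \<union> Rew ` S \<union> UpdL ` S
     \<union> (\<lambda>(s, rd, c, es). ScanR s rd c es) ` (S \<times> infos \<times> UNIV \<times> {es. length es = K})
     \<union> (\<lambda>(s, rd, es). ScanL s rd es) ` (S \<times> infos \<times> {es. length es = K})
     \<union> (\<lambda>(s, rd, es). Chk s rd es) ` (S \<times> infos \<times> {es. length es = K})
     \<union> (\<lambda>(s, ops, es). UpdR s ops es) ` (S \<times> instrs \<times> {es. length es = K})"

lemma in_ctrls [simp]:
  "Start \<in> ctrls" "Acc \<in> ctrls" "Rew s \<in> ctrls \<longleftrightarrow> s \<in> S" "UpdL s \<in> ctrls \<longleftrightarrow> s \<in> S"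
  "ScanR s rd c es \<in> ctrls \<longleftrightarrow> s \<in> S \<and> rd \<in> infos \<and> length es = K"
  "ScanL s rd es \<in> ctrls \<longleftrightarrow> s \<in> S \<and> rd \<in> infos \<and> length es = K"
  "Chk s rd es \<in> ctrls \<longleftrightarrow> s \<in> S \<and> rd \<in> infos \<and> length es = K"
  "UpdR s ops es \<in> ctrls \<longleftrightarrow> s \<in> S \<and> ops \<in> instrs \<and> length es = K"
  by (auto simp: ctrls_def image_iff)

lemma in_cells [simp]: "None \<in> cells" "Some c \<in> cells \<longleftrightarrow> length c = K + 2"
  by (auto simp: cells_def)

lemma finite_bools: "finite {es :: bool list. length es = m}"
  using finite_lists_length_eq[of "UNIV :: bool set" m] by simp

lemma finite_ctrls: "finite ctrls" and finite_cells: "finite cells"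
proof -
  have "finite infos" unfolding infos_def
    using finite_Sig finite_bools by (intro finite_lists_length_eq) auto
  moreover have "finite instrs" unfolding instrs_def by (intro finite_lists_length_eq) auto
  ultimately show "finite ctrls" unfolding ctrls_def using finite_S finite_bools
    by (intro finite_UnI finite_imageI finite_cartesian_product) auto
  show "finite cells" unfolding cells_def using finite_bools by auto
qed

text \<open>The target of a move that wraps around is read off another track: at the end of the scan the
  counter track \<open>K\<close> holds the largest pointer, and the marker track \<open>K + 1\<close>, which is set in
  the first cell only, holds \<open>1\<close>, the encoding of the pointer \<open>0\<close>.\<close>

definition adjust :: "info \<Rightarrow> bool list \<Rightarrow> nat \<times> move \<Rightarrow> nat \<times> move" where
  "adjust rd es = (\<lambda>(k, m). if m = Up \<and> es ! k then (K + 1, Stay)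
     else if m = Down \<and> fst (rd ! k) = LEnd then (K, Stay) else (k, m))"

definition upd_bits :: "instr \<Rightarrow> bool list \<Rightarrow> bool list \<Rightarrow> bool list" where
  "upd_bits ops cs col = map2 (\<lambda>(k, m) c. if m = Stay then col ! k else col ! k \<noteq> c) ops cs"

definition upd_carry :: "instr \<Rightarrow> bool list \<Rightarrow> bool list \<Rightarrow> bool list" where
  "upd_carry ops cs col = map2 (\<lambda>(k, m) c. c \<and> (m = Up \<longrightarrow> col ! k) \<and> (m = Down \<longrightarrow> \<not> col ! k)) ops cs"

text \<open>If the increment overflows the tape, a column is appended and all flags become false: no
  pointer stored in the old columns can equal the new counter. On \<open>REnd\<close> the remaining
  flags concern the last position \<open>n\<close>, which is what \<open>adjust\<close> needs for a
  wrapping \<open>Up\<close>.\<close>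

fun tr :: "'s ctrl \<Rightarrow> inp \<Rightarrow> bool list option \<Rightarrow> 's action set" where
  "tr Start a None = {(Rew sini, Some (replicate K True @ [False, True]), 0, 0)}"
| "tr (Rew s) a g = {if a \<noteq> LEnd then (Rew s, g, - 1, 0) else if s = sacc then (Acc, g, 0, 0)
     else (ScanR s (replicate K (LEnd, replicate K False)) True (replicate K True), g, 0, 0)}"
| "tr (ScanR s rd c es) a (Some col) = {(ScanR s rd (c \<and> col ! K)
     (map2 (\<lambda>e x. e \<and> x = (col ! K \<noteq> c)) es (take K col)), Some (col[K := (col ! K \<noteq> c)]), 0, 1)}"
| "tr (ScanR s rd c es) a None = {if c
     then (ScanL s rd (replicate K False), Some (replicate K False @ [True, False]), 0, - 1)
     else (ScanL s rd es, None, 0, - 1)}"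
| "tr (ScanL s rd es) a (Some col) = {if col ! (K + 1)
     then (Chk s (map2 (\<lambda>e x. if e then (a, es) else x) es rd) es, Some col, 1, 0)
     else (ScanL s rd es, Some col, 0, - 1)}"
| "tr (Chk s rd es) a g = (if a = REnd
     then (\<lambda>(s', ops). (UpdR s' (map (adjust rd es) ops) (replicate K True), g, 0, 0)) ` \<delta> s rd
     else {(ScanR s rd True (replicate K True), g, 0, 0)})"
| "tr (UpdR s ops cs) a (Some col) = {(UpdR s ops (upd_carry ops cs col),
     Some (upd_bits ops cs col @ [False, col ! (K + 1)]), 0, 1)}"
| "tr (UpdR s ops cs) a None = {(UpdL s, None, 0, - 1)}"
| "tr (UpdL s) a (Some col) = {if col ! (K + 1) then (Rew s, Some col, 0, 0) else (UpdL s, Some col, 0, - 1)}"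
| "tr _ _ _ = {}"

definition cq :: "'s ctrl \<Rightarrow> nat" where
  "cq = (SOME f. inj_on f ctrls)"

definition cg :: "bool list option \<Rightarrow> nat" where
  "cg = (SOME g. inj_on g cells \<and> g None = 0)"

lemma inj_cq: "inj_on cq ctrls"
proof -
  have ex: "\<exists>f :: _ \<Rightarrow> nat. inj_on f ctrls" using finite_imp_inj_to_nat_seg[OF finite_ctrls] by blast
  show ?thesis unfolding cq_def by (rule someI_ex[OF ex])
qed

lemma inj_cg: "inj_on cg cells" and cg_None: "cg None = 0"
proof -
  obtain f :: "_ \<Rightarrow> nat" where f: "inj_on f cells" using finite_imp_inj_to_nat_seg[OF finite_cells] by blast
  define g where "g x = (if x = None then 0 else Suc (f x))" for x
  have ex: "\<exists>g :: _ \<Rightarrow> nat. inj_on g cells \<and> g None = 0"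
    using f by (intro exI[of _ g]) (auto simp: inj_on_def g_def)
  have "inj_on cg cells \<and> cg None = 0" unfolding cg_def by (rule someI_ex[OF ex])
  then show "inj_on cg cells" "cg None = 0" by auto
qed

definition dirs :: "int set" where "dirs = {- 1, 0, 1}"

text \<open>Filtering the transitions through \<open>ctrls\<close>, \<open>cells\<close> and
  \<open>dirs\<close> makes validity immediate. The transitions that occur in actual runs pass the
  filter, as \<open>good_conf\<close> demands.\<close>

definition M :: tm where
  "M = \<lparr>states = cq ` ctrls, init = cq Start, acc = cq Acc, alph = cg ` cells,
    delta = \<lambda>q a x. {(cq q', cg x', d, e) | q0 x0 q' x' d e. q0 \<in> ctrls \<and> x0 \<in> cells \<and>
      cq q0 = q \<and> cg x0 = x \<and> (q', x', d, e) \<in> tr q0 a x0 \<and> q' \<in> ctrls \<and> x' \<in> cells \<and>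
      d \<in> dirs \<and> e \<in> dirs}\<rparr>"

lemma valid_M: "valid_tm M"
  unfolding valid_tm_def using finite_ctrls finite_cells image_eqI[of 0 cg None cells] cg_None
  by (auto simp: M_def dirs_def)

lemma delta_M: "(a, b, d, e) \<in> delta M qn c xn \<longleftrightarrow> (\<exists>q0 x0 q' x'. q0 \<in> ctrls \<and> x0 \<in> cells \<and>
      cq q0 = qn \<and> cg x0 = xn \<and> (q', x', d, e) \<in> tr q0 c x0 \<and> q' \<in> ctrls \<and> x' \<in> cells \<and>
      d \<in> dirs \<and> e \<in> dirs \<and> a = cq q' \<and> b = cg x')"
  unfolding M_def tm.simps mem_Collect_eq prod.inject by (intro iffI) (elim exE conjE, blast)+

lemma deterministic_M:
  assumes "\<And>s rd x y. s \<in> S \<Longrightarrow> x \<in> \<delta> s rd \<Longrightarrow> y \<in> \<delta> s rd \<Longrightarrow> x = y"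
  shows "deterministic_tm M"
proof -
  have tr: "x = y" if "q \<in> ctrls" "x \<in> tr q a g" "y \<in> tr q a g" for q a g x y
    using that by (cases "(q, a, g)" rule: tr.cases) (auto split: if_splits dest: assms)
  show ?thesis unfolding deterministic_tm_def
  proof (intro allI ballI)
    fix q a g x y assume "x \<in> delta M q a g" "y \<in> delta M q a g"
    then obtain q0 x0 q' x' d e q1 x1 q'' x'' d' e' where
      *: "x = (cq q', cg x', d, e)" "y = (cq q'', cg x'', d', e')"
      "q0 \<in> ctrls" "x0 \<in> cells" "cq q0 = q" "cg x0 = g" "(q', x', d, e) \<in> tr q0 a x0"
      "q1 \<in> ctrls" "x1 \<in> cells" "cq q1 = q" "cg x1 = g" "(q'', x'', d', e') \<in> tr q1 a x1"
      unfolding M_def by auto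
    then have "q0 = q1" "x0 = x1" using inj_cq inj_cg by (auto dest: inj_onD)
    then have "(q', x', d, e) = (q'', x'', d', e')" using * tr by blast
    then show "x = y" using * by simp
  qed
qed

definition conf :: "'s ctrl \<Rightarrow> nat \<Rightarrow> bool list list \<Rightarrow> nat \<Rightarrow> config" where
  "conf q i cols j = (cq q, i, tape cg cols, j)"

definition wide :: "bool list list \<Rightarrow> bool" where
  "wide cols \<longleftrightarrow> (\<forall>c\<in>set cols. length c = K + 2)"

definition get :: "bool list list \<Rightarrow> nat \<Rightarrow> bool list option" where
  "get cols j = (if j < length cols then Some (cols ! j) else None)"

lemma step_conf:
  assumes "q \<in> ctrls" "wide cols" "j \<le> length cols"
  shows "step M w (conf q i cols j) y \<longleftrightarrow>
    (\<exists>q' x d e. (q', x, d, e) \<in> tr q (read_inp w i) (get cols j) \<and> q' \<in> ctrls \<and> x \<in> cells \<and> d \<in> dirs \<and> e \<in> dirs \<and>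
      y = (cq q', min (length w + 1) (nat (int i + d)), (tape cg cols)(j := cg x), nat (int j + e)))"
    (is "_ = ?R")
proof -
  have get: "get cols j \<in> cells" "tape cg cols j = cg (get cols j)"
    using assms by (auto simp: get_def wide_def tape_def)
  have delta: "(a, b, d, e) \<in> delta M (cq q) (read_inp w i) (tape cg cols j) \<longleftrightarrow>
    (\<exists>q' x. (q', x, d, e) \<in> tr q (read_inp w i) (get cols j) \<and> q' \<in> ctrls \<and> x \<in> cells \<and> d \<in> dirs \<and> e \<in> dirs
      \<and> a = cq q' \<and> b = cg x)" (is "?L = ?R") for a b d e
  proof
    assume ?L
    then obtain q0 x0 q' x where *: "q0 \<in> ctrls" "x0 \<in> cells" "cq q0 = cq q" "cg x0 = tape cg cols j"
      "(q', x, d, e) \<in> tr q0 (read_inp w i) x0" "q' \<in> ctrls" "x \<in> cells" "d \<in> dirs" "e \<in> dirs"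
      "a = cq q'" "b = cg x"
      unfolding delta_M by metis
    then have "q0 = q" "x0 = get cols j"
      using inj_onD[OF inj_cq *(3)] inj_onD[OF inj_cg, of x0 "get cols j"] get assms(1) by auto
    then show ?R using * by blast
  next
    assume ?R
    then show ?L unfolding delta_M get(2) using get(1) assms(1) by metis
  qed
  obtain a i' U j' where y: "y = (a, i', U, j')" by (metis prod_cases4)
  have "step M w (conf q i cols j) y \<longleftrightarrow> (\<exists>b d e. (a, b, d, e) \<in> delta M (cq q) (read_inp w i) (tape cg cols j) \<and>
    i' = min (length w + 1) (nat (int i + d)) \<and> U = (tape cg cols)(j := b) \<and> j' = nat (int j + e))"
    by (simp add: step_def conf_def y)
  then show ?thesis unfolding delta y by blast
qed

end

section \<open>Correctness and space bound of the simulation\<close>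

locale simulation_run = simulation +
  fixes w :: "fsym list"
  assumes w: "set w \<subseteq> Sig"
begin

abbreviation n where "n \<equiv> length w"

definition small :: "nat \<Rightarrow> bool" where
  "small j \<longleftrightarrow> real j \<le> 2 * log 2 (real n + 2)"

text \<open>The whole future of a configuration: termination of all runs, the space bound, and the
  verdict \<open>b\<close>, which \<open>c\<close> determines.\<close>

definition good :: "config \<Rightarrow> bool \<Rightarrow> bool" where
  "good c b \<longleftrightarrow> Wellfounded.accp (\<lambda>c' c. step M w c c') c \<and>
     (\<forall>c'. (step M w)\<^sup>*\<^sup>* c c' \<longrightarrow> small (snd (snd (snd c')))) \<and>
     ((\<exists>c'. (step M w)\<^sup>*\<^sup>* c c' \<and> fst c' = acc M) \<longleftrightarrow> b)"

lemma goodD: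
  assumes "good c b"
  shows "Wellfounded.accp (\<lambda>c' c. step M w c c') c"
    and "(step M w)\<^sup>*\<^sup>* c c' \<Longrightarrow> small (snd (snd (snd c')))"
    and "(\<exists>c'. (step M w)\<^sup>*\<^sup>* c c' \<and> fst c' = acc M) \<longleftrightarrow> b"
  using assms unfolding good_def by blast+

lemma good_step:
  assumes "small (snd (snd (snd c)))" and succ: "\<And>c'. step M w c c' \<Longrightarrow> good c' (h c')"
    and "b \<longleftrightarrow> fst c = acc M \<or> (\<exists>c'. step M w c c' \<and> h c')"
  shows "good c b"
  unfolding good_def
proof (intro conjI allI impI)
  show "Wellfounded.accp (\<lambda>c' c. step M w c c') c"
    by (rule accp.accI) (rule goodD(1)[OF succ])
  show "small (snd (snd (snd c')))" if "(step M w)\<^sup>*\<^sup>* c c'" for c'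
    using that
  proof (cases rule: converse_rtranclpE)
    case (step c1)
    then show ?thesis using goodD(2)[OF succ] by blast
  qed (use assms(1) in simp)
  have "(\<exists>c'. (step M w)\<^sup>*\<^sup>* c c' \<and> fst c' = acc M) \<longleftrightarrow>
      fst c = acc M \<or> (\<exists>c1. step M w c c1 \<and> (\<exists>c'. (step M w)\<^sup>*\<^sup>* c1 c' \<and> fst c' = acc M))"
    (is "?L \<longleftrightarrow> ?R")
  proof
    assume ?L
    then obtain c' where "(step M w)\<^sup>*\<^sup>* c c'" and a: "fst c' = acc M" by blast
    then show ?R by (cases rule: converse_rtranclpE) (simp, blast)
  next
    assume ?R
    then show ?L by (meson converse_rtranclp_into_rtranclp rtranclp.rtrancl_refl)
  qed
  also have "\<dots> \<longleftrightarrow> b"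
    unfolding assms(3) using goodD(3)[OF succ] by (intro disj_cong ex_cong1 conj_cong refl)
  finally show "(\<exists>c'. (step M w)\<^sup>*\<^sup>* c c' \<and> fst c' = acc M) = b" .
qed

text \<open>The first hypothesis gives \<open>l \<le> 1 + log 2 (n + 1)\<close>. Since
  \<open>log 2 (n + 2)\<close> is at least \<open>1\<close>, the summand is absorbed by the factor
  \<open>2\<close>, which is the space constant of the simulation.\<close>

lemma small_length:
  assumes "2 ^ (l - 1) \<le> n + 1" "l \<ge> 1" "j \<le> l"
  shows "small j"
proof -
  have "real (l - 1) \<le> log 2 (real (n + 1))"
    using assms(1) by (intro le_log_of_power) (metis of_nat_le_iff of_nat_numeral of_nat_power, simp)
  also have "\<dots> \<le> log 2 (real n + 2)" by simp
  finally have "real l \<le> 1 + log 2 (real n + 2)" using assms(2) by simp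
  moreover have "1 \<le> log 2 (real n + 2)" using log_le_cancel_iff[of 2 2 "real n + 2"] by simp
  ultimately show ?thesis using assms(3) unfolding small_def by linarith
qed

definition fits :: "bool list list \<Rightarrow> bool" where
  "fits cols \<longleftrightarrow> wide cols \<and> cols \<noteq> [] \<and> 2 ^ (length cols - 1) \<le> n + 1"

lemma good_conf:
  assumes "q \<in> ctrls" "q \<noteq> Acc" "fits cols" "j \<le> length cols"
    and "\<And>q' x d e. (q', x, d, e) \<in> tr q (read_inp w i) (get cols j) \<Longrightarrow>
      q' \<in> ctrls \<and> x \<in> cells \<and> d \<in> dirs \<and> e \<in> dirs \<and> (x = None \<longrightarrow> j = length cols) \<and>
      good (conf q' (min (n + 1) (nat (int i + d))) (put cols j x) (nat (int j + e))) (h q' x d e)"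
    and "b \<longleftrightarrow> (\<exists>q' x d e. (q', x, d, e) \<in> tr q (read_inp w i) (get cols j) \<and> h q' x d e)"
  shows "good (conf q i cols j) b"
proof -
  have w: "wide cols" using assms(3) by (simp add: fits_def)
  note mem = assms(5)
  have eq: "(q' \<in> ctrls \<and> x \<in> cells \<and> d \<in> dirs \<and> e \<in> dirs \<and>
      y = (cq q', min (n + 1) (nat (int i + d)), (tape cg cols)(j := cg x), nat (int j + e))) \<longleftrightarrow>
      y = conf q' (min (n + 1) (nat (int i + d))) (put cols j x) (nat (int j + e))"
    if "(q', x, d, e) \<in> tr q (read_inp w i) (get cols j)" for q' x d e y
    using mem[OF that] by (simp add: conf_def tape_put[OF assms(4)])
  have s: "step M w (conf q i cols j) y \<longleftrightarrow>
    (\<exists>q' x d e. (q', x, d, e) \<in> tr q (read_inp w i) (get cols j) \<and>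
      y = conf q' (min (n + 1) (nat (int i + d))) (put cols j x) (nat (int j + e)))" for y
    unfolding step_conf[OF assms(1) w assms(4)]
    by (intro iff_exI conj_cong refl) (rule eq)
  \<comment> \<open>\<open>good_step\<close> wants verdicts indexed by configurations, whereas
    \<open>h\<close> is indexed by actions; a good configuration has only one verdict, so
    \<open>THE\<close> recovers it.\<close>
  define H where "H c = (THE x. good c x)" for c
  have H: "H c = x" if "good c x" for c x
    unfolding H_def
  proof (rule the_equality)
    show "y = x" if "good c y" for y using goodD(3)[OF that] goodD(3)[OF \<open>good c x\<close>] by simp
  qed (rule that)
  have "cq q \<noteq> cq Acc" using assms(1,2) inj_onD[OF inj_cq, of q Acc] by auto
  then have na: "fst (conf q i cols j) \<noteq> acc M" by (simp add: conf_def M_def)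
  show ?thesis
  proof (rule good_step[where h = H])
    show "small (snd (snd (snd (conf q i cols j))))"
      using assms(3,4) small_length[of "length cols" j] by (simp add: conf_def fits_def Suc_le_eq)
    show "good c' (H c')" if st: "step M w (conf q i cols j) c'" for c'
    proof -
      obtain q' x d e where *: "(q', x, d, e) \<in> tr q (read_inp w i) (get cols j)"
        "c' = conf q' (min (n + 1) (nat (int i + d))) (put cols j x) (nat (int j + e))"
        using st unfolding s by blast
      then have "good c' (h q' x d e)" using mem by blast
      then show ?thesis using H by simp
    qed
    have "(\<exists>c'. step M w (conf q i cols j) c' \<and> H c') \<longleftrightarrow> b"
    proof
      assume "\<exists>c'. step M w (conf q i cols j) c' \<and> H c'"
      then obtain q' x d e where *: "(q', x, d, e) \<in> tr q (read_inp w i) (get cols j)"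
        "H (conf q' (min (n + 1) (nat (int i + d))) (put cols j x) (nat (int j + e)))"
        unfolding s by blast
      then have "h q' x d e" using H mem[OF *(1)] by blast
      then show b unfolding assms(6) using *(1) by blast
    next
      assume b
      then obtain q' x d e where *: "(q', x, d, e) \<in> tr q (read_inp w i) (get cols j)" "h q' x d e"
        unfolding assms(6) by blast
      then have "H (conf q' (min (n + 1) (nat (int i + d))) (put cols j x) (nat (int j + e)))"
        using H mem[OF *(1)] by blast
      then show "\<exists>c'. step M w (conf q i cols j) c' \<and> H c'" unfolding s using *(1) by blast
    qed
    then show "b \<longleftrightarrow> fst (conf q i cols j) = acc M \<or> (\<exists>c'. step M w (conf q i cols j) c' \<and> H c')"
      using na by simp
  qed
qed

lemma good_conf1:
  assumes "tr q (read_inp w i) (get cols j) = {(q', x, d, e)}" "fits cols" "j \<le> length cols"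
    and "q \<in> ctrls" "q \<noteq> Acc" "q' \<in> ctrls" "x \<in> cells" "d \<in> dirs" "e \<in> dirs" "x = None \<longrightarrow> j = length cols"
    and "good (conf q' (min (n + 1) (nat (int i + d))) (put cols j x) (nat (int j + e))) b"
  shows "good (conf q i cols j) b"
proof (rule good_conf[where h = "\<lambda>_ _ _ _. b"])
qed (use assms in simp_all)

fun scan :: "bool \<Rightarrow> bool list \<Rightarrow> bool list list \<Rightarrow> bool \<times> bool list \<times> bool list list" where
  "scan c es [] = (c, es, [])"
| "scan c es (col # cols) = (let (c', es', cols') =
     scan (c \<and> col ! K) (map2 (\<lambda>e x. e \<and> x = (col ! K \<noteq> c)) es (take K col)) cols
   in (c', es', col[K := (col ! K \<noteq> c)] # cols'))"

fun update :: "instr \<Rightarrow> bool list \<Rightarrow> bool list list \<Rightarrow> bool list \<times> bool list list" where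
  "update ops cs [] = (cs, [])"
| "update ops cs (col # cols) = (let (cs', cols') = update ops (upd_carry ops cs col) cols
     in (cs', (upd_bits ops cs col @ [False, col ! (K + 1)]) # cols'))"

lemma wide_simps [simp]: "wide []" "wide (c # cols) \<longleftrightarrow> length c = K + 2 \<and> wide cols"
  "wide (cols @ ds) \<longleftrightarrow> wide cols \<and> wide ds"
  by (auto simp: wide_def)

text \<open>Ripple-carry increment of track \<open>K\<close> with final carry \<open>c'\<close>. The
  pointer bits are compared with the counter bit just written, so a flag tests equality with the
  incremented counter.\<close>

lemma scan:
  assumes "scan c es cols = (c', es', cols')" "wide cols" "length es = K"
  shows "length cols' = length cols \<and> wide cols' \<and> length es' = K \<and>
    (\<forall>k. k \<noteq> K \<longrightarrow> track k cols' = track k cols) \<and>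
    bval (track K cols') + 2 ^ length cols * of_bool c' = bval (track K cols) + of_bool c \<and>
    (\<forall>k<K. es' ! k \<longleftrightarrow> es ! k \<and> track k cols = track K cols')"
  using assms
proof (induction cols arbitrary: c es cols')
  case (Cons col cols)
  define es1 where "es1 = map2 (\<lambda>e x. e \<and> x = (col ! K \<noteq> c)) es (take K col)"
  obtain cols1 where 1: "scan (c \<and> col ! K) es1 cols = (c', es', cols1)"
    and cols': "cols' = col[K := (col ! K \<noteq> c)] # cols1"
    using Cons.prems by (auto simp: es1_def split: prod.splits)
  have len: "length es1 = K" using Cons.prems by (simp add: es1_def)
  have es1: "es1 ! k \<longleftrightarrow> es ! k \<and> col ! k = (col ! K \<noteq> c)" if "k < K" for k
    using that Cons.prems by (simp add: es1_def)
  have IH: "length cols1 = length cols" "wide cols1" "length es' = K"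
    "\<And>k. k \<noteq> K \<Longrightarrow> track k cols1 = track k cols"
    "bval (track K cols1) + 2 ^ length cols * of_bool c' = bval (track K cols) + of_bool (c \<and> col ! K)"
    "\<And>k. k < K \<Longrightarrow> es' ! k \<longleftrightarrow> es1 ! k \<and> track k cols = track K cols1"
    using Cons.IH[OF 1 _ len] Cons.prems by auto
  have K: "col[K := x] ! K = x" for x using Cons.prems by simp
  have "bval (track K cols') + 2 ^ length (col # cols) * of_bool c'
      = bval (track K (col # cols)) + of_bool c"
    using IH(5) unfolding cols' track_simps K by (cases c; cases "col ! K") (auto simp: algebra_simps)
  then show ?case using IH Cons.prems es1 by (auto simp: cols' K)
qed auto

text \<open>The carry serves as a borrow when the move is \<open>Down\<close>. Carries that are
  initially true add or subtract one; \<open>Stay\<close> copies the source track whatever the carry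
  is.\<close>

lemma update:
  assumes "update ops cs cols = (cs', cols')" "wide cols" "length cs = K" "length ops = K"
  shows "length cols' = length cols \<and> wide cols' \<and> length cs' = K \<and>
    track (K + 1) cols' = track (K + 1) cols \<and> bval (track K cols') = 0 \<and>
    (\<forall>k<K. case ops ! k of (l, m) \<Rightarrow>
       (m = Stay \<longrightarrow> track k cols' = track l cols) \<and>
       (m = Up \<longrightarrow> bval (track k cols') + 2 ^ length cols * of_bool (cs' ! k) = bval (track l cols) + of_bool (cs ! k)) \<and>
       (m = Down \<longrightarrow> bval (track k cols') + of_bool (cs ! k) = bval (track l cols) + 2 ^ length cols * of_bool (cs' ! k)))"
  using assms
proof (induction cols arbitrary: cs cols')
  case (Cons col cols)
  define cs1 where "cs1 = upd_carry ops cs col"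
  obtain cols1 where 1: "update ops cs1 cols = (cs', cols1)"
    and cols': "cols' = (upd_bits ops cs col @ [False, col ! (K + 1)]) # cols1"
    using Cons.prems by (auto simp: cs1_def split: prod.splits)
  have len: "length cs1 = K" "length (upd_bits ops cs col) = K"
    using Cons.prems by (simp_all add: cs1_def upd_carry_def upd_bits_def)
  have W: "wide cols" "length ops = K" using Cons.prems by simp_all
  note IH = Cons.IH[OF 1 W(1) len(1) W(2)]
  have "case ops ! k of (l, m) \<Rightarrow>
       (m = Stay \<longrightarrow> track k cols' = track l (col # cols)) \<and>
       (m = Up \<longrightarrow> bval (track k cols') + 2 ^ length (col # cols) * of_bool (cs' ! k) = bval (track l (col # cols)) + of_bool (cs ! k)) \<and>
       (m = Down \<longrightarrow> bval (track k cols') + of_bool (cs ! k) = bval (track l (col # cols)) + 2 ^ length (col # cols) * of_bool (cs' ! k))"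
    if k: "k < K" for k
  proof -
    obtain l m where lm: "ops ! k = (l, m)" by force
    have b: "upd_bits ops cs col ! k = (if m = Stay then col ! l else col ! l \<noteq> cs ! k)"
      "cs1 ! k = (cs ! k \<and> (m = Up \<longrightarrow> col ! l) \<and> (m = Down \<longrightarrow> \<not> col ! l))"
      using k lm Cons.prems by (simp_all add: upd_bits_def cs1_def upd_carry_def)
    have t: "track k cols' = (upd_bits ops cs col ! k) # track k cols1"
      using k len by (simp add: cols' nth_append)
    have IHk: "(m = Stay \<longrightarrow> track k cols1 = track l cols) \<and>
       (m = Up \<longrightarrow> bval (track k cols1) + 2 ^ length cols * of_bool (cs' ! k) = bval (track l cols) + of_bool (cs1 ! k)) \<and>
       (m = Down \<longrightarrow> bval (track k cols1) + of_bool (cs1 ! k) = bval (track l cols) + 2 ^ length cols * of_bool (cs' ! k))"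
      using IH k lm by auto
    show ?thesis unfolding lm t using IHk
      by (cases m; cases "col ! l"; cases "cs ! k") (auto simp: b algebra_simps)
  qed
  then show ?case using IH Cons.prems len by (auto simp: cols' nth_append)
qed auto

text \<open>Pointers are stored with offset one because they are compared with the counter after its
  increment: at input position \<open>i\<close> it then holds \<open>i + 1\<close>.\<close>

definition enc :: "nat list \<Rightarrow> nat \<Rightarrow> bool list list \<Rightarrow> bool" where
  "enc v c cols \<longleftrightarrow> fits cols \<and> length v = K \<and> (\<forall>k<K. bval (track k cols) = Suc (v ! k)) \<and>
     bval (track K cols) = c \<and> track (K + 1) cols = True # replicate (length cols - 1) False"

lemma enc_marker:
  assumes "enc v c cols" "l < length cols"
  shows "cols ! l ! Suc K \<longleftrightarrow> l = 0"
proof -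
  have "cols ! l ! (K + 1) = track (K + 1) cols ! l" using assms by (simp add: track_def)
  then show ?thesis using assms by (cases l) (auto simp: enc_def)
qed

lemma fits_cong: "fits cols \<Longrightarrow> length cols' = length cols \<Longrightarrow> wide cols' \<Longrightarrow> fits cols'"
  by (auto simp: fits_def)

lemma fits_wide: "fits cols \<Longrightarrow> wide cols"
  by (simp add: fits_def)

lemma dirs [simp]: "- 1 \<in> dirs" "0 \<in> dirs" "1 \<in> dirs"
  by (auto simp: dirs_def)

lemma put_simps [simp]:
  "put cols j None = cols" "j < length cols \<Longrightarrow> put cols j (Some c) = cols[j := c]"
  "put cols (length cols) (Some c) = cols @ [c]"
  by (auto simp: put_def)

lemma get_simps [simp]: "j < length cols \<Longrightarrow> get cols j = Some (cols ! j)"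
  "get cols (length cols) = None" "get [] 0 = None"
  by (auto simp: get_def)

lemma nat_pred [simp]: "nat (int m - 1) = m - Suc 0"
  by simp

lemma good_ScanR:
  assumes "s \<in> S" "rd \<in> infos" "i \<le> n + 1" "fits (pre @ cols)" "length es = K"
    and "scan c es cols = (c', es', cols')"
    and "good (conf (ScanR s rd c' es') i (pre @ cols') (length pre + length cols)) b"
  shows "good (conf (ScanR s rd c es) i (pre @ cols) (length pre)) b"
  using assms(4-)
proof (induction cols arbitrary: pre c es cols')
  case (Cons col cols)
  define es1 where "es1 = map2 (\<lambda>e x. e \<and> x = (col ! K \<noteq> c)) es (take K col)"
  define col1 where "col1 = col[K := (col ! K \<noteq> c)]"
  obtain cols1 where 1: "scan (c \<and> col ! K) es1 cols = (c', es', cols1)" "cols' = col1 # cols1"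
    using Cons.prems by (auto simp: es1_def col1_def split: prod.splits)
  have col: "length col = K + 2" using fits_wide[OF Cons.prems(1)] by simp
  have len: "length es1 = K" using Cons.prems col by (simp add: es1_def)
  have fits: "fits ((pre @ [col1]) @ cols)"
    using Cons.prems(1) col by (auto simp: fits_def col1_def)
  have "good (conf (ScanR s rd (c \<and> col ! K) es1) i ((pre @ [col1]) @ cols) (length (pre @ [col1]))) b"
    using Cons.prems(4) 1(2) by (intro Cons.IH[OF fits len 1(1)]) simp
  note prev = this
  show ?case
    by (rule good_conf1[where q' = "ScanR s rd (c \<and> col ! K) es1" and x = "Some col1" and d = 0 and e = 1])
      (use prev assms(1-3) Cons.prems(1,2) col len in \<open>simp_all add: es1_def col1_def nat_add_distrib\<close>)
qed auto

lemma good_UpdR: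
  assumes "s \<in> S" "ops \<in> instrs" "i \<le> n + 1" "fits (pre @ cols)" "length cs = K"
    and "update ops cs cols = (cs', cols')"
    and "good (conf (UpdR s ops cs') i (pre @ cols') (length pre + length cols)) b"
  shows "good (conf (UpdR s ops cs) i (pre @ cols) (length pre)) b"
  using assms(4-)
proof (induction cols arbitrary: pre cs cols')
  case (Cons col cols)
  define cs1 where "cs1 = upd_carry ops cs col"
  define col1 where "col1 = upd_bits ops cs col @ [False, col ! (K + 1)]"
  obtain cols1 where 1: "update ops cs1 cols = (cs', cols1)" "cols' = col1 # cols1"
    using Cons.prems by (auto simp: cs1_def col1_def split: prod.splits)
  have col: "length col1 = K + 2" using Cons.prems assms(2)
    by (auto simp: col1_def upd_bits_def instrs_def)
  have len: "length cs1 = K" using Cons.prems assms(2) by (auto simp: cs1_def upd_carry_def instrs_def)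
  have fits: "fits ((pre @ [col1]) @ cols)"
    using Cons.prems(1) col by (auto simp: fits_def)
  have "good (conf (UpdR s ops cs1) i ((pre @ [col1]) @ cols) (length (pre @ [col1]))) b"
    using Cons.prems(4) 1(2) by (intro Cons.IH[OF fits len 1(1)]) simp
  note prev = this
  show ?case
    by (rule good_conf1[where q' = "UpdR s ops cs1" and x = "Some col1" and d = 0 and e = 1])
      (use prev assms(1-3) Cons.prems(1,2) col len in \<open>simp_all add: cs1_def col1_def nat_add_distrib\<close>)
qed auto

lemma good_ScanL:
  assumes "s \<in> S" "rd \<in> infos" "i \<le> n + 1" "length es = K" "enc v c cols"
    and "good (conf (ScanL s rd es) i cols 0) b"
  shows "j < length cols \<Longrightarrow> good (conf (ScanL s rd es) i cols j) b"
proof (induction j)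
  case (Suc j)
  note prev = this
  show ?case
    by (rule good_conf1[where q' = "ScanL s rd es" and x = "Some (cols ! Suc j)" and d = 0 and e = "- 1"])
      (use prev assms enc_marker[OF assms(5), of "Suc j"] in \<open>auto simp: enc_def fits_def wide_def\<close>)
qed (use assms in simp)

lemma good_UpdL:
  assumes "s \<in> S" "i \<le> n + 1" "enc v c cols"
    and "good (conf (UpdL s) i cols 0) b"
  shows "j < length cols \<Longrightarrow> good (conf (UpdL s) i cols j) b"
proof (induction j)
  case (Suc j)
  note prev = this
  show ?case
    by (rule good_conf1[where q' = "UpdL s" and x = "Some (cols ! Suc j)" and d = 0 and e = "- 1"])
      (use prev assms enc_marker[OF assms(3), of "Suc j"] in \<open>auto simp: enc_def fits_def wide_def\<close>)
qed (use assms in simp)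

lemma good_Rew:
  assumes "s \<in> S" "fits cols" "good (conf (Rew s) 0 cols 0) b"
  shows "i \<le> n + 1 \<Longrightarrow> good (conf (Rew s) i cols 0) b"
proof (induction i)
  case (Suc i)
  have "get cols 0 \<in> cells" "get cols 0 = None \<longrightarrow> 0 = length cols" "put cols 0 (get cols 0) = cols"
    using assms(2) by (auto simp: get_def fits_def wide_def put_def)
  moreover have "read_inp w (Suc i) \<noteq> LEnd" by (simp add: read_inp_def)
  moreover note prems = assms calculation Suc
  show ?case
    by (rule good_conf1[where q' = "Rew s" and x = "get cols 0" and d = "- 1" and e = 0])
      (use prems in auto)
qed (use assms in simp)

lemma enc_length: "enc v c cols \<Longrightarrow> 0 < length cols"
  by (auto simp: enc_def fits_def)

lemma enc_first_cell:
  assumes "enc v c cols"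
  shows "fits cols" "get cols 0 = Some (cols ! 0)" "put cols 0 (Some (cols ! 0)) = cols"
    "length (cols ! 0) = Suc (Suc K)" "cols ! 0 ! Suc K"
  using assms enc_length[OF assms] enc_marker[OF assms, of 0] by (auto simp: enc_def fits_def wide_def)

definition reading :: "nat \<Rightarrow> bool list \<Rightarrow> info \<Rightarrow> info" where
  "reading i es rd = map2 (\<lambda>e x. if e then (read_inp w i, es) else x) es rd"

lemma read_inp: "i \<le> n \<Longrightarrow> read_inp w i \<in> insert LEnd (Sym ` Sig)" "i \<le> n \<Longrightarrow> read_inp w i \<noteq> REnd"
  "read_inp w (Suc n) = REnd"
  using w nth_mem[of "i - 1" w] by (auto simp: read_inp_def subset_iff)

lemma reading_infos:
  assumes "rd \<in> infos" "length es = K" "i \<le> n"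
  shows "reading i es rd \<in> infos"
proof -
  let ?A = "insert LEnd (Sym ` Sig) \<times> {es. length es = K}"
  have rd: "set rd \<subseteq> ?A" "length rd = K" using assms(1) by (simp_all add: infos_def)
  have "reading i es rd ! k \<in> ?A" if k: "k < K" for k
  proof (cases "es ! k")
    case True
    then have "reading i es rd ! k = (read_inp w i, es)" using k rd assms(2) by (simp add: reading_def)
    then show ?thesis using read_inp(1)[OF assms(3)] assms(2) by simp
  next
    case False
    then have "reading i es rd ! k = rd ! k" using k rd assms(2) by (simp add: reading_def)
    then show ?thesis using subsetD[OF rd(1) nth_mem, of k] k rd(2) by simp
  qed
  moreover have "length (reading i es rd) = K" using rd assms(2) by (simp add: reading_def)
  moreover from calculation have "set (reading i es rd) \<subseteq> ?A"
    by (metis in_set_conv_nth subsetI)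
  ultimately show ?thesis by (simp add: infos_def)
qed

lemma bval_track_less: "length cols = l \<Longrightarrow> bval (track k cols) < 2 ^ l"
  using bval_less[of "track k cols"] by simp

lemma good_scan_position:
  assumes "s \<in> S" "rd \<in> infos" "i \<le> n" "enc v i cols"
    and nxt: "\<And>cols'. enc v (Suc i) cols' \<Longrightarrow>
      good (conf (Chk s (reading i (map (\<lambda>x. x = i) v) rd) (map (\<lambda>x. x = i) v)) (Suc i) cols' 0) b"
  shows "good (conf (ScanR s rd True (replicate K True)) i cols 0) b"
proof -
  define es where "es = map (\<lambda>x. x = i) v"
  obtain c' es' cols' where sc: "scan True (replicate K True) cols = (c', es', cols')"
    by (metis prod_cases3)
  have fits: "fits cols" and v: "length v = K" "\<And>k. k < K \<Longrightarrow> bval (track k cols) = Suc (v ! k)"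
    "bval (track K cols) = i" "track (K + 1) cols = True # replicate (length cols - 1) False"
    using assms by (auto simp: enc_def)
  have len: "length cols' = length cols" "wide cols'" "length es' = K"
    and tr: "\<And>k. k \<noteq> K \<Longrightarrow> track k cols' = track k cols"
    and val: "bval (track K cols') + 2 ^ length cols * of_bool c' = Suc i"
    and es': "\<And>k. k < K \<Longrightarrow> es' ! k \<longleftrightarrow> track k cols = track K cols'"
    using scan[OF sc fits_wide[OF fits]] v by auto
  have les: "length es = K" using v by (simp add: es_def)
  define cols2 where "cols2 = (if c' then cols' @ [replicate K False @ [True, False]] else cols')"
  have ne: "cols \<noteq> []" using fits by (auto simp: fits_def)
  have enc2: "enc v (Suc i) cols2"
  proof (cases c')
    case True
    \<comment> \<open>Overflow happens only when the counter reaches the power of two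
      \<open>i + 1 = 2 ^ length cols\<close>, which is at most \<open>n + 1\<close>; this keeps the
      tape logarithmic.\<close>
    then have "2 ^ length cols \<le> n + 1" using val assms(3) by simp
    then have "fits cols2" using True len ne by (simp add: cols2_def fits_def)
    moreover have "track (K + 1) cols2 = True # replicate (length cols2 - 1) False"
      using True ne tr v(4) len
      by (cases cols) (auto simp: cols2_def nth_append replicate_append_same)
    ultimately show ?thesis
      using True v val len tr by (auto simp: enc_def cols2_def bval_append nth_append)
  next
    case False
    then show ?thesis using fits fits_cong[OF fits len(1,2)] v val tr len
      by (auto simp: enc_def cols2_def)
  qed
  have es2: "(if c' then replicate K False else es') = es"
  proof (rule nth_equalityI)
    fix k assume "k < length (if c' then replicate K False else es')"
    then have k: "k < K" using len by (auto split: if_splits)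
    have "Suc (v ! k) < 2 ^ length cols" using v(2)[OF k] bval_track_less[of cols _ k] by simp
    moreover have "es' ! k \<longleftrightarrow> Suc (v ! k) = bval (track K cols')"
      using es'[OF k] v(2)[OF k] bval_inj[of "track k cols" "track K cols'"] len by simp
    ultimately show "(if c' then replicate K False else es') ! k = es ! k"
      using k v(1) val by (auto simp: es_def)
  qed (use les len in simp)
  have "good (conf (Chk s (reading i es rd) es) (Suc i) cols2 0) b"
    using nxt[OF enc2] by (simp add: es_def)
  note prev = this
  have "good (conf (ScanL s rd es) i cols2 0) b"
    by (rule good_conf1[where q' = "Chk s (reading i es rd) es" and x = "Some (cols2 ! 0)" and d = 1 and e = 0])
      (use prev assms(1-3) enc_first_cell[OF enc2] reading_infos[OF assms(2) les assms(3)] les in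
        \<open>simp_all add: reading_def nat_add_distrib\<close>)
  then have "good (conf (ScanL s rd es) i cols2 (length cols - 1)) b"
    using good_ScanL[OF assms(1,2) _ les enc2, of i b "length cols - 1"] assms(3) len ne
    by (auto simp: cols2_def)
  note prev = this
  have fits': "fits cols'" by (rule fits_cong[OF fits len(1,2)])
  have "good (conf (ScanR s rd c' es') i cols' (length cols')) b"
  proof (cases c')
    case True
    show ?thesis
      by (rule good_conf1[where q' = "ScanL s rd es" and d = 0 and e = "- 1"
            and x = "Some (replicate K False @ [True, False])"])
        (use prev assms(1-3) les len(1)[symmetric] len(3) fits' es2 ne True in
          \<open>simp_all add: cols2_def\<close>)
  next
    case False
    show ?thesis
      by (rule good_conf1[where q' = "ScanL s rd es" and d = 0 and e = "- 1" and x = None])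
        (use prev assms(1-3) les len(1)[symmetric] len(3) fits' es2 ne False in
          \<open>simp_all add: cols2_def\<close>)
  qed
  then show ?thesis
    using good_ScanR[OF assms(1,2), of i "[]" cols "replicate K True", OF _ _ _ sc] assms(3) fits len by simp
qed

text \<open>While the input head runs from \<open>i\<close> to \<open>n\<close>, the record
  \<open>rd\<close> is correct for the pointers below \<open>i\<close>; its other entries are still
  to be overwritten.\<close>

lemma good_scan:
  assumes "s \<in> S" "i \<le> n" "\<forall>x\<in>set v. x \<le> n" "length v = K"
    and fin: "\<And>cols'. enc v (Suc n) cols' \<Longrightarrow>
      good (conf (Chk s (info w v) (map (\<lambda>x. x = n) v)) (Suc n) cols' 0) b"
    and "enc v i cols" "rd \<in> infos" "\<forall>k<K. v ! k < i \<longrightarrow> rd ! k = info w v ! k"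
  shows "good (conf (ScanR s rd True (replicate K True)) i cols 0) b"
  using assms(2,6-)
proof (induction i arbitrary: rd cols rule: inc_induct)
  case base
  have "length rd = K" using base by (simp add: infos_def)
  moreover have "v ! k = n \<or> v ! k < n" if "k < K" for k using assms(3,4) that by (auto simp: le_less)
  ultimately have "reading n (map (\<lambda>x. x = n) v) rd = info w v"
    using base(3) assms(4) by (intro nth_equalityI) (auto simp: reading_def info_def)
  then show ?case using good_scan_position[OF assms(1) base(2) le_refl base(1)] fin by simp
next
  case (step i)
  let ?es = "map (\<lambda>x. x = i) v"
  have rd: "reading i ?es rd \<in> infos" using step.hyps step.prems assms(4) by (intro reading_infos) auto
  have pos: "\<forall>k<K. v ! k < Suc i \<longrightarrow> reading i ?es rd ! k = info w v ! k"
    using step.prems assms(4) by (auto simp: reading_def info_def infos_def less_Suc_eq)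
  show ?case
  proof (rule good_scan_position[OF assms(1) step.prems(2) _ step.prems(1)])
    fix cols' assume enc: "enc v (Suc i) cols'"
    have "good (conf (ScanR s (reading i ?es rd) True (replicate K True)) (Suc i) cols' 0) b"
      by (rule step.IH[OF enc rd pos])
    note prev = this
    show "good (conf (Chk s (reading i ?es rd) ?es) (Suc i) cols' 0) b"
      by (rule good_conf1[where q' = "ScanR s (reading i ?es rd) True (replicate K True)"
            and x = "Some (cols' ! 0)" and d = 0 and e = 0])
      (use prev assms(1,4) rd enc_first_cell[OF enc] read_inp(2)[of "Suc i"] step.hyps in
        \<open>simp_all add: nat_add_distrib\<close>)
  qed (use step.hyps in simp)
qed

lemma adjust_instrs:
  assumes "length ops = K" "fst ` set ops \<subseteq> {..<K}"
  shows "map (adjust rd es) ops \<in> instrs"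
proof -
  have "adjust rd es km \<in> {..<K + 2} \<times> {Stay, Up, Down}" if "km \<in> set ops" for km
  proof -
    obtain k m where km: "km = (k, m)" by force
    then have "k < K" using assms(2) that by force
    then show ?thesis by (cases m) (auto simp: km adjust_def)
  qed
  then have "set (map (adjust rd es) ops) \<subseteq> {..<K + 2} \<times> {Stay, Up, Down}"
    unfolding set_map by (rule image_subsetI)
  then show ?thesis using assms(1) unfolding instrs_def by simp
qed

lemma good_update:
  assumes "s \<in> S" "length ops = K" "fst ` set ops \<subseteq> {..<K}" "\<forall>x\<in>set v. x \<le> n" "enc v (Suc n) cols"
    and fin: "\<And>cols'. enc (upd n ops v) 0 cols' \<Longrightarrow> good (conf (Rew s) (Suc n) cols' 0) b"
  shows "good (conf (UpdR s (map (adjust (info w v) (map (\<lambda>x. x = n) v)) ops) (replicate K True)) (Suc n) cols 0) b"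
proof -
  define aops where "aops = map (adjust (info w v) (map (\<lambda>x. x = n) v)) ops"
  obtain cs' cols' where up: "update aops (replicate K True) cols = (cs', cols')" by force
  have fits: "fits cols" and v: "length v = K" "\<And>k. k < K \<Longrightarrow> bval (track k cols) = Suc (v ! k)"
    "bval (track K cols) = Suc n" "track (K + 1) cols = True # replicate (length cols - 1) False"
    using assms by (auto simp: enc_def)
  have aops: "aops \<in> instrs" "length aops = K"
    using adjust_instrs[OF assms(2,3)] assms(2) by (simp_all add: aops_def)
  have U: "length cols' = length cols" "wide cols'" "length cs' = K"
    "track (K + 1) cols' = track (K + 1) cols" "bval (track K cols') = 0"
    and Uk: "\<And>k l m. k < K \<Longrightarrow> aops ! k = (l, m) \<Longrightarrow>
       (m = Stay \<longrightarrow> track k cols' = track l cols) \<and>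
       (m = Up \<longrightarrow> bval (track k cols') + 2 ^ length cols * of_bool (cs' ! k) = Suc (bval (track l cols))) \<and>
       (m = Down \<longrightarrow> Suc (bval (track k cols')) = bval (track l cols) + 2 ^ length cols * of_bool (cs' ! k))"
    using update[OF up fits_wide[OF fits]] aops by fastforce+
  have one: "bval (track (K + 1) cols) = 1" unfolding v(4) by simp
  have "bval (track k cols') = Suc (upd n ops v ! k)" if k: "k < K" for k
  proof -
    obtain l m where lm: "ops ! k = (l, m)" by force
    then have l: "l < K" using assms(2,3) k nth_mem[of k ops] by force
    have upd: "upd n ops v ! k = mv n m (v ! l)" using k assms(2) by (simp add: upd_def lm)
    have a: "aops ! k = adjust (info w v) (map (\<lambda>x. x = n) v) (l, m)"
      using k assms(2) by (simp add: aops_def lm)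
    have vl: "v ! l \<le> n" using l v assms(4) by simp
    have rd: "fst (info w v ! l) = LEnd \<longleftrightarrow> v ! l = 0"
      using l v vl by (simp add: info_def read_inp_def)
    have lt: "bval (track j cols') < 2 ^ length cols" "bval (track j cols) < 2 ^ length cols" for j
      using bval_track_less U(1) by auto
    show ?thesis
    proof (cases m)
      case Stay
      then show ?thesis using Uk[OF k] a l v upd by (simp add: adjust_def)
    next
      case Up
      show ?thesis
      proof (cases "v ! l = n")
        case True
        then show ?thesis using Uk[OF k] a l v upd Up one by (simp add: adjust_def)
      next
        case False
        then have "aops ! k = (l, Up)" using a l v Up by (simp add: adjust_def)
        \<comment> \<open>The counter track holds \<open>n + 1\<close> in the same columns, and the
          encoding of a pointer below \<open>n\<close> does not exceed this value after the
          increment: no carry is left.\<close>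
        moreover have "Suc (Suc (v ! l)) < 2 ^ length cols" using lt(2)[of K] v(3) vl False by simp
        ultimately show ?thesis using Uk[OF k] v(2)[OF l] upd False Up by (cases "cs' ! k") fastforce+
      qed
    next
      case Down
      show ?thesis
      proof (cases "v ! l = 0")
        case True
        then show ?thesis using Uk[OF k] a l v upd Down rd by (simp add: adjust_def)
      next
        case False
        then have "aops ! k = (l, Down)" using a l v Down rd by (simp add: adjust_def)
        then show ?thesis using Uk[OF k] v(2)[OF l] upd False Down lt(1)[of k] by (cases "cs' ! k") fastforce+
      qed
    qed
  qed
  then have enc: "enc (upd n ops v) 0 cols'"
    using U v fits_cong[OF fits U(1,2)] assms(2) by (simp add: enc_def upd_def)
  have "good (conf (UpdL s) (Suc n) cols' 0) b"
    by (rule good_conf1[where q' = "Rew s" and x = "Some (cols' ! 0)" and d = 0 and e = 0])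
      (use assms(1) fin[OF enc] enc enc_length[OF enc] enc_marker[OF enc, of 0] in \<open>auto simp: enc_def fits_def wide_def\<close>)
  then have "good (conf (UpdL s) (Suc n) cols' (length cols' - 1)) b"
    using assms(1) enc_length[OF enc] by (simp add: good_UpdL[OF _ _ enc])
  note prev = this
  have "good (conf (UpdR s aops cs') (Suc n) cols' (length cols')) b"
    by (rule good_conf1[where q' = "UpdL s" and d = 0 and e = "- 1" and x = None])
      (use prev assms(1) aops U(3) fits_cong[OF fits U(1,2)] in simp_all)
  then show ?thesis
    using good_UpdR[OF assms(1) aops(1), of "Suc n" "[]" cols "replicate K True", OF _ _ _ up] fits U
    by (simp add: aops_def)
qed

lemma small_0: "small 0"
  using small_length[of 1 0] by simp

lemma good_Acc:
  assumes "fits cols"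
  shows "good (conf Acc i cols 0) True"
proof -
  have "\<not> step M w (conf Acc i cols 0) y" for y
    using step_conf[where q = Acc and cols = cols and j = 0 and i = i] fits_wide[OF assms] by simp
  then show ?thesis
    by (rule_tac good_step[where h = "\<lambda>_. True"]) (simp_all add: conf_def M_def small_0)
qed

lemma good_outcome:
  assumes "outcome \<delta> sacc w (s, v) b"
  shows "s \<in> S \<Longrightarrow> length v = K \<Longrightarrow> \<forall>x\<in>set v. x \<le> n \<Longrightarrow> enc v 0 cols \<Longrightarrow> i \<le> n + 1 \<Longrightarrow>
    good (conf (Rew s) i cols 0) b"
  using assms
proof (induction "(s, v)" b arbitrary: s v cols i rule: outcome.induct)
  case (outcome_acc v)
  then have enc: "enc v 0 cols" by simp
  have "good (conf (Rew sacc) 0 cols 0) True"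
    by (rule good_conf1[where q' = Acc and x = "Some (cols ! 0)" and d = 0 and e = 0])
      (use good_Acc sacc enc_first_cell[OF enc] in \<open>simp_all add: read_inp_def\<close>)
  then show ?case
    using good_Rew[OF sacc enc_first_cell(1)[OF enc]] outcome_acc.prems by blast
next
  case (outcome_step s v h b)
  note s = outcome_step.prems(1) and v = outcome_step.prems(2,3)
  let ?rd0 = "replicate K (LEnd, replicate K False)"
  have rd0: "?rd0 \<in> infos" by (auto simp: infos_def)
  have rd: "info w v \<in> infos" using read_inp(1) v by (auto simp: infos_def info_def)
  let ?es = "map (\<lambda>x. x = n) v"
  have "good (conf (Chk s (info w v) ?es) (Suc n) cols' 0) b" if enc: "enc v (Suc n) cols'" for cols'
  proof (rule good_conf[where h = "\<lambda>q' _ _ _. \<exists>s' ops. (s', ops) \<in> \<delta> s (info w v) \<and>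
      q' = UpdR s' (map (adjust (info w v) ?es) ops) (replicate K True) \<and> h (s', upd n ops v)"])
    show "Chk s (info w v) ?es \<in> ctrls" "fits cols'" "0 \<le> length cols'"
      using s rd v enc by (simp_all add: enc_def)
    have g: "get cols' 0 = Some (cols' ! 0)" "length (cols' ! 0) = K + 2"
      using enc_length[OF enc] enc by (auto simp: enc_def fits_def wide_def)
    have trs: "tr (Chk s (info w v) ?es) (read_inp w (Suc n)) (get cols' 0) =
      (\<lambda>(s', ops). (UpdR s' (map (adjust (info w v) ?es) ops) (replicate K True), Some (cols' ! 0), 0, 0)) ` \<delta> s (info w v)"
      by (simp add: read_inp(3) g)
    have pst: "pstep \<delta> w (s, v) (s', upd n ops v)" if "(s', ops) \<in> \<delta> s (info w v)" for s' ops
      using that by (auto simp: pstep_def)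
    have upd: "good (conf (UpdR s' (map (adjust (info w v) ?es) ops) (replicate K True)) (Suc n) cols' 0)
        (h (s', upd n ops v))"
      if ops: "(s', ops) \<in> \<delta> s (info w v)" for s' ops
    proof -
      have p: "s' \<in> S" "length ops = K" "fst ` set ops \<subseteq> {..<K}" using prog[OF s ops] by auto
      have len: "length (upd n ops v) = K" using p(2) by (simp add: upd_def)
      have le: "\<forall>x\<in>set (upd n ops v). x \<le> n"
      proof
        fix x assume "x \<in> set (upd n ops v)"
        then obtain k m where km: "(k, m) \<in> set ops" "x = mv n m (v ! k)" by (auto simp: upd_def)
        then have "k < K" using p(3) by force
        then show "x \<le> n" using v km(2) by (simp add: mv_le)
      qed
      show ?thesis
      proof (rule good_update[OF p v(2) enc])
        fix cols2 assume "enc (upd n ops v) 0 cols2"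
        then show "good (conf (Rew s') (Suc n) cols2 0) (h (s', upd n ops v))"
          using outcome_step.hyps(3)[OF pst[OF ops] p(1) len le] by simp
      qed
    qed
    show "q' \<in> ctrls \<and> x \<in> cells \<and> d \<in> dirs \<and> e \<in> dirs \<and> (x = None \<longrightarrow> 0 = length cols') \<and>
      good (conf q' (min (n + 1) (nat (int (Suc n) + d))) (put cols' 0 x) (nat (int 0 + e)))
       (\<exists>s' ops. (s', ops) \<in> \<delta> s (info w v) \<and>
      q' = UpdR s' (map (adjust (info w v) ?es) ops) (replicate K True) \<and> h (s', upd n ops v))"
      if tr: "(q', x, d, e) \<in> tr (Chk s (info w v) ?es) (read_inp w (Suc n)) (get cols' 0)" for q' x d e
    proof -
      obtain s' ops where ops: "(s', ops) \<in> \<delta> s (info w v)"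
        and q': "q' = UpdR s' (map (adjust (info w v) ?es) ops) (replicate K True)"
          "x = Some (cols' ! 0)" "d = 0" "e = 0"
        using tr unfolding trs by auto
      \<comment> \<open>Different instructions may be adjusted to the same action; they then lead to
        the same machine configuration and share its verdict.\<close>
      have uniq: "h (s'', upd n ops' v) = h (s', upd n ops v)"
        if "(s'', ops') \<in> \<delta> s (info w v)"
          "q' = UpdR s'' (map (adjust (info w v) ?es) ops') (replicate K True)" for s'' ops'
        using goodD(3)[OF upd[OF that(1)]] goodD(3)[OF upd[OF ops]] that(2) q'(1) by simp
      have p: "s' \<in> S" "length ops = K" "fst ` set ops \<subseteq> {..<K}" using prog[OF s ops] by auto
      have "(\<exists>s' ops. (s', ops) \<in> \<delta> s (info w v) \<and>
        q' = UpdR s' (map (adjust (info w v) ?es) ops) (replicate K True) \<and> h (s', upd n ops v))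
        \<longleftrightarrow> h (s', upd n ops v)"
        using uniq ops q'(1) by blast
      then show ?thesis
        using upd[OF ops] adjust_instrs[OF p(2,3)] p(1) g enc_length[OF enc] q' by simp
    qed
    show "b \<longleftrightarrow> (\<exists>q' x d e. (q', x, d, e) \<in> tr (Chk s (info w v) ?es) (read_inp w (Suc n)) (get cols' 0) \<and>
      (\<exists>s' ops. (s', ops) \<in> \<delta> s (info w v) \<and>
      q' = UpdR s' (map (adjust (info w v) ?es) ops) (replicate K True) \<and> h (s', upd n ops v)))"
    proof
      assume b
      then obtain s' ops where ops: "(s', ops) \<in> \<delta> s (info w v)" "h (s', upd n ops v)"
        using outcome_step.hyps(4) by (auto simp: pstep_def)
      have "(UpdR s' (map (adjust (info w v) ?es) ops) (replicate K True), Some (cols' ! 0), 0, 0)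
        \<in> tr (Chk s (info w v) ?es) (read_inp w (Suc n)) (get cols' 0)"
        unfolding trs using ops(1) by (rule rev_image_eqI) simp
      then show "\<exists>q' x d e. (q', x, d, e) \<in> tr (Chk s (info w v) ?es) (read_inp w (Suc n)) (get cols' 0) \<and>
      (\<exists>s' ops. (s', ops) \<in> \<delta> s (info w v) \<and>
      q' = UpdR s' (map (adjust (info w v) ?es) ops) (replicate K True) \<and> h (s', upd n ops v))"
        using ops by blast
    qed (use outcome_step.hyps(4) pst in blast)
  qed simp
  then have "good (conf (ScanR s ?rd0 True (replicate K True)) 0 cols 0) b"
    using good_scan[OF s _ v(2,1) _ outcome_step.prems(4) rd0] by simp
  note prev = this
  have "good (conf (Rew s) 0 cols 0) b"
    by (rule good_conf1[where q' = "ScanR s ?rd0 True (replicate K True)" and x = "Some (cols ! 0)" and d = 0 and e = 0])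
      (use prev outcome_step.hyps(1) s rd0 enc_first_cell[OF outcome_step.prems(4)] in \<open>simp_all add: read_inp_def\<close>)
  then show ?case
    using good_Rew[OF s enc_first_cell(1)] outcome_step.prems(4,5) by blast
qed

lemma good_init:
  assumes "outcome \<delta> sacc w (sini, replicate K 0) b"
  shows "good (init_config M) b"
proof -
  \<comment> \<open>All pointer tracks hold \<open>1\<close>, which encodes position
    \<open>0\<close>; the counter is \<open>0\<close> and the marker is set.\<close>
  define col where "col = replicate K True @ [False, True]"
  have "enc (replicate K 0) 0 [col]"
    by (auto simp: enc_def fits_def col_def nth_append)
  then have g: "good (conf (Rew sini) 0 [col] 0) b"
    using good_outcome[OF assms sini] by simp
  have init: "init_config M = conf Start 0 [] 0"
    by (simp add: init_config_def conf_def M_def tape_def cg_None fun_eq_iff)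
  have step: "step M w (conf Start 0 [] 0) y \<longleftrightarrow> y = conf (Rew sini) 0 [col] 0" for y
    using step_conf[of Start "[]" 0 w 0 y] sini tape_put[of 0 "[]" "Some col" cg]
    by (simp add: col_def conf_def put_def)
  have "cq Start \<noteq> cq Acc" using inj_onD[OF inj_cq, of Start Acc] by auto
  then show ?thesis unfolding init using g
    by (rule_tac good_step[where h = "\<lambda>_. b"])
      (simp_all add: step, simp_all add: conf_def M_def small_0)
qed

lemma simulates:
  assumes "outcome \<delta> sacc w (sini, replicate K 0) b"
  shows "log_space M 2 w" "halts M w" "accepts M w \<longleftrightarrow> b"
proof -
  note good = goodD[OF good_init[OF assms]]
  show "log_space M 2 w"
    unfolding log_space_def reachable_def using good(2) by (fastforce simp: small_def)
  show "accepts M w \<longleftrightarrow> b"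
    unfolding accepts_def reachable_def using good(3) .
  have "Wellfounded.accp (\<lambda>c' c. step M w c c') c" if "reachable M w c" for c
    using that unfolding reachable_def
  proof (induction rule: rtranclp_induct)
    case base
    show ?case by (rule good(1))
  next
    case (step c c')
    show ?case by (rule accp_downward[OF step.IH step.hyps(2)])
  qed
  moreover have "(\<lambda>c' c. reachable M w c \<and> step M w c c') \<le> (\<lambda>c' c. step M w c c')" by auto
  ultimately have acc: "Wellfounded.accp (\<lambda>c' c. reachable M w c \<and> step M w c c') c" if "reachable M w c" for c
    using that accp_subset by blast
  \<comment> \<open>An unreachable configuration has no successor in the restricted relation and is
    accessible for that reason.\<close>
  have "Wellfounded.accp (\<lambda>c' c. reachable M w c \<and> step M w c c') c" for c
    by (cases "reachable M w c") (rule acc, assumption, rule accp.accI, simp)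
  then show "halts M w" unfolding halts_def by (rule accp_wfpI[rule_format])
qed

end

section \<open>Searching for long walks\<close>

lemma pred_div:
  fixes y b :: nat
  assumes "0 < y" "0 < b"
  shows "(y - 1) div b = (if b dvd y then y div b - 1 else y div b)"
proof (cases "b dvd y")
  case True
  then obtain q where q: "y = b * q" by blast
  then obtain q' where "q = Suc q'" using assms by (cases q) auto
  moreover obtain b' where b: "b = Suc b'" using assms by (cases b) auto
  ultimately have "y - 1 = b' + b * q'" using q by (simp add: algebra_simps)
  then have "(y - 1) div b = q'" using b by (simp only: div_mult_self2) simp
  then show ?thesis using True q \<open>q = Suc q'\<close> assms by simp
next
  case False
  obtain y' where y': "y = Suc y'" using assms by (cases y) auto
  then show ?thesis using False by (simp add: div_Suc dvd_eq_mod_eq_0)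
qed

lemma pred_mod:
  fixes y b :: nat
  assumes "0 < y" "0 < b"
  shows "(y - 1) mod b = (if b dvd y then b - 1 else y mod b - 1)"
proof (cases "b dvd y")
  case True
  then obtain q where q: "y = b * q" by blast
  then obtain q' where "q = Suc q'" using assms by (cases q) auto
  moreover obtain b' where b: "b = Suc b'" using assms by (cases b) auto
  ultimately have "y - 1 = b' + b * q'" using q by (simp add: algebra_simps)
  then have "(y - 1) mod b = b'" using b by (simp only: mod_mult_self2) simp
  then show ?thesis using True b by simp
next
  case False
  obtain y' where y': "y = Suc y'" using assms by (cases y) auto
  then show ?thesis using False by (auto simp: mod_Suc dvd_eq_mod_eq_0 split: if_splits)
qed

definition digits :: "nat \<Rightarrow> nat \<Rightarrow> nat \<Rightarrow> nat list" where
  "digits N L y = map (\<lambda>k. y div N ^ k mod N) [0..<L]"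

lemma length_digits [simp]: "length (digits N L y) = L"
  by (simp add: digits_def)

lemma digits_Suc: "digits N (Suc L) y = y mod N # digits N L (y div N)"
  unfolding digits_def upt_conv_Cons[OF zero_less_Suc] map_Suc_upt[symmetric]
  by (simp add: comp_def div_mult2_eq)

lemma digits_zero: "0 < N \<Longrightarrow> (\<forall>l<k. y div N ^ l mod N = 0) \<longleftrightarrow> N ^ k dvd (y :: nat)"
proof (induction k)
  case (Suc k)
  have "N ^ Suc k dvd y \<longleftrightarrow> N ^ k dvd y \<and> N dvd y div N ^ k"
  proof (cases "N ^ k dvd y")
    case True
    then show ?thesis using Suc.prems by (simp add: dvd_div_iff_mult)
  next
    case False
    then show ?thesis using dvd_mult_right[of N "N ^ k" y] by auto
  qed
  then show ?case using Suc by (auto simp: less_Suc_eq dvd_eq_mod_eq_0[symmetric])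
qed simp

text \<open>The borrow reaches digit \<open>k\<close> exactly if all lower digits are zero, that is,
  if \<open>N ^ k\<close> divides \<open>y\<close>; taking \<open>0\<close> to \<open>N - 1\<close>
  is the cyclic move \<open>Down\<close>.\<close>

lemma digit_pred:
  assumes "0 < y" "0 < N"
  shows "(y - 1) div N ^ k mod N =
    mv (N - 1) (if N ^ k dvd y then Down else Stay) (y div N ^ k mod N)"
proof (cases "N ^ k dvd y")
  case True
  then obtain q where q: "y = N ^ k * q" by blast
  then have pos: "0 < q" using assms(1) by (cases q) auto
  have div: "y div N ^ k = q" "(y - 1) div N ^ k = q - 1"
    using pred_div[of y "N ^ k"] True q assms by simp_all
  show ?thesis unfolding div using True pred_mod[OF pos assms(2)] by (simp add: dvd_eq_mod_eq_0)
next
  case False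
  then show ?thesis using assms pred_div[of y "N ^ k"] by simp
qed

text \<open>Guarantees that counting down meets every list of pointers as part of a start
  vertex.\<close>

lemma digits_surj:
  assumes "\<forall>e\<in>set x. e < N"
  shows "\<exists>y. y < N ^ length x \<and> digits N (length x) y = x"
  using assms
proof (induction x)
  case (Cons a x)
  then obtain y where y: "y < N ^ length x" "digits N (length x) y = x" by auto
  have a: "a < N" using Cons.prems by simp
  have "N * Suc y \<le> N * N ^ length x" using y(1) by (intro mult_le_mono2) simp
  then have "a + N * y < N ^ length (a # x)" using a by simp
  moreover have "digits N (length (a # x)) (a + N * y) = a # x"
    using a y(2) by (simp add: digits_Suc)
  ultimately show ?case by blast
qed (simp add: digits_def)

lemma digits_add: "digits N L (i * N ^ L + y) = digits N L y"
proof (induction L arbitrary: y)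
  case (Suc L)
  have "i * N ^ Suc L + y = N * (i * N ^ L) + y" by simp
  then have "(i * N ^ Suc L + y) mod N = y mod N"
    "N > 0 \<Longrightarrow> (i * N ^ Suc L + y) div N = i * N ^ L + y div N"
    by (simp_all only: mod_mult_self4 div_mult_self4 add.commute)
       simp_all
  then show ?case using Suc by (cases "N = 0") (simp_all add: digits_Suc)
qed (simp add: digits_def)

lemma digits_div: "map (\<lambda>k. y div N ^ (l + k) mod N) [0..<L] = digits N L (y div N ^ l)"
  by (simp add: digits_def power_add div_mult2_eq)

section \<open>The search program\<close>

datatype 's search = Begin | Run nat nat "'s option" | Found | Done

lemma upd_append: "upd n (a @ b) v = upd n a v @ upd n b v"
  by (simp add: upd_def)

locale searching =
  fixes \<delta> :: "'s prog" and Sl :: "'s list" and \<kappa> :: nat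
  assumes prog: "s \<in> set Sl \<Longrightarrow> (s', ops) \<in> \<delta> s rd \<Longrightarrow>
      s' \<in> set Sl \<and> length ops = \<kappa> \<and> fst ` set ops \<subseteq> {..<\<kappa>}"
begin

text \<open>One more than the number of states, for two reasons: the digit value
  \<open>length Sl\<close> is a dummy start state with which the search begins, and
  \<open>Z * N ^ \<kappa> - 1\<close> steps are then at least as many as there are vertices.\<close>

definition Z :: nat where "Z = Suc (length Sl)"

text \<open>Pointers \<open>0\<close> to \<open>2 * \<kappa> - 1\<close> belong to the clock, the
  last \<open>\<kappa>\<close> to the vertex being walked.\<close>

definition keep :: instr where "keep = map (\<lambda>k. (2 * \<kappa> + k, Stay)) [0..<\<kappa>]"
definition idle :: instr where "idle = map (\<lambda>k. (k, Stay)) [0..<2 * \<kappa>]"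

definition sub :: "info \<Rightarrow> info" where
  "sub rd = map (\<lambda>(a, es). (a, drop (2 * \<kappa>) es)) (drop (2 * \<kappa>) rd)"

text \<open>A stuck walk idles instead of halting, so that the branch survives to test the remaining
  start vertices.\<close>

definition walks :: "'s option \<Rightarrow> info \<Rightarrow> ('s option \<times> instr) set" where
  "walks cur rd = (case cur of None \<Rightarrow> {(None, keep)} | Some s \<Rightarrow>
     if \<delta> s (sub rd) = {} then {(None, keep)}
     else (\<lambda>(s', ops). (Some s', map (\<lambda>(k, m). (2 * \<kappa> + k, m)) ops)) ` \<delta> s (sub rd))"

definition zero :: "info \<Rightarrow> nat \<Rightarrow> bool" where
  "zero rd k \<longleftrightarrow> fst (rd ! k) = LEnd"

text \<open>\<open>dec rd 0\<close> decrements the clock pointers; \<open>dec rd \<kappa>\<close>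
  yields the upper half of the decremented clock and thereby loads the next start vertex.\<close>

definition dec :: "info \<Rightarrow> nat \<Rightarrow> instr" where
  "dec rd a = map (\<lambda>k. (k, if \<forall>l<k. zero rd l then Down else Stay)) [a..<2 * \<kappa>]"

definition start :: "nat \<Rightarrow> 's option" where
  "start z = (if z < length Sl then Some (Sl ! z) else None)"

text \<open>A configuration \<open>Run z m cur\<close> with pointers \<open>u @ v @ x\<close> reads its clock from the mixed-radix
  number with digits \<open>m\<close>, \<open>u\<close>, \<open>v\<close>, \<open>z\<close> (least significant first). The part \<open>(v, z)\<close> is the start
  vertex under test, and \<open>(m, u)\<close> is the number of steps still to be walked from the current vertex
  \<open>(cur, x)\<close>; \<open>cur = None\<close> records that the walk got stuck.\<close>

fun srch :: "'s search prog" where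
  "srch Begin rd = {(Run (Z - 1) (Z - 1) None, map (\<lambda>k. (k, Down)) [0..<3 * \<kappa>])}"
| "srch (Run z (Suc m) cur) rd = (\<lambda>(cur', ops). (Run z m cur', idle @ ops)) ` walks cur rd"
| "srch (Run z 0 cur) rd = (if \<forall>k<\<kappa>. zero rd k
    then if cur \<noteq> None then {(Found, idle @ keep)}
      else if \<forall>k<2 * \<kappa>. zero rd k
        then if z = 0 then {(Done, idle @ keep)}
          else {(Run (z - 1) (Z - 1) (start (z - 1)), dec rd 0 @ dec rd \<kappa>)}
        else {(Run z (Z - 1) (start z), dec rd 0 @ dec rd \<kappa>)}
    else (\<lambda>(cur', ops). (Run z (Z - 1) cur', dec rd 0 @ ops)) ` walks cur rd)"
| "srch Found rd = {}"
| "srch Done rd = {}"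

definition sstates :: "'s search set" where
  "sstates = {Begin, Found, Done} \<union>
     (\<lambda>(z, m, cur). Run z m cur) ` ({..<Z} \<times> {..<Z} \<times> insert None (Some ` set Sl))"

lemma finite_sstates: "finite sstates"
  by (simp add: sstates_def)

lemma in_sstates [simp]: "Begin \<in> sstates" "Found \<in> sstates" "Done \<in> sstates"
  "Run z m cur \<in> sstates \<longleftrightarrow> z < Z \<and> m < Z \<and> (\<forall>s. cur = Some s \<longrightarrow> s \<in> set Sl)"
  by (auto simp: sstates_def image_iff split: option.splits)
     (metis not_None_eq)

lemma start_in: "start z = Some s \<Longrightarrow> s \<in> set Sl"
  by (auto simp: start_def split: if_splits)

lemma walks_in:
  assumes "(cur', ops) \<in> walks cur rd" "\<forall>s. cur = Some s \<longrightarrow> s \<in> set Sl"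
  shows "(\<forall>s. cur' = Some s \<longrightarrow> s \<in> set Sl) \<and> length ops = \<kappa> \<and> fst ` set ops \<subseteq> {..<3 * \<kappa>}"
proof (cases "\<exists>s. cur = Some s \<and> \<delta> s (sub rd) \<noteq> {}")
  case True
  then obtain s where s: "cur = Some s" "\<delta> s (sub rd) \<noteq> {}" by blast
  then have "(cur', ops) \<in> (\<lambda>(s', ops). (Some s', map (\<lambda>(k, m). (2 * \<kappa> + k, m)) ops)) ` \<delta> s (sub rd)"
    using assms(1) by (simp add: walks_def)
  then obtain s' ops' where *: "cur = Some s" "(s', ops') \<in> \<delta> s (sub rd)" "cur' = Some s'"
    "ops = map (\<lambda>(k, m). (2 * \<kappa> + k, m)) ops'"
    using s(1) by auto
  then have p: "s' \<in> set Sl" "length ops' = \<kappa>" "fst ` set ops' \<subseteq> {..<\<kappa>}"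
    using prog[OF _ *(2)] assms(2) by auto
  have "fst ` set ops = (\<lambda>k. 2 * \<kappa> + k) ` fst ` set ops'"
    by (auto simp: *(4) image_image split_beta)
  then show ?thesis using p * by (auto simp: subset_iff)
next
  case False
  then have "cur' = None" "ops = keep"
    using assms(1) by (auto simp: walks_def split: option.splits if_splits)
  then show ?thesis by (auto simp: keep_def)
qed

lemma sources:
  "fst ` set idle \<subseteq> {..<3 * \<kappa>}" "fst ` set keep \<subseteq> {..<3 * \<kappa>}" "fst ` set (dec rd a) \<subseteq> {..<3 * \<kappa>}"
  "length idle = 2 * \<kappa>" "length keep = \<kappa>" "length (dec rd a) = 2 * \<kappa> - a"
  by (auto simp: idle_def keep_def dec_def)

lemma srch_prog:
  assumes "s \<in> sstates" "(s', ops) \<in> srch s rd"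
  shows "s' \<in> sstates \<and> length ops = 3 * \<kappa> \<and> fst ` set ops \<subseteq> {..<3 * \<kappa>}"
proof -
  have run: ?thesis if s: "s = Run z m cur" for z m cur
  proof -
    have zm: "z < Z" "m < Z" "\<forall>s. cur = Some s \<longrightarrow> s \<in> set Sl" using assms(1) s by simp_all
    have walk: ?thesis
      if w: "(s', ops) \<in> (\<lambda>(cur', ops2). (Run z m' cur', ops1 @ ops2)) ` walks cur rd"
        and m': "m' < Z" and ops1: "length ops1 = 2 * \<kappa>" "fst ` set ops1 \<subseteq> {..<3 * \<kappa>}" for m' ops1
    proof -
      obtain cur' ops2 where *: "(cur', ops2) \<in> walks cur rd" "s' = Run z m' cur'" "ops = ops1 @ ops2"
        using w by auto
      show ?thesis using walks_in[OF *(1) zm(3)] * m' ops1 zm(1) by (simp add: image_Un)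
    qed
    have restart: ?thesis
      if "(s', ops) = (Run z' (Z - 1) (start z'), dec rd 0 @ dec rd \<kappa>)" "z' < Z" for z'
      using that start_in[of z'] sources(3,6)[of rd] by (simp add: image_Un Z_def)
    have stop: ?thesis if "(s', ops) = (Found, idle @ keep) \<or> (s', ops) = (Done, idle @ keep)"
proof -
      have "ops = idle @ keep" "s' \<in> sstates" using that by auto
      then show ?thesis using sources(1,2,4,5) by (simp add: image_Un)
    qed
    show ?thesis
    proof (cases m)
      case (Suc m')
      show ?thesis
      proof (rule walk)
        show "(s', ops) \<in> (\<lambda>(cur', ops2). (Run z m' cur', idle @ ops2)) ` walks cur rd"
          using assms(2) unfolding s Suc srch.simps .
      qed (use zm Suc sources in simp_all)
    next
      case 0
      have in': "(s', ops) \<in> srch (Run z 0 cur) rd" using assms(2) s 0 by simp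
      show ?thesis
      proof (cases "\<forall>k<\<kappa>. zero rd k")
        case True
        have "z' < Z \<Longrightarrow> (s', ops) = (Run z' (Z - 1) (start z'), dec rd 0 @ dec rd \<kappa>) \<Longrightarrow> ?thesis" for z'
          using restart .
        moreover have "z - 1 < Z" using zm by simp
        moreover have "(s', ops) = (Found, idle @ keep) \<or> (s', ops) = (Done, idle @ keep) \<or>
          (s', ops) = (Run (z - 1) (Z - 1) (start (z - 1)), dec rd 0 @ dec rd \<kappa>) \<or>
          (s', ops) = (Run z (Z - 1) (start z), dec rd 0 @ dec rd \<kappa>)"
          using in' unfolding srch.simps if_P[OF True] by (simp split: if_splits)
        ultimately show ?thesis using stop zm(1) by blast
      next
        case False
        show ?thesis
        proof (rule walk)
          show "(s', ops) \<in> (\<lambda>(cur', ops2). (Run z (Z - 1) cur', dec rd 0 @ ops2)) ` walks cur rd"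
            using in' unfolding srch.simps if_not_P[OF False] .
        qed (use sources(3,6)[of rd 0] in \<open>simp_all add: Z_def\<close>)
      qed
    qed
  qed
  show ?thesis
  proof (cases s)
    case Begin
    then show ?thesis using assms by (auto simp: Z_def)
  next
    case (Run z m cur)
    then show ?thesis by (rule run)
  qed (use assms in simp_all)
qed

lemma srch_deterministic:
  assumes det: "\<And>s rd x y. s \<in> set Sl \<Longrightarrow> x \<in> \<delta> s rd \<Longrightarrow> y \<in> \<delta> s rd \<Longrightarrow> x = y"
    and "s \<in> sstates" "x \<in> srch s rd" "y \<in> srch s rd"
  shows "x = y"
proof -
  have w: "x = y" if xy: "x \<in> walks cur rd" "y \<in> walks cur rd" "\<forall>s. cur = Some s \<longrightarrow> s \<in> set Sl" for x y cur
  proof (cases "\<exists>s. cur = Some s \<and> \<delta> s (sub rd) \<noteq> {}")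
    case True
    then obtain s where s: "cur = Some s" "\<delta> s (sub rd) \<noteq> {}" by blast
    obtain x' y' where "x' \<in> \<delta> s (sub rd)" "y' \<in> \<delta> s (sub rd)"
      "x = (\<lambda>(s', ops). (Some s', map (\<lambda>(k, m). (2 * \<kappa> + k, m)) ops)) x'"
      "y = (\<lambda>(s', ops). (Some s', map (\<lambda>(k, m). (2 * \<kappa> + k, m)) ops)) y'"
      using xy(1,2) s by (auto simp: walks_def)
    moreover have "s \<in> set Sl" using s xy(3) by simp
    ultimately show ?thesis using det[of s x' "sub rd" y'] by simp
  next
    case False
    then show ?thesis using xy(1,2) by (cases cur) (simp_all add: walks_def)
  qed
  show ?thesis
  proof (cases s)
    case (Run z m cur)
    then have "\<forall>s. cur = Some s \<longrightarrow> s \<in> set Sl" using assms(2) by simp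
    note w = w[OF _ _ this]
    show ?thesis
    proof (cases m)
      case (Suc m')
      then show ?thesis using assms(3,4) Run w by (auto simp: image_iff dest: w)
    next
      case 0
      show ?thesis
      proof (cases "\<forall>k<\<kappa>. zero rd k")
        case True
        then show ?thesis using assms(3,4) by (simp add: Run 0 split: if_splits)
      next
        case False
        then have "x \<in> (\<lambda>(cur', ops). (Run z (Z - 1) cur', dec rd 0 @ ops)) ` walks cur rd"
          "y \<in> (\<lambda>(cur', ops). (Run z (Z - 1) cur', dec rd 0 @ ops)) ` walks cur rd"
          using assms(3,4) unfolding Run 0 srch.simps by (simp_all only: if_False)
        then show ?thesis using w by auto
      qed
    qed
  qed (use assms(3,4) in simp_all)
qed

end

section \<open>The verdict of the search\<close>

locale searching_run = searching \<delta> Sl \<kappa> for \<delta> :: "'s prog" and Sl \<kappa> +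
  fixes w :: "fsym list"
begin

abbreviation n where "n \<equiv> length w"
abbreviation N where "N \<equiv> Suc n"
definition \<Lambda> :: nat where "\<Lambda> = Z * N ^ \<kappa>"

definition cnf :: "nat \<Rightarrow> 's option \<Rightarrow> nat list \<Rightarrow> 's search \<times> nat list" where
  "cnf \<tau> cur x = (Run (\<tau> div Z div N ^ (2 * \<kappa>)) (\<tau> mod Z) cur, digits N (2 * \<kappa>) (\<tau> div Z) @ x)"

definition alive :: "'s option \<Rightarrow> nat list \<Rightarrow> nat \<Rightarrow> bool" where
  "alive cur x m \<longleftrightarrow> (\<exists>s y. cur = Some s \<and> (pstep \<delta> w ^^ m) (s, x) y)"

text \<open>The verdict at clock value \<open>\<tau>\<close>: either the current walk can go on for
  its remaining \<open>\<tau> mod \<Lambda>\<close> steps, or one of the start vertices still to be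
  tested admits a walk of full length.\<close>

definition found :: "nat \<Rightarrow> 's option \<Rightarrow> nat list \<Rightarrow> bool" where
  "found \<tau> cur x \<longleftrightarrow> alive cur x (\<tau> mod \<Lambda>) \<or>
     (\<exists>\<rho>. \<rho> < \<tau> div \<Lambda> \<and> alive (start (\<rho> div N ^ \<kappa>)) (digits N \<kappa> \<rho>) (\<Lambda> - 1))"

text \<open>Idling makes the graph total, so that the part of \<open>found\<close> that ignores the
  current vertex passes through a step.\<close>

definition next_vertex :: "'s option \<Rightarrow> nat list \<Rightarrow> ('s option \<times> nat list) set" where
  "next_vertex cur x = (case cur of None \<Rightarrow> {(None, x)} | Some s \<Rightarrow>
     if \<exists>y. pstep \<delta> w (s, x) y then {(Some s', x') | s' x'. pstep \<delta> w (s, x) (s', x')} else {(None, x)})"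

lemma Z_pos: "0 < Z" by (simp add: Z_def)
lemma \<Lambda>_pos: "0 < \<Lambda>" by (simp add: \<Lambda>_def Z_def)

lemma sub_info: "length u = 2 * \<kappa> \<Longrightarrow> sub (info w (u @ x)) = info w x"
  by (simp add: sub_def info_def)

lemma upd_keep: "length u = 2 * \<kappa> \<Longrightarrow> length x = \<kappa> \<Longrightarrow> upd n keep (u @ x) = x"
  by (simp add: upd_def keep_def nth_append list_eq_iff_nth_eq)

lemma upd_idle: "length u = 2 * \<kappa> \<Longrightarrow> upd n idle (u @ x) = u"
  by (simp add: upd_def idle_def nth_append list_eq_iff_nth_eq)

lemma upd_shift: "length u = 2 * \<kappa> \<Longrightarrow> upd n (map (\<lambda>(k, m). (2 * \<kappa> + k, m)) ops) (u @ x) = upd n ops x"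
  by (simp add: upd_def nth_append split_beta)

lemma alive_None [simp]: "\<not> alive None x m"
  by (simp add: alive_def)

lemma alive_Suc: "alive cur x (Suc m) \<longleftrightarrow> (\<exists>(cur', x') \<in> next_vertex cur x. alive cur' x' m)"
proof (cases "\<exists>s y. cur = Some s \<and> pstep \<delta> w (s, x) y")
  case True
  then obtain s where s: "cur = Some s" "\<exists>y. pstep \<delta> w (s, x) y" by blast
  then have nv: "next_vertex cur x = {(Some s', x') | s' x'. pstep \<delta> w (s, x) (s', x')}"
    by (simp add: next_vertex_def)
  have "alive cur x (Suc m) \<longleftrightarrow> (\<exists>s' x' y. pstep \<delta> w (s, x) (s', x') \<and> (pstep \<delta> w ^^ m) (s', x') y)"
    unfolding alive_def s(1) relpowp_Suc_left by (auto simp: relcompp_apply simp del: relpowp.simps)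
  also have "\<dots> \<longleftrightarrow> (\<exists>(cur', x') \<in> next_vertex cur x. alive cur' x' m)"
    unfolding nv alive_def by (auto simp del: relpowp.simps split_paired_Ex)
  finally show ?thesis .
next
  case False
  have "\<not> alive cur x (Suc m)"
    using False unfolding alive_def relpowp_Suc_left by (auto simp: relcompp_apply simp del: relpowp.simps)
  moreover have "next_vertex cur x = {(None, x)}"
    using False by (cases cur) (simp_all add: next_vertex_def)
  ultimately show ?thesis by simp
qed

lemma walks_next:
  assumes "length u = 2 * \<kappa>" "length x = \<kappa>"
  shows "(\<lambda>(cur', ops). (cur', upd n ops (u @ x))) ` walks cur (info w (u @ x)) = next_vertex cur x"
proof (cases "\<exists>s. cur = Some s \<and> \<delta> s (info w x) \<noteq> {}")
  case True
  then obtain s where s: "cur = Some s" "\<delta> s (info w x) \<noteq> {}" by blast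
  then have "\<exists>y. pstep \<delta> w (s, x) y" by (auto simp: pstep_def)
  then have "next_vertex cur x = {(Some s', x') | s' x'. pstep \<delta> w (s, x) (s', x')}"
    using s by (simp add: next_vertex_def)
  also have "\<dots> = (\<lambda>(s', ops). (Some s', upd n ops x)) ` \<delta> s (info w x)"
    by (auto simp: pstep_def image_iff)
  finally show ?thesis using s assms
    by (simp add: walks_def sub_info image_image split_beta upd_shift)
next
  case False
  have "next_vertex cur x = {(None, x)}"
  proof (cases cur)
    case (Some s)
    then have "\<not> pstep \<delta> w (s, x) y" for y using False by (auto simp: pstep_def)
    then show ?thesis using Some by (simp add: next_vertex_def)
  qed (simp add: next_vertex_def)
  moreover have "walks cur (info w (u @ x)) = {(None, keep)}"
    using False assms by (cases cur) (simp_all add: walks_def sub_info)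
  ultimately show ?thesis using assms by (simp add: upd_keep)
qed

lemma zero_info:
  assumes "length x = \<kappa>" "k < 2 * \<kappa>"
  shows "zero (info w (digits N (2 * \<kappa>) y @ x)) k \<longleftrightarrow> y div N ^ k mod N = 0"
proof -
  have "y div N ^ k mod N \<le> n" by (simp add: less_Suc_eq_le[symmetric])
  then show ?thesis using assms
    by (simp add: zero_def info_def nth_append read_inp_def digits_def)
qed

lemma all_zero_info:
  assumes "length x = \<kappa>" "k \<le> 2 * \<kappa>"
  shows "(\<forall>l<k. zero (info w (digits N (2 * \<kappa>) y @ x)) l) \<longleftrightarrow> N ^ k dvd y"
  using zero_info[OF assms(1)] assms(2) by (simp add: digits_zero[symmetric])

lemma upd_dec:
  assumes "length x = \<kappa>" "0 < y"
  shows "upd n (dec (info w (digits N (2 * \<kappa>) y @ x)) a) (digits N (2 * \<kappa>) y @ x) =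
    map (\<lambda>k. (y - 1) div N ^ k mod N) [a..<2 * \<kappa>]"
proof -
  have "mv n (if \<forall>l<k. zero (info w (digits N (2 * \<kappa>) y @ x)) l then Down else Stay)
      ((digits N (2 * \<kappa>) y @ x) ! k) = (y - 1) div N ^ k mod N" if "k < 2 * \<kappa>" for k
    using digit_pred[OF assms(2), of N k] all_zero_info[OF assms(1), of k y] that
    by (simp add: nth_append digits_def)
  then show ?thesis by (simp add: upd_def dec_def)
qed

lemma pstep_set: "{y. pstep \<delta>' w (s, v) y} = (\<lambda>(s', ops). (s', upd n ops v)) ` \<delta>' s (info w v)"
proof (intro equalityI subsetI)
  fix y assume "y \<in> {y. pstep \<delta>' w (s, v) y}"
  then show "y \<in> (\<lambda>(s', ops). (s', upd n ops v)) ` \<delta>' s (info w v)"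
    by (cases y) (auto simp: pstep_def intro: rev_image_eqI)
qed (auto simp: pstep_def)

lemma mod_\<Lambda>_eq_0: "\<tau> mod \<Lambda> = 0 \<longleftrightarrow> \<tau> mod Z = 0 \<and> N ^ \<kappa> dvd \<tau> div Z"
  using Z_pos by (simp add: \<Lambda>_def mod_mult2_eq dvd_eq_mod_eq_0 conj_commute)

lemma div_\<Lambda>: "\<tau> div \<Lambda> = \<tau> div Z div N ^ \<kappa>"
  by (simp add: \<Lambda>_def div_mult2_eq)

text \<open>While \<open>\<tau>\<close> is not a multiple of \<open>\<Lambda>\<close>, the decrement
  borrows within \<open>(m, u)\<close> only and leaves the start vertex \<open>(v, z)\<close>
  alone.\<close>

lemma steps_walk:
  assumes x: "length x = \<kappa>" and "0 < \<tau> mod \<Lambda>"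
  shows "{y. pstep srch w (cnf \<tau> cur x) y} = (\<lambda>(cur', x'). cnf (\<tau> - 1) cur' x') ` next_vertex cur x"
proof -
  define y where "y = \<tau> div Z"
  define v where "v = digits N (2 * \<kappa>) y @ x"
  have \<tau>: "0 < \<tau>" using assms(2) by (cases \<tau>) auto
  have pre: "length (digits N (2 * \<kappa>) y) = 2 * \<kappa>" by simp
  show ?thesis
  proof (cases "\<tau> mod Z")
    case (Suc m)
    then have "(\<tau> - 1) div Z = y" "(\<tau> - 1) mod Z = m"
      using pred_div[OF \<tau> Z_pos] pred_mod[OF \<tau> Z_pos] by (simp_all add: y_def dvd_eq_mod_eq_0)
    then have cnf': "cnf (\<tau> - 1) cur' x' = (Run (y div N ^ (2 * \<kappa>)) m cur', digits N (2 * \<kappa>) y @ x')" for cur' x'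
      unfolding cnf_def by simp
    show ?thesis
      unfolding cnf' unfolding cnf_def Suc y_def[symmetric] pstep_set srch.simps
        walks_next[OF pre x, symmetric] image_image
      by (simp add: upd_append upd_idle split_beta)
  next
    case 0
    then have "\<not> N ^ \<kappa> dvd y" using assms(2) mod_\<Lambda>_eq_0[of \<tau>] by (auto simp: y_def)
    then have nd: "\<not> (\<forall>k<\<kappa>. zero (info w v) k)" and y: "0 < y"
      using all_zero_info[OF x, of \<kappa> y] by (simp_all add: v_def) (cases y; simp)
    have nd2: "\<not> N ^ (2 * \<kappa>) dvd y"
      using \<open>\<not> N ^ \<kappa> dvd y\<close> dvd_mult_left[of "N ^ \<kappa>" "N ^ \<kappa>" y]
      by (auto simp: mult_2 power_add)
    have "(\<tau> - 1) div Z = y - 1" "(\<tau> - 1) mod Z = Z - 1"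
      using pred_div[OF \<tau> Z_pos] pred_mod[OF \<tau> Z_pos] 0 by (simp_all add: y_def dvd_eq_mod_eq_0)
    moreover have "(y - 1) div N ^ (2 * \<kappa>) = y div N ^ (2 * \<kappa>)" using pred_div[OF y] nd2 by simp
    ultimately have cnf': "cnf (\<tau> - 1) cur' x' = (Run (y div N ^ (2 * \<kappa>)) (Z - 1) cur', digits N (2 * \<kappa>) (y - 1) @ x')" for cur' x'
      unfolding cnf_def by simp
    have dec: "upd n (dec (info w v) 0) v = digits N (2 * \<kappa>) (y - 1)"
      unfolding v_def upd_dec[OF x y] by (simp add: digits_def)
    show ?thesis
      unfolding cnf' unfolding cnf_def 0 y_def[symmetric] v_def[symmetric] pstep_set srch.simps if_not_P[OF nd]
        walks_next[OF pre x, symmetric] image_image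
      by (simp add: upd_append dec split_beta v_def[symmetric])
  qed
qed

lemma steps_found:
  assumes x: "length x = \<kappa>" and "\<tau> mod \<Lambda> = 0"
  shows "\<exists>v. {y. pstep srch w (cnf \<tau> (Some s) x) y} = {(Found, v)}"
proof -
  have "\<tau> mod Z = 0" "\<forall>k<\<kappa>. zero (info w (digits N (2 * \<kappa>) (\<tau> div Z) @ x)) k"
    using assms(2) all_zero_info[OF x, of \<kappa>] by (simp_all add: mod_\<Lambda>_eq_0)
  then show ?thesis unfolding cnf_def pstep_set by simp
qed

lemma steps_done: "length x = \<kappa> \<Longrightarrow> \<exists>v. {y. pstep srch w (cnf 0 None x) y} = {(Done, v)}"
  unfolding cnf_def pstep_set using all_zero_info[of x _ 0] by (simp add: zero_info)

text \<open>At a multiple of \<open>\<Lambda>\<close> one borrow does both jobs: it resets the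
  remaining steps to \<open>\<Lambda> - 1\<close> and moves \<open>(v, z)\<close> to the next start
  vertex, which is also loaded as the current one.\<close>

lemma steps_restart:
  assumes x: "length x = \<kappa>" and "\<tau> mod \<Lambda> = 0" and \<rho>: "\<tau> div \<Lambda> = Suc \<rho>"
  shows "{y. pstep srch w (cnf \<tau> None x) y} = {cnf (\<tau> - 1) (start (\<rho> div N ^ \<kappa>)) (digits N \<kappa> \<rho>)}"
proof -
  define y where "y = \<tau> div Z"
  define v where "v = digits N (2 * \<kappa>) y @ x"
  have 0: "\<tau> mod Z = 0" and dvd: "N ^ \<kappa> dvd y" using assms(2) by (auto simp: mod_\<Lambda>_eq_0 y_def)
  have q: "y div N ^ \<kappa> = Suc \<rho>" using \<rho> by (simp add: div_\<Lambda> y_def)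
  then have y: "0 < y" by (rule_tac ccontr) simp
  then have \<tau>: "0 < \<tau>" unfolding y_def by (rule_tac ccontr) simp
  have zk: "\<forall>k<\<kappa>. zero (info w v) k" using all_zero_info[OF x, of \<kappa> y] dvd by (simp add: v_def)
  have z2k: "(\<forall>k<2 * \<kappa>. zero (info w v) k) \<longleftrightarrow> N ^ (2 * \<kappa>) dvd y"
    using all_zero_info[OF x, of "2 * \<kappa>" y] by (simp add: v_def)
  have div\<rho>: "(y - 1) div N ^ \<kappa> = \<rho>" using pred_div[OF y, of "N ^ \<kappa>"] dvd q by simp
  then have z': "(y - 1) div N ^ (2 * \<kappa>) = \<rho> div N ^ \<kappa>" by (simp add: mult_2 power_add div_mult2_eq)
  have dec: "upd n (dec (info w v) 0) v = digits N (2 * \<kappa>) (y - 1)"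
    unfolding v_def upd_dec[OF x y] by (simp add: digits_def)
  have "[\<kappa>..<2 * \<kappa>] = map (\<lambda>k. \<kappa> + k) [0..<\<kappa>]" using map_add_upt[of \<kappa> \<kappa>] by (simp add: mult_2 add.commute)
  then have dec2: "upd n (dec (info w v) \<kappa>) v = digits N \<kappa> \<rho>"
    unfolding v_def upd_dec[OF x y] using digits_div[of "y - 1" N \<kappa> \<kappa>] div\<rho> by (simp add: comp_def)
  have "(\<tau> - 1) div Z = y - 1" "(\<tau> - 1) mod Z = Z - 1"
    using pred_div[OF \<tau> Z_pos] pred_mod[OF \<tau> Z_pos] 0 by (simp_all add: y_def dvd_eq_mod_eq_0)
  then have cnf': "cnf (\<tau> - 1) cur' x' = (Run (\<rho> div N ^ \<kappa>) (Z - 1) cur', digits N (2 * \<kappa>) (y - 1) @ x')" for cur' x'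
    unfolding cnf_def z'[symmetric] by simp
  have srch: "srch (Run (y div N ^ (2 * \<kappa>)) 0 None) (info w v) =
      {(Run (\<rho> div N ^ \<kappa>) (Z - 1) (start (\<rho> div N ^ \<kappa>)), dec (info w v) 0 @ dec (info w v) \<kappa>)}"
  proof (cases "N ^ (2 * \<kappa>) dvd y")
    case True
    then have "y div N ^ (2 * \<kappa>) \<noteq> 0" using y by (simp add: dvd_div_eq_0_iff)
    moreover have "y div N ^ (2 * \<kappa>) - 1 = \<rho> div N ^ \<kappa>" using z' pred_div[OF y, of "N ^ (2 * \<kappa>)"] True by simp
    ultimately show ?thesis using zk z2k True by simp
  next
    case False
    then have "y div N ^ (2 * \<kappa>) = \<rho> div N ^ \<kappa>" using z' pred_div[OF y, of "N ^ (2 * \<kappa>)"] by simp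
    moreover have "\<not> (\<forall>k<2 * \<kappa>. zero (info w v) k)" using z2k False by simp
    ultimately show ?thesis using zk by (simp only: srch.simps if_P if_not_P simp_thms)
  qed
  show ?thesis
    unfolding cnf' unfolding cnf_def 0 y_def[symmetric] v_def[symmetric] pstep_set srch
    by (simp add: upd_append dec dec2)
qed

lemma next_vertex:
  assumes "(cur', x') \<in> next_vertex cur x" "\<forall>s. cur = Some s \<longrightarrow> s \<in> set Sl" "length x = \<kappa>"
  shows "(\<forall>s. cur' = Some s \<longrightarrow> s \<in> set Sl) \<and> length x' = \<kappa>"
proof (cases "\<exists>s y. cur = Some s \<and> pstep \<delta> w (s, x) y")
  case True
  then obtain s where s: "cur = Some s" "\<exists>y. pstep \<delta> w (s, x) y" by blast
  then obtain s' where s': "cur' = Some s'" "pstep \<delta> w (s, x) (s', x')"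
    using assms(1) by (auto simp: next_vertex_def)
  then obtain ops where "(s', ops) \<in> \<delta> s (info w x)" "x' = upd n ops x" by (auto simp: pstep_def)
  then show ?thesis using prog[of s s' ops "info w x"] s s' assms(2) by (simp add: upd_def)
next
  case False
  then have "cur' = None" "x' = x"
    using assms(1) by (cases cur; simp add: next_vertex_def)+
  then show ?thesis using assms by simp
qed

lemma next_vertex_nonempty: "next_vertex cur x \<noteq> {}"
  by (auto simp: next_vertex_def split: option.splits)

lemma found_pred:
  assumes "\<tau> mod \<Lambda> = Suc r"
  shows "found \<tau> cur x \<longleftrightarrow> (\<exists>(cur', x') \<in> next_vertex cur x. found (\<tau> - 1) cur' x')"
proof -
  have \<tau>: "0 < \<tau>" using assms by (cases \<tau>) auto
  have "\<not> \<Lambda> dvd \<tau>" using assms by (simp add: dvd_eq_mod_eq_0)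
  then have "(\<tau> - 1) mod \<Lambda> = r" "(\<tau> - 1) div \<Lambda> = \<tau> div \<Lambda>"
    using pred_mod[OF \<tau> \<Lambda>_pos] pred_div[OF \<tau> \<Lambda>_pos] assms by simp_all
  then show ?thesis unfolding found_def assms alive_Suc using next_vertex_nonempty[of cur x] by auto
qed

lemma found_restart:
  assumes "\<tau> mod \<Lambda> = 0" "\<tau> div \<Lambda> = Suc \<rho>"
  shows "found \<tau> None x \<longleftrightarrow> found (\<tau> - 1) (start (\<rho> div N ^ \<kappa>)) (digits N \<kappa> \<rho>)"
proof -
  have \<tau>: "0 < \<tau>" using assms by (cases \<tau>) auto
  have "\<Lambda> dvd \<tau>" using assms by (simp add: dvd_eq_mod_eq_0)
  then have "(\<tau> - 1) mod \<Lambda> = \<Lambda> - 1" "(\<tau> - 1) div \<Lambda> = \<rho>"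
    using pred_mod[OF \<tau> \<Lambda>_pos] pred_div[OF \<tau> \<Lambda>_pos] assms by simp_all
  then show ?thesis unfolding found_def assms(2) by (auto simp: less_Suc_eq)
qed

lemma outcome_image:
  assumes "fst c \<noteq> a" "{y. pstep \<delta>' w c y} = f ` I" "inj_on f I"
    and "\<And>i. i \<in> I \<Longrightarrow> outcome \<delta>' a w (f i) (h i)" "b \<longleftrightarrow> (\<exists>i\<in>I. h i)"
  shows "outcome \<delta>' a w c b"
proof -
  obtain s v where c: "c = (s, v)" by force
  have step: "pstep \<delta>' w (s, v) y \<longleftrightarrow> y \<in> f ` I" for y using assms(2) c by auto
  have inv: "inv_into I f (f i) = i" if "i \<in> I" for i using assms(3) that by simp
  show ?thesis unfolding c
  proof (rule outcome_step[where h = "\<lambda>y. h (inv_into I f y)"])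
    show "outcome \<delta>' a w y (h (inv_into I f y))" if "pstep \<delta>' w (s, v) y" for y
      using that assms(4) inv unfolding step by auto
    show "b = (\<exists>y. pstep \<delta>' w (s, v) y \<and> h (inv_into I f y))"
      using assms(5) inv unfolding step by auto
  qed (use assms(1) c in simp)
qed

lemma outcome_final:
  assumes "s \<in> {Found, Done}" "a \<in> {Found, Done}"
  shows "outcome srch a w (s, v) (s = a)"
proof (cases "s = a")
  case True
  then show ?thesis using outcome_acc[of srch a w v] by simp
next
  case False
  have "\<not> pstep srch w (s, v) y" for y using assms(1) by (auto simp: pstep_def)
  then show ?thesis using False by (rule_tac outcome_step[where h = "\<lambda>_. True"]) simp_all
qed

lemma inj_cnf: "inj_on (\<lambda>(cur, x). cnf \<tau> cur x) A"
  by (auto simp: cnf_def inj_on_def)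

text \<open>Acceptance is a disjunction over the successors, which fits \<open>found\<close>. Its
  negation fits too when the graph is functional, since then each configuration has exactly one
  successor.\<close>

lemma outcome_cnf:
  assumes "a = Found \<or> a = Done \<and> (\<forall>s\<in>set Sl. \<forall>rd. \<forall>x\<in>\<delta> s rd. \<forall>y\<in>\<delta> s rd. x = y)"
    and "length x = \<kappa>" "\<forall>s. cur = Some s \<longrightarrow> s \<in> set Sl"
  shows "outcome srch a w (cnf \<tau> cur x) (found \<tau> cur x \<longleftrightarrow> a = Found)"
  using assms(2,3)
proof (induction \<tau> arbitrary: cur x rule: less_induct)
  case (less \<tau>)
  have a: "a \<in> {Found, Done}" "fst (cnf \<tau> cur x) \<noteq> a" using assms(1) by (auto simp: cnf_def)
  have final: "outcome srch a w (cnf \<tau> cur x) (s = a)"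
    if "{y. pstep srch w (cnf \<tau> cur x) y} = {(s, v)}" "s \<in> {Found, Done}" for s v
    by (rule outcome_image[where f = "\<lambda>_. (s, v)" and I = "{()}" and h = "\<lambda>_. s = a", OF a(2)])
      (use that a outcome_final in auto)
  consider r where "\<tau> mod \<Lambda> = Suc r" | s where "\<tau> mod \<Lambda> = 0" "cur = Some s"
    | \<rho> where "\<tau> mod \<Lambda> = 0" "cur = None" "\<tau> div \<Lambda> = Suc \<rho>"
    | "\<tau> mod \<Lambda> = 0" "cur = None" "\<tau> div \<Lambda> = 0"
    by (metis nat.exhaust option.exhaust)
  then show ?case
  proof cases
    case (1 r)
    then have lt: "\<tau> - 1 < \<tau>" by (cases \<tau>) auto
    show ?thesis
    proof (rule outcome_image[where h = "\<lambda>(cur', x'). found (\<tau> - 1) cur' x' \<longleftrightarrow> a = Found",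
          OF a(2) steps_walk[OF less.prems(1)] inj_cnf])
      show "outcome srch a w (case i of (cur', x') \<Rightarrow> cnf (\<tau> - 1) cur' x')
          (case i of (cur', x') \<Rightarrow> found (\<tau> - 1) cur' x' \<longleftrightarrow> a = Found)"
        if "i \<in> next_vertex cur x" for i
      proof -
        obtain cur' x' where i: "i = (cur', x')" by force
        show ?thesis using less.IH[OF lt, of x' cur'] next_vertex[of cur' x' cur x] that less.prems i by simp
      qed
      show "(found \<tau> cur x \<longleftrightarrow> a = Found) \<longleftrightarrow>
        (\<exists>i\<in>next_vertex cur x. case i of (cur', x') \<Rightarrow> found (\<tau> - 1) cur' x' \<longleftrightarrow> a = Found)"
      proof (cases "a = Found")
        case False
        have det: "p = q" if "p \<in> next_vertex cur x" "q \<in> next_vertex cur x" for p q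
        proof (cases cur)
          case (Some s)
          have "y = z" if "pstep \<delta> w (s, x) y" "pstep \<delta> w (s, x) z" for y z
            using that assms(1) False less.prems(2) Some
            by (cases y; cases z) (fastforce simp: pstep_def)
          then show ?thesis using that Some by (fastforce simp: next_vertex_def split: if_splits)
        qed (use that in \<open>simp add: next_vertex_def\<close>)
        obtain p where "p \<in> next_vertex cur x" using next_vertex_nonempty by blast
        then have "next_vertex cur x = {p}" using det by blast
        then show ?thesis using False found_pred[OF 1, of cur x] by (simp add: split_beta)
      qed (use found_pred[OF 1, of cur x] in simp)
    qed (use 1 in simp)
  next
    case (2 s)
    then have "alive cur x 0" by (simp add: alive_def)
    then have "found \<tau> cur x" using 2 by (simp add: found_def)
    then show ?thesis using steps_found[OF less.prems(1) 2(1), of s] final[of Found] 2(2) by (auto simp: eq_commute)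
  next
    case (3 \<rho>)
    then have lt: "\<tau> - 1 < \<tau>" by (cases \<tau>) auto
    show ?thesis
    proof (rule outcome_image[where I = "{()}" and h = "\<lambda>_. found \<tau> cur x \<longleftrightarrow> a = Found", OF a(2)])
      show "{y. pstep srch w (cnf \<tau> cur x) y} =
          (\<lambda>_. cnf (\<tau> - 1) (start (\<rho> div N ^ \<kappa>)) (digits N \<kappa> \<rho>)) ` {()}"
        using steps_restart[OF less.prems(1) 3(1,3)] 3(2) by simp
      show "outcome srch a w (cnf (\<tau> - 1) (start (\<rho> div N ^ \<kappa>)) (digits N \<kappa> \<rho>)) (found \<tau> cur x \<longleftrightarrow> a = Found)"
        unfolding 3(2) found_restart[OF 3(1,3)] using start_in by (rule_tac less.IH[OF lt]) auto
    qed auto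
  next
    case 4
    then have \<tau>: "\<tau> = 0" using div_mult_mod_eq[of \<tau> \<Lambda>] by simp
    then have "\<not> found \<tau> cur x" using 4 by (simp add: found_def)
    then show ?thesis using steps_done[OF less.prems(1)] final[of Done] assms(1) \<tau> 4(2) by auto
  qed
qed

definition long_walk :: bool where
  "long_walk \<longleftrightarrow> (\<exists>s\<in>set Sl. \<exists>x y. length x = \<kappa> \<and> (\<forall>e\<in>set x. e \<le> n) \<and> (pstep \<delta> w ^^ (\<Lambda> - 1)) (s, x) y)"

text \<open>Moving all pointers down from \<open>0\<close> wraps them to \<open>n\<close>, so the
  clock starts with every digit at its maximum.\<close>

lemma step_Begin: "{y. pstep srch w (Begin, replicate (3 * \<kappa>) 0) y} = {cnf (Z * N ^ (2 * \<kappa>) * Z - 1) None (replicate \<kappa> n)}"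
proof -
  define \<tau> where "\<tau> = Z * N ^ (2 * \<kappa>) * Z"
  have pos: "0 < \<tau>" "0 < N ^ (2 * \<kappa>) * Z" using Z_pos by (simp_all add: \<tau>_def)
  have \<tau>: "\<tau> = Z * (N ^ (2 * \<kappa>) * Z)" by (simp add: \<tau>_def)
  have 1: "(\<tau> - 1) div Z = N ^ (2 * \<kappa>) * Z - 1" "(\<tau> - 1) mod Z = Z - 1"
    using pred_div[OF pos(1) Z_pos] pred_mod[OF pos(1) Z_pos] Z_pos by (simp_all add: \<tau>)
  have 2: "(N ^ (2 * \<kappa>) * Z - 1) div N ^ (2 * \<kappa>) = Z - 1"
    using pred_div[OF pos(2), of "N ^ (2 * \<kappa>)"] by simp
  have "(N ^ (2 * \<kappa>) * Z - 1) div N ^ k mod N = n" if "k < 2 * \<kappa>" for k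
  proof -
    have "2 * \<kappa> = k + Suc (2 * \<kappa> - k - 1)" using that by simp
    then have "N ^ (2 * \<kappa>) * Z = N ^ k * (N * (N ^ (2 * \<kappa> - k - 1) * Z))" (is "_ = _ * (N * ?q)")
      by (metis mult.assoc power_Suc power_add)
    moreover have q: "0 < N * ?q" using Z_pos by simp
    ultimately have "(N ^ (2 * \<kappa>) * Z - 1) div N ^ k = N * ?q - 1"
      using pred_div[OF pos(2), of "N ^ k"] by (simp del: mult_Suc mult_Suc_right)
    then show ?thesis
      using pred_mod[OF q, of N] by (simp del: mult_Suc mult_Suc_right)
  qed
  then have 3: "digits N (2 * \<kappa>) (N ^ (2 * \<kappa>) * Z - 1) = replicate (2 * \<kappa>) n"
    by (simp add: digits_def list_eq_iff_nth_eq)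
  have "upd n (map (\<lambda>k. (k, Down)) [0..<3 * \<kappa>]) (replicate (3 * \<kappa>) 0) = replicate (2 * \<kappa>) n @ replicate \<kappa> n"
    by (simp add: upd_def list_eq_iff_nth_eq nth_append)
  then show ?thesis
    unfolding cnf_def \<tau>_def[symmetric] 1 2 3 pstep_set by simp
qed

lemma found_begin: "found (Z * N ^ (2 * \<kappa>) * Z - 1) None x \<longleftrightarrow> long_walk"
proof -
  define \<tau> where "\<tau> = Z * N ^ (2 * \<kappa>) * Z"
  have \<tau>: "\<tau> = \<Lambda> * (Z * N ^ \<kappa>)" by (simp add: \<tau>_def \<Lambda>_def mult_2 power_add)
  have pos: "0 < \<tau>" using Z_pos by (simp add: \<tau>_def)
  have div: "(\<tau> - 1) div \<Lambda> = Z * N ^ \<kappa> - 1"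
    using pred_div[OF pos \<Lambda>_pos] \<Lambda>_pos by (simp add: \<tau>)
  show ?thesis unfolding \<tau>_def[symmetric] found_def div
  proof
    assume "alive None x ((\<tau> - 1) mod \<Lambda>) \<or>
      (\<exists>\<rho><Z * N ^ \<kappa> - 1. alive (start (\<rho> div N ^ \<kappa>)) (digits N \<kappa> \<rho>) (\<Lambda> - 1))"
    then obtain \<rho> s y where "start (\<rho> div N ^ \<kappa>) = Some s" "(pstep \<delta> w ^^ (\<Lambda> - 1)) (s, digits N \<kappa> \<rho>) y"
      by (auto simp: alive_def)
    moreover have "\<forall>e\<in>set (digits N \<kappa> \<rho>). e \<le> n" by (auto simp: digits_def less_Suc_eq_le[symmetric])
    ultimately show long_walk unfolding long_walk_def using start_in length_digits by blast
  next
    assume long_walk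
    then obtain s v y where *: "s \<in> set Sl" "length v = \<kappa>" "\<forall>e\<in>set v. e \<le> n"
      "(pstep \<delta> w ^^ (\<Lambda> - 1)) (s, v) y"
      unfolding long_walk_def by blast
    obtain i where i: "i < length Sl" "Sl ! i = s" using *(1) by (auto simp: in_set_conv_nth)
    obtain m where m: "m < N ^ \<kappa>" "digits N \<kappa> m = v"
      using digits_surj[of v N] *(2,3) by (auto simp: less_Suc_eq_le)
    let ?\<rho> = "i * N ^ \<kappa> + m"
    have "?\<rho> div N ^ \<kappa> = i" using m(1) by simp
    moreover have "digits N \<kappa> ?\<rho> = v" using m(2) by (simp add: digits_add)
    ultimately have "alive (start (?\<rho> div N ^ \<kappa>)) (digits N \<kappa> ?\<rho>) (\<Lambda> - 1)"
      unfolding alive_def start_def using i *(4) by (intro exI[of _ s] exI[of _ y]) simp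
    moreover have "Suc i * N ^ \<kappa> \<le> length Sl * N ^ \<kappa>" using i(1) by (intro mult_le_mono1) simp
    then have "?\<rho> < length Sl * N ^ \<kappa>" using m(1) by simp
    \<comment> \<open>The dummy value counted in \<open>Z\<close> gives the room: its block lies
      above all real start vertices.\<close>
    then have "?\<rho> < Z * N ^ \<kappa> - 1" using m(1) by (simp add: Z_def)
    ultimately show "alive None x ((\<tau> - 1) mod \<Lambda>) \<or>
      (\<exists>\<rho><Z * N ^ \<kappa> - 1. alive (start (\<rho> div N ^ \<kappa>)) (digits N \<kappa> \<rho>) (\<Lambda> - 1))" by blast
  qed
qed

lemma outcome_srch:
  assumes "a = Found \<or> a = Done \<and> (\<forall>s\<in>set Sl. \<forall>rd. \<forall>x\<in>\<delta> s rd. \<forall>y\<in>\<delta> s rd. x = y)"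
  shows "outcome srch a w (Begin, replicate (3 * \<kappa>) 0) (long_walk \<longleftrightarrow> a = Found)"
proof (rule outcome_image[where I = "{()}" and h = "\<lambda>_. long_walk \<longleftrightarrow> a = Found"])
  show "{y. pstep srch w (Begin, replicate (3 * \<kappa>) 0) y} =
      (\<lambda>_. cnf (Z * N ^ (2 * \<kappa>) * Z - 1) None (replicate \<kappa> n)) ` {()}"
    unfolding step_Begin by simp
  show "outcome srch a w (cnf (Z * N ^ (2 * \<kappa>) * Z - 1) None (replicate \<kappa> n)) (long_walk \<longleftrightarrow> a = Found)"
    using outcome_cnf[OF assms, of "replicate \<kappa> n" None "Z * N ^ (2 * \<kappa>) * Z - 1"]
    unfolding found_begin by simp
qed (use assms in auto)

end

section \<open>The pointer machine of an observation\<close>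

lemma syms_ren [simp]: "syms (ren \<rho> t) = syms t"
  unfolding ren_def by (induction t) auto

lemma wf_ren [simp]: "wf_trm (ren \<rho> t) = wf_trm t"
  unfolding ren_def by (induction t) auto

lemma ren_simps [simp]: "ren \<rho> (bul s t) = bul (ren \<rho> s) (ren \<rho> t)" "ren \<rho> (const c) = const c"
  by (simp_all add: ren_def bul_def const_def)

lemma ren_ren: "ren \<rho> (ren \<rho>' t) = ren (\<rho> \<circ> \<rho>') t"
  by (simp add: ren_def subst_subst comp_def)

lemma ren_id [simp]: "ren id t = t"
  by (simp add: ren_def)

lemma occ_heights_empty: "x \<notin> vars t \<Longrightarrow> occ_heights t x = {}"
  by (induction t) auto

lemma occ_heights_ren: "inj \<rho> \<Longrightarrow> occ_heights (ren \<rho> t) (\<rho> x) = occ_heights t x"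
  unfolding ren_def by (induction t) (auto dest: injD)

definition free_flow :: "flow \<Rightarrow> bool" where
  "free_flow f \<longleftrightarrow> is_flow f \<and> balanced f \<and> (syms (fst f) \<union> syms (snd f)) \<inter> range PosC = {}"

lemma free_flow_ren:
  assumes "inj \<rho>" "free_flow (t, u)"
  shows "free_flow (ren \<rho> t, ren \<rho> u)"
proof -
  have "balanced (ren \<rho> t, ren \<rho> u)"
    unfolding balanced_def
  proof
    fix y
    show "\<forall>h1\<in>occ_heights (fst (ren \<rho> t, ren \<rho> u)) y \<union> occ_heights (snd (ren \<rho> t, ren \<rho> u)) y.
      \<forall>h2\<in>occ_heights (fst (ren \<rho> t, ren \<rho> u)) y \<union> occ_heights (snd (ren \<rho> t, ren \<rho> u)) y. h1 = h2"
    proof (cases "y \<in> range \<rho>")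
      case True
      then obtain x where "y = \<rho> x" by blast
      then show ?thesis using assms by (simp add: occ_heights_ren free_flow_def balanced_def)
    next
      case False
      then have "y \<notin> vars (ren \<rho> t)" "y \<notin> vars (ren \<rho> u)" by (auto simp: vars_ren)
      then show ?thesis by (simp add: occ_heights_empty)
    qed
  qed
  then show ?thesis using assms by (auto simp: free_flow_def is_flow_def vars_ren)
qed

text \<open>The new root deepens both sides by one and the closed constants add no variable, so
  equal heights stay equal.\<close>

lemma free_flow_bul:
  assumes "free_flow (t, u)" "s \<in> const ` range StC" "s' \<in> const ` range StC"
  shows "free_flow (bul s t, bul s' u)"
proof -
  have "balanced (bul s t, bul s' u)"
    unfolding balanced_def using assms
    by (fastforce simp: bul_def const_def free_flow_def balanced_def)
  then show ?thesis using assms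
    by (auto simp: free_flow_def is_flow_def bul_def const_def)
qed

definition tri :: "fsym \<Rightarrow> fsym \<Rightarrow> trm \<Rightarrow> trm" where
  "tri c d b = bul (const c) (bul (const d) b)"

lemma tri_eq [simp]: "tri c d b = tri c' d' b' \<longleftrightarrow> c = c' \<and> d = d' \<and> b = b'"
  by (simp add: tri_def bul_def const_def)

lemma subst_tri [simp]: "subst \<sigma> (tri c d b) = tri c d (subst \<sigma> b)"
  by (simp add: tri_def bul_def const_def)

lemma ren_tri [simp]: "ren \<rho> (tri c d b) = tri c d (ren \<rho> b)"
  by (simp add: tri_def)

lemma stensor_flow:
  assumes "X \<in> stensor A B" "g \<in> X"
  shows "\<exists>f\<in>\<Union>A. \<exists>h\<in>\<Union>B. g = ftensor f h"
proof -
  obtain l where l: "X = \<Union> (set (map (\<lambda>(F, G). wtensor F G) l))" "set l \<subseteq> A \<times> B"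
    using assms(1) by (auto simp: stensor_def)
  then obtain F G where FG: "(F, G) \<in> set l" "g \<in> wtensor F G" using assms(2) by auto
  then have "F \<in> A" "G \<in> B" using l(2) by auto
  then show ?thesis using FG(2) unfolding wtensor_def by blast
qed

text \<open>Three tensor layers are peeled off; the renamings they introduce fix the constants and
  preserve balance. Since \<open>Ob\<close> is only equivalent to a member of \<open>Matr\<close>,
  one more renaming is undone by its inverse.\<close>

lemma observation_flows:
  assumes "Ob \<in> observations Sig" "f \<in> Ob"
  shows "\<exists>c d t c' d' u. f = (tri c d t, tri c' d' u) \<and> c \<in> insert Star Sig \<and> c' \<in> insert Star Sig \<and>
    d \<in> {Lsym, Rsym} \<and> d' \<in> {Lsym, Rsym} \<and> free_flow (t, u)"
proof -
  obtain Ob' where Ob': "Ob' \<in> Matr Sig obs_semiring" "wiring_equiv Ob Ob'"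
    using assms by (auto simp: observations_def)
  obtain g where g: "g \<in> Ob'" "flow_renaming f g" using Ob' assms(2) by (auto simp: wiring_equiv_def)
  have odd: "inj (\<lambda>x :: nat. 2 * x + 1)" by (auto simp: inj_def)
  obtain f1 g1 G1 where f1: "g = ftensor f1 g1" "f1 \<in> \<Union> (Csemi (insert Star Sig))"
    "G1 \<in> stensor (Csemi {Lsym, Rsym}) obs_semiring" "g1 \<in> G1"
    using stensor_flow[OF Ob'(1)[unfolded Matr_def] g(1)] by blast
  obtain f2 g2 G2 where f2: "g1 = ftensor f2 g2" "f2 \<in> \<Union> (Csemi {Lsym, Rsym})"
    "G2 \<in> obs_semiring" "g2 \<in> G2"
    using stensor_flow[OF f1(3,4)] by blast
  obtain f3 g3 where f3: "g2 = ftensor f3 g3" "f3 \<in> \<Union> (Csemi (range StC))"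
    "g3 \<in> \<Union> (restrict_syms (range PosC) balanced_wirings)"
    using stensor_flow[OF f2(3)[unfolded obs_semiring_def] f2(4)] by blast
  have g3: "free_flow (fst g3, snd g3)"
    using f3(3) by (auto simp: restrict_syms_def balanced_wirings_def free_flow_def)
  obtain c c' where c: "f1 = (const c, const c')" "c \<in> insert Star Sig" "c' \<in> insert Star Sig"
    using f1(2) by (auto simp: Csemi_def)
  obtain d d' where d: "f2 = (const d, const d')" "d \<in> {Lsym, Rsym}" "d' \<in> {Lsym, Rsym}"
    using f2(2) by (auto simp: Csemi_def)
  have s: "fst f3 \<in> const ` range StC" "snd f3 \<in> const ` range StC"
    using f3(2) by (auto simp: Csemi_def)
  then have rs: "ren \<rho> (fst f3) = fst f3" "ren \<rho> (snd f3) = snd f3" for \<rho> by auto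
  let ?\<rho> = "\<lambda>x :: nat. 2 * x + 1"
  have "free_flow (fst g2, snd g2)"
    using free_flow_bul[OF free_flow_ren[OF odd g3] s] by (simp add: f3(1) ftensor_def rs)
  then have "free_flow (ren ?\<rho> (ren ?\<rho> (fst g2)), ren ?\<rho> (ren ?\<rho> (snd g2)))"
    by (intro free_flow_ren[OF odd])
  moreover have "g = (tri c d (ren ?\<rho> (ren ?\<rho> (fst g2))), tri c' d' (ren ?\<rho> (ren ?\<rho> (snd g2))))"
    by (simp add: f1(1) f2(1) c(1) d(1) ftensor_def tri_def)
  ultimately obtain t u where tu: "free_flow (t, u)" "g = (tri c d t, tri c' d' u)" by blast
  obtain \<rho> where \<rho>: "bij \<rho>" "g = (ren \<rho> (fst f), ren \<rho> (snd f))"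
    using g(2) by (auto simp: flow_renaming_def)
  have "inv \<rho> \<circ> \<rho> = id" using \<rho>(1) by (simp add: bij_is_inj)
  then have "f = (ren (inv \<rho>) (fst g), ren (inv \<rho>) (snd g))"
    unfolding \<rho>(2) by (simp add: ren_ren)
  then have "f = (tri c d (ren (inv \<rho>) t), tri c' d' (ren (inv \<rho>) u))" by (simp add: tu(2))
  moreover have "free_flow (ren (inv \<rho>) t, ren (inv \<rho>) u)"
    using \<rho>(1) by (intro free_flow_ren[OF _ tu(1)]) (simp add: bij_imp_bij_inv bij_is_inj)
  ultimately show ?thesis using c d by blast
qed

fun letter :: "inp \<Rightarrow> fsym" where
  "letter (Sym c) = c"
| "letter _ = Star"

definition cell :: "fsym \<Rightarrow> fsym \<Rightarrow> trm \<Rightarrow> trm \<Rightarrow> nat \<Rightarrow> trm" where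
  "cell c d x y q = tri c d (bul x (bul y (App Msym [const (PosC q)])))"

definition opposite :: "fsym \<Rightarrow> fsym" where
  "opposite d = (if d = Lsym then Rsym else Lsym)"

definition turn :: "fsym \<Rightarrow> move" where
  "turn d = (if d = Lsym then Up else Down)"

text \<open>Each edge of the cyclic word is used in both directions: leaving position
  \<open>j\<close> on side \<open>Lsym\<close> leads up and arrives on side \<open>Rsym\<close>;
  leaving it on side \<open>Rsym\<close> leads down and arrives on side \<open>Lsym\<close>.\<close>

lemma inst_wordrep:
  assumes "length p = length w + 1"
  shows "(a', a) \<in> inst (wordrep w p) \<longleftrightarrow>
    (\<exists>j d x y. j \<le> length w \<and> d \<in> {Lsym, Rsym} \<and> a = cell (letter (read_inp w j)) d x y (p ! j) \<and>
      a' = cell (letter (read_inp w (mv (length w) (turn d) j))) (opposite d) x y (p ! mv (length w) (turn d) j))"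
    (is "_ \<longleftrightarrow> ?R")
proof -
  define n where "n = length w"
  define c where "c i = (if i = 0 \<or> i = n + 1 then Star else w ! (i - 1))" for i
  define q where "q i = (if i = n + 1 then p ! 0 else p ! i)" for i
  define tm where "tm i d = cell (c i) d (Var 0) (Var 1) (q i)" for i d
  have W: "wordrep w p = (\<Union>i\<in>{0..n}. biflow (tm i Lsym) (tm (i + 1) Rsym))"
    by (simp add: wordrep_def Let_def tm_def[abs_def] cell_def[abs_def] tri_def c_def[abs_def] q_def[abs_def] n_def)
  have sub: "subst \<sigma> (tm i d) = cell (c i) d (\<sigma> 0) (\<sigma> 1) (q i)" for \<sigma> i d
    by (simp add: tm_def cell_def bul_def const_def)
  have rd: "c i = letter (read_inp w i)" "q i = p ! i" if "i \<le> n" for i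
    using that by (auto simp: c_def q_def read_inp_def n_def)
  \<comment> \<open>Index \<open>n + 1\<close> is position \<open>0\<close> again, for the letter as
    well as for the position constant.\<close>
  have rd': "c (i + 1) = letter (read_inp w (mv n Up i))" "q (i + 1) = p ! mv n Up i" if "i \<le> n" for i
    using that by (auto simp: c_def q_def read_inp_def n_def)
  have mem: "(t, u) \<in> wordrep w p \<longleftrightarrow> (\<exists>i\<le>n. (t = tm i Lsym \<and> u = tm (i + 1) Rsym) \<or> (t = tm (i + 1) Rsym \<and> u = tm i Lsym))" for t u
    unfolding W biflow_def by (simp add: Bex_def)
  have "(a', a) \<in> inst (wordrep w p) \<longleftrightarrow> (\<exists>\<sigma> t u. a' = subst \<sigma> t \<and> a = subst \<sigma> u \<and> (t, u) \<in> wordrep w p)"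
    unfolding inst_def by simp
  also have "\<dots> \<longleftrightarrow> (\<exists>x y i. i \<le> n \<and>
      ((a' = cell (c i) Lsym x y (q i) \<and> a = cell (c (i + 1)) Rsym x y (q (i + 1))) \<or>
      (a = cell (c i) Lsym x y (q i) \<and> a' = cell (c (i + 1)) Rsym x y (q (i + 1)))))" (is "?A \<longleftrightarrow> ?B")
  proof
    assume ?A
    then obtain \<sigma> i where "i \<le> n"
      "(a' = subst \<sigma> (tm i Lsym) \<and> a = subst \<sigma> (tm (i + 1) Rsym)) \<or>
       (a' = subst \<sigma> (tm (i + 1) Rsym) \<and> a = subst \<sigma> (tm i Lsym))"
      unfolding mem by blast
    then show ?B unfolding sub by (intro exI[of _ "\<sigma> 0"] exI[of _ "\<sigma> 1"] exI[of _ i]) blast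
  next
    assume ?B
    then obtain x y i where i: "i \<le> n" "(a' = cell (c i) Lsym x y (q i) \<and> a = cell (c (i + 1)) Rsym x y (q (i + 1))) \<or>
      (a = cell (c i) Lsym x y (q i) \<and> a' = cell (c (i + 1)) Rsym x y (q (i + 1)))" by blast
    define \<sigma> where "\<sigma> k = (if k = 0 then x else y)" for k :: nat
    have "subst \<sigma> (tm i d) = cell (c i) d x y (q i)" for i d by (simp add: sub \<sigma>_def)
    then have "(a' = subst \<sigma> (tm i Lsym) \<and> a = subst \<sigma> (tm (i + 1) Rsym)) \<or>
       (a' = subst \<sigma> (tm (i + 1) Rsym) \<and> a = subst \<sigma> (tm i Lsym))" using i(2) by (elim disjE) simp_all
    then show ?A unfolding mem using i(1) by blast
  qed
  also have "\<dots> \<longleftrightarrow> ?R"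
  proof
    assume ?B
    then obtain x y i where i: "i \<le> n" and
      *: "(a' = cell (c i) Lsym x y (q i) \<and> a = cell (c (i + 1)) Rsym x y (q (i + 1))) \<or>
      (a = cell (c i) Lsym x y (q i) \<and> a' = cell (c (i + 1)) Rsym x y (q (i + 1)))" by blast
    have down: "mv n Down (mv n Up i) = i" "mv n Up i \<le> n" using i by auto
    from *[unfolded rd[OF i] rd'[OF i]] show ?R
    proof
      assume "a' = cell (letter (read_inp w i)) Lsym x y (p ! i) \<and>
        a = cell (letter (read_inp w (mv n Up i))) Rsym x y (p ! mv n Up i)"
      then show ?thesis using down
        by (intro exI[of _ "mv n Up i"] exI[of _ Rsym] exI[of _ x] exI[of _ y])
          (simp add: turn_def opposite_def n_def[symmetric] del: mv.simps)
    next
      assume "a = cell (letter (read_inp w i)) Lsym x y (p ! i) \<and>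
        a' = cell (letter (read_inp w (mv n Up i))) Rsym x y (p ! mv n Up i)"
      then show ?thesis using i
        by (intro exI[of _ i] exI[of _ Lsym] exI[of _ x] exI[of _ y])
          (simp add: turn_def opposite_def n_def[symmetric] del: mv.simps)
    qed
  next
    assume ?R
    then obtain j d x y where j: "j \<le> n" and d: "d \<in> {Lsym, Rsym}"
      and *: "a = cell (letter (read_inp w j)) d x y (p ! j)"
      "a' = cell (letter (read_inp w (mv n (turn d) j))) (opposite d) x y (p ! mv n (turn d) j)"
      unfolding n_def by blast
    show ?B
    proof (cases "d = Lsym")
      case True
      then show ?thesis using * rd[OF j] rd'[OF j] j
        by (intro exI[of _ x] exI[of _ y] exI[of _ j]) (simp add: turn_def opposite_def del: mv.simps)
    next
      case False
      define i where "i = mv n Down j"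
      have i: "i \<le> n" "mv n Up i = j" using j by (auto simp: i_def)
      then show ?thesis using * d False rd[OF i(1)] rd'[OF i(1)]
        by (intro exI[of _ x] exI[of _ y] exI[of _ i]) (simp add: turn_def opposite_def i_def[symmetric] del: mv.simps)
    qed
  qed
  finally show ?thesis .
qed

section \<open>Truncated terms as skeletons filled with position constants\<close>

fun coll :: "(fsym \<Rightarrow> bool) \<Rightarrow> nat \<Rightarrow> trm \<Rightarrow> trm" where
  "coll P 0 t = const Star"
| "coll P (Suc h) (Var x) = const Star"
| "coll P (Suc h) (App f ts) =
     (if P f \<and> length ts = arity f then App f (map (coll P h) ts) else const Star)"

text \<open>Truncating an instance of a balanced flow at a fixed height truncates all occurrences of a
  variable in the same way, and hence yields another instance of the flow.\<close>

lemma coll_subst: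
  assumes "wf_trm t" "\<forall>f\<in>syms t. P f" "size t \<le> h"
    and "\<And>x k. k \<in> occ_heights t x \<Longrightarrow> \<sigma>' x = coll P (h - k) (\<sigma> x)"
  shows "coll P h (subst \<sigma> t) = subst \<sigma>' t"
  using assms
proof (induction t arbitrary: h)
  case (Var x)
  then show ?case by simp
next
  case (App f ts)
  then obtain h' where h: "h = Suc h'" by (cases h) auto
  have "coll P h' (subst \<sigma> t) = subst \<sigma>' t" if t: "t \<in> set ts" for t
  proof (rule App.IH[OF t])
    show "wf_trm t" "\<forall>f\<in>syms t. P f" using App.prems t by auto
    have "size t \<le> size_list size ts" using t by (intro size_list_estimation') auto
    then show "size t \<le> h'" using App.prems(3) h by simp
    show "\<sigma>' x = coll P (h' - k) (\<sigma> x)" if "k \<in> occ_heights t x" for x k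
      using App.prems(4)[of "Suc k" x] that t h by auto
  qed
  then show ?case using App.prems h by simp
qed

fun tset :: "nat set \<Rightarrow> fsym set \<Rightarrow> nat \<Rightarrow> trm set" where
  "tset V F 0 = insert (const Star) (Var ` V)"
| "tset V F (Suc h) = insert (const Star) (Var ` V) \<union>
     (\<Union>f\<in>F. App f ` {ts. set ts \<subseteq> tset V F h \<and> length ts = arity f})"

lemma tset_App: "f \<in> F \<Longrightarrow> set ts \<subseteq> tset V F h \<Longrightarrow> length ts = arity f \<Longrightarrow> App f ts \<in> tset V F (Suc h)"
  by simp blast

lemma finite_tset: "finite V \<Longrightarrow> finite F \<Longrightarrow> finite (tset V F h)"
  by (induction h) (auto intro!: finite_lists_length_eq)

lemma tset_props: "t \<in> tset V F h \<Longrightarrow> vars t \<subseteq> V \<and> syms t \<subseteq> insert Star F \<and> wf_trm t"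
proof (induction h arbitrary: t)
  case (Suc h)
  show ?case
  proof (cases "t \<in> insert (const Star) (Var ` V)")
    case False
    then obtain f ts where t: "t = App f ts" "f \<in> F" "set ts \<subseteq> tset V F h" "length ts = arity f"
      using Suc.prems by auto
    then show ?thesis using Suc.IH by (fastforce simp: subset_iff)
  qed (auto simp: const_def)
qed (auto simp: const_def)

text \<open>Instances may contain ill-formed applications and foreign symbols. As
  \<open>coll\<close> cuts these along with everything that is too deep, its values are well-formed
  terms of bounded height over \<open>F\<close> and \<open>Star\<close>.\<close>

lemma coll_tset: "(\<And>f. P f \<Longrightarrow> f \<in> F) \<Longrightarrow> coll P h t \<in> tset {} F h"
proof (induction P h t rule: coll.induct)
  case (3 P h f ts)
  then have "App f (map (coll P h) ts) \<in> tset {} F (Suc h)" if "P f" "length ts = arity f"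
    using that by (intro tset_App) auto
  then show ?case by simp
qed auto

definition positions :: "trm \<Rightarrow> nat set" where
  "positions t = {q. PosC q \<in> syms t}"

lemma positions_App: "positions (App f ts) = {q. PosC q = f} \<union> (\<Union>t\<in>set ts. positions t)"
  by (auto simp: positions_def)

lemma finite_positions: "finite (positions t)"
proof (induction t)
  case (App f ts)
  have "finite {q. PosC q = f}" by (cases f) auto
  then show ?case using App by (simp add: positions_App)
qed (simp add: positions_def)

text \<open>Position constants are leaves of a tree of bounded branching and height. The base
  \<open>Suc m\<close> keeps the bound positive when \<open>m = 0\<close>.\<close>

lemma card_positions:
  assumes "\<And>f. f \<in> F \<Longrightarrow> arity f \<le> m"
  shows "t \<in> tset V F h \<Longrightarrow> card (positions t) \<le> Suc m ^ h"
proof (induction h arbitrary: t)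
  case 0
  then have "positions t = {}" by (auto simp: positions_def const_def)
  then show ?case by simp
next
  case (Suc h)
  show ?case
  proof (cases "t \<in> insert (const Star) (Var ` V)")
    case True
    then have "positions t = {}" by (auto simp: positions_def const_def)
    then show ?thesis by simp
  next
    case False
    then obtain f ts where t: "t = App f ts" "f \<in> F" "set ts \<subseteq> tset V F h" "length ts = arity f"
      using Suc.prems by auto
    show ?thesis
    proof (cases "\<exists>q. f = PosC q")
      case True
      then obtain q where "f = PosC q" by blast
      then have "positions t = {q}" using t by (auto simp: positions_App)
      then have "card (positions t) = 1" by simp
      then show ?thesis by (metis One_nat_def Suc_leI zero_less_Suc zero_less_power)
    next
      case False
      then have "positions t = (\<Union>u\<in>set ts. positions u)" unfolding t(1) positions_App by auto
      then have "card (positions t) \<le> (\<Sum>u\<in>set ts. card (positions u))"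
        by (simp add: card_UN_le)
      also have "\<dots> \<le> of_nat (card (set ts)) * Suc m ^ h"
        using t(3) Suc.IH by (intro sum_bounded_above) auto
      also have "\<dots> \<le> Suc m * Suc m ^ h"
        using card_length[of ts] t(4) assms[OF t(2)] by (intro mult_le_mono1) simp
      finally show ?thesis by simp
    qed
  qed
qed

definition fill :: "nat list \<Rightarrow> trm \<Rightarrow> trm" where
  "fill v s = subst (\<lambda>k. const (PosC (v ! k))) s"

fun unfill :: "(nat \<Rightarrow> nat) \<Rightarrow> trm \<Rightarrow> trm" where
  "unfill g (Var x) = Var x"
| "unfill g (App f ts) = (case f of PosC q \<Rightarrow> Var (g q) | _ \<Rightarrow> App f (map (unfill g) ts))"

lemma unfill:
  assumes "t \<in> tset {} (F \<union> range PosC) h" "F \<inter> range PosC = {}" "\<And>q. q \<in> positions t \<Longrightarrow> g q \<in> V \<and> v ! g q = q"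
  shows "unfill g t \<in> tset V F h \<and> fill v (unfill g t) = t"
  using assms(1,3)
proof (induction h arbitrary: t)
  case 0
  then show ?case by (auto simp: const_def fill_def)
next
  case (Suc h)
  show ?case
  proof (cases "t = const Star")
    case False
    then obtain f ts where t: "t = App f ts" "f \<in> F \<union> range PosC" "set ts \<subseteq> tset {} (F \<union> range PosC) h" "length ts = arity f"
      using Suc.prems(1) by auto
    show ?thesis
    proof (cases "\<exists>q. f = PosC q")
      case True
      then obtain q where q: "f = PosC q" by blast
      then show ?thesis using t Suc.prems(2)[of q] by (auto simp: positions_App fill_def const_def)
    next
      case False
      then have f: "f \<in> F" "unfill g t = App f (map (unfill g) ts)" using t by (auto split: fsym.splits)
      have "unfill g u \<in> tset V F h \<and> fill v (unfill g u) = u" if u: "u \<in> set ts" for u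
        using Suc.IH[of u] Suc.prems(2) u t by (auto simp: positions_App)
      then have "set (map (unfill g) ts) \<subseteq> tset V F h" "map (fill v \<circ> unfill g) ts = ts"
        by (auto simp: map_idI)
      then have "unfill g t \<in> tset V F (Suc h)" "fill v (unfill g t) = t"
        unfolding f(2) using tset_App[OF f(1), of "map (unfill g) ts" V h] t(1,4)
        by (simp_all add: fill_def comp_def)
      then show ?thesis ..
    qed
  qed (auto simp: const_def fill_def)
qed

text \<open>One variable per position constant suffices for the skeleton. The list has an additional
  slot \<open>K\<close>, which the skeleton does not mention; after a step of the word it holds the
  active pointer.\<close>

lemma representable:
  assumes "t \<in> tset {} (F \<union> range PosC) h" "F \<inter> range PosC = {}"
    and "card (positions t) \<le> K" "positions t \<subseteq> X" "q0 \<in> X"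
  shows "\<exists>s qs. s \<in> tset {..<K} F h \<and> length qs = Suc K \<and> set qs \<subseteq> X \<and> fill qs s = t"
proof -
  obtain l where l: "set l = positions t" "distinct l" using finite_distinct_list[OF finite_positions] by blast
  have len: "length l \<le> K" using assms(3) l distinct_card[of l] by simp
  define qs where "qs = l @ replicate (Suc K - length l) q0"
  have "\<exists>k. k < length l \<and> l ! k = q" if "q \<in> positions t" for q
    using that l(1) by (metis in_set_conv_nth)
  then obtain g where g: "\<And>q. q \<in> positions t \<Longrightarrow> g q < length l \<and> l ! g q = q" by metis
  have "unfill g t \<in> tset {..<K} F h \<and> fill qs (unfill g t) = t"
  proof (rule unfill[OF assms(1,2)])
    show "g q \<in> {..<K} \<and> qs ! g q = q" if "q \<in> positions t" for q
      using g[OF that] len by (simp add: qs_def nth_append)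
  qed
  moreover have "length qs = Suc K" "set qs \<subseteq> X" using len assms(4,5) l(1) by (auto simp: qs_def)
  ultimately show ?thesis by blast
qed

fun pmap :: "(nat \<Rightarrow> nat) \<Rightarrow> trm \<Rightarrow> trm" where
  "pmap \<pi> (Var x) = Var x"
| "pmap \<pi> (App f ts) = App (case f of PosC q \<Rightarrow> PosC (\<pi> q) | _ \<Rightarrow> f) (map (pmap \<pi>) ts)"

text \<open>Relabelling passes through a term without position constants into the substitution. This
  is how a step is transported between pointer lists with the same equality pattern.\<close>

lemma pmap_subst: "syms t \<inter> range PosC = {} \<Longrightarrow> pmap \<pi> (subst \<sigma> t) = subst (\<lambda>x. pmap \<pi> (\<sigma> x)) t"
proof (induction t)
  case (App f ts)
  then have "(case f of PosC q \<Rightarrow> PosC (\<pi> q) | _ \<Rightarrow> f) = f" by (auto split: fsym.splits)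
  moreover have "pmap \<pi> (subst \<sigma> t) = subst (\<lambda>x. pmap \<pi> (\<sigma> x)) t" if "t \<in> set ts" for t
    using App.prems that by (intro App.IH) auto
  ultimately show ?case by simp
qed simp

lemma pmap_fill: "syms s \<inter> range PosC = {} \<Longrightarrow> vars s \<subseteq> {..<length v} \<Longrightarrow> pmap \<pi> (fill v s) = fill (map \<pi> v) s"
  unfolding fill_def by (subst pmap_subst) (auto intro!: subst_cong_vars simp: const_def)

lemma positions_subst:
  assumes "syms t \<inter> range PosC = {}"
  shows "positions (subst \<sigma> t) = (\<Union>x\<in>vars t. positions (\<sigma> x))"
  using assms
proof (induction t)
  case (App f ts)
  then have "{q. PosC q = f} = {}" by auto
  moreover have "positions (subst \<sigma> t) = (\<Union>x\<in>vars t. positions (\<sigma> x))" if "t \<in> set ts" for t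
    using App.prems that by (intro App.IH) auto
  ultimately show ?case by (simp add: positions_App)
qed simp

lemma closed_fill: "closed (fill v s)"
  by (simp add: closed_def fill_def vars_subst const_def)

lemma wf_fill: "wf_trm s \<Longrightarrow> wf_trm (fill v s)"
  unfolding fill_def by (induction s) (auto simp: const_def)

text \<open>Pigeonhole: a walk of \<open>m\<close> steps has \<open>m + 1 > card V\<close> entries,
  so it contains a cycle; going round it \<open>k\<close> times gives at least \<open>k\<close>
  steps.\<close>

lemma relpowp_pump:
  assumes "finite V" "x \<in> V" "\<And>a b. a \<in> V \<Longrightarrow> R a b \<Longrightarrow> b \<in> V" "(R ^^ m) x y" "card V \<le> m"
  shows "\<exists>x\<in>V. \<exists>y. (R ^^ k) x y"
proof -
  obtain f where f: "f 0 = x" "f m = y" "\<And>i. i < m \<Longrightarrow> R (f i) (f (Suc i))"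
    using assms(4) unfolding relpowp_fun_conv by blast
  have V: "f i \<in> V" if "i \<le> m" for i
    using that by (induction i) (use f(1,3) assms(2,3) in auto)
  have "\<not> inj_on f {0..m}"
  proof
    assume "inj_on f {0..m}"
    then have "card {0..m} \<le> card V" using V assms(1) by (intro card_inj_on_le[of f]) auto
    then show False using assms(5) by simp
  qed
  then obtain i j where ij: "i < j" "j \<le> m" "f i = f j"
    unfolding inj_on_def by (metis atLeastAtMost_iff linorder_neqE_nat)
  have "(R ^^ (j - i)) (f i) (f j)" unfolding relpowp_fun_conv
    using f(3) ij by (intro exI[of _ "\<lambda>l. f (i + l)"]) simp
  then have cyc: "(R ^^ (j - i)) (f i) (f i)" using ij(3) by simp
  have "(R ^^ (k * (j - i))) (f i) (f i)"
    by (induction k) (auto simp: relpowp_add intro: relcomppI cyc)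
  moreover have "k * (j - i) = k + (k * (j - i) - k)" using ij by (cases "j - i") auto
  ultimately obtain z where "(R ^^ k) (f i) z" by (metis relcomppE relpowp_add)
  then show ?thesis using V[of i] ij by auto
qed

lemma relpowp_prefix:
  fixes R :: "'a \<Rightarrow> 'a \<Rightarrow> bool"
  assumes "(R ^^ m) x y" "k \<le> m"
  shows "\<exists>z. (R ^^ k) x z"
proof -
  obtain f where "f 0 = x" "\<forall>i<m. R (f i) (f (Suc i))"
    using assms(1) unfolding relpowp_fun_conv by blast
  then have "f 0 = x \<and> f k = f k \<and> (\<forall>i<k. R (f i) (f (Suc i)))" using assms(2) by simp
  then have "(R ^^ k) x (f k)" unfolding relpowp_fun_conv by (intro exI[of _ f])
  then show ?thesis ..
qed

section \<open>The pointer program of an observation\<close>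

datatype vertex = PhA fsym fsym trm | PhB fsym trm

text \<open>The active position gets a slot \<open>k\<close> of its own, since other occurrences of
  its old variable must keep their value when the active pointer moves.\<close>

fun activate :: "nat \<Rightarrow> trm \<Rightarrow> trm" where
  "activate k (App f [x, App g [y, z]]) = bul x (bul y (App Msym [Var k]))"
| "activate k t = t"

locale observation =
  fixes Sig :: "fsym set" and Ob :: wiring
  assumes finite_Sig: "finite Sig" and arity_Sig: "\<forall>c\<in>Sig. arity c = 0"
    and Ob: "Ob \<in> observations Sig"
begin

definition letters :: "fsym set" where "letters = insert Star Sig"

definition Sy :: "fsym set" where
  "Sy = (insert Bul (insert Msym (insert Star (\<Union>f\<in>Ob. syms (fst f) \<union> syms (snd f))))) - range PosC"

text \<open>Bounds the size of every term in \<open>Ob\<close>. The summand \<open>4\<close> counts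
  the levels of the frame \<open>x \<bullet> y \<bullet> M(p)\<close> of a word cell down to
  \<open>p\<close>, which truncation must spare.\<close>

definition H :: nat where "H = (\<Sum>f\<in>Ob. size (fst f) + size (snd f)) + 4"

text \<open>Bounds the number of position constants in a truncated term, and so the number of
  pointers needed for it; one more pointer is reserved for the active position.\<close>

definition K0 :: nat where "K0 = Suc (Max (arity ` Sy)) ^ H"

definition Sk :: "trm set" where "Sk = tset {..<K0} Sy H"

lemma finite_Ob: "finite Ob"
  using Ob by (simp add: observations_def)

lemma finite_syms: "finite (syms t)"
  by (induction t) auto

lemma finite_Sy: "finite Sy"
  by (simp add: Sy_def finite_Ob finite_syms)

lemma finite_Sk: "finite Sk"
  by (simp add: Sk_def finite_tset finite_Sy)

lemma Sy_simps: "Bul \<in> Sy" "Msym \<in> Sy" "Star \<in> Sy" "Sy \<inter> range PosC = {}" "PosC q \<notin> Sy"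
  by (auto simp: Sy_def)

lemma Sk_props: "s \<in> Sk \<Longrightarrow> vars s \<subseteq> {..<K0} \<and> syms s \<inter> range PosC = {} \<and> wf_trm s"
  using tset_props[of s "{..<K0}" Sy H] Sy_simps by (auto simp: Sk_def)

lemma card_positions_K0: "t \<in> tset {} (Sy \<union> range PosC) H \<Longrightarrow> card (positions t) \<le> K0"
  unfolding K0_def using finite_Sy by (intro card_positions[of "Sy \<union> range PosC"]) auto

lemma inst_ObE:
  assumes "(a', a) \<in> inst Ob"
  obtains c d t c' d' u \<sigma> where "(tri c d t, tri c' d' u) \<in> Ob" "a' = tri c d (subst \<sigma> t)" "a = tri c' d' (subst \<sigma> u)"
    "c \<in> letters" "c' \<in> letters" "d \<in> {Lsym, Rsym}" "d' \<in> {Lsym, Rsym}" "free_flow (t, u)"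
    "syms t \<union> syms u \<subseteq> Sy" "size t \<le> H" "size u \<le> H"
proof -
  obtain \<sigma> f where f: "f \<in> Ob" "a' = subst \<sigma> (fst f)" "a = subst \<sigma> (snd f)"
    using assms by (auto simp: inst_def)
  obtain c d t c' d' u where *: "f = (tri c d t, tri c' d' u)" "c \<in> letters" "c' \<in> letters"
    "d \<in> {Lsym, Rsym}" "d' \<in> {Lsym, Rsym}" "free_flow (t, u)"
    using observation_flows[OF Ob f(1)] unfolding letters_def by blast
  have "syms t \<union> syms u \<subseteq> Sy"
    using f(1) *(1,6) by (force simp: Sy_def free_flow_def tri_def bul_def)
  moreover have "size (fst f) + size (snd f) \<le> H"
    unfolding H_def using finite_Ob f(1) by (intro trans_le_add1 member_le_sum) auto
  then have "size t \<le> H" "size u \<le> H" by (auto simp: *(1) tri_def bul_def)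
  ultimately show thesis using that[of c d t c' d' u \<sigma>] f * by simp
qed

lemma is_flow_Ob: "\<forall>f\<in>Ob. is_flow f"
proof
  fix f assume "f \<in> Ob"
  then obtain c d t c' d' u where *: "f = (tri c d t, tri c' d' u)" "c \<in> letters" "c' \<in> letters"
    "d \<in> {Lsym, Rsym}" "d' \<in> {Lsym, Rsym}" "free_flow (t, u)"
    using observation_flows[OF Ob] unfolding letters_def by blast
  then have "arity c = 0" "arity c' = 0" using arity_Sig by (auto simp: letters_def)
  then show "is_flow f" using * by (auto simp: is_flow_def free_flow_def tri_def bul_def const_def)
qed

text \<open>The common pattern of relabelling and truncation: both turn the two sides of an instance
  into the two sides of another instance of the same flow.\<close>

lemma inst_Ob_map:
  assumes "(tri c1 d1 b', tri c2 d2 b) \<in> inst Ob"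
    and m: "\<And>t u \<sigma>. free_flow (t, u) \<Longrightarrow> syms t \<union> syms u \<subseteq> Sy \<Longrightarrow> size t \<le> H \<Longrightarrow> size u \<le> H \<Longrightarrow>
      \<exists>\<sigma>'. m (subst \<sigma> t) = subst \<sigma>' t \<and> m (subst \<sigma> u) = subst \<sigma>' u"
  shows "(tri c1 d1 (m b'), tri c2 d2 (m b)) \<in> inst Ob"
  using assms(1)
proof (cases rule: inst_ObE)
  case (1 c d t c' d' u \<sigma>)
  then obtain \<sigma>' where "m (subst \<sigma> t) = subst \<sigma>' t" "m (subst \<sigma> u) = subst \<sigma>' u" using m by blast
  then have "(tri c1 d1 (m b'), tri c2 d2 (m b)) = (subst \<sigma>' (tri c d t), subst \<sigma>' (tri c' d' u))"
    using 1 by simp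
  then show ?thesis using 1(1) unfolding inst_def by blast
qed

lemma inst_Ob_pmap:
  assumes "(tri c d b', tri c' d' b) \<in> inst Ob"
  shows "(tri c d (pmap \<pi> b'), tri c' d' (pmap \<pi> b)) \<in> inst Ob"
proof (rule inst_Ob_map[OF assms])
  fix t u \<sigma> assume "syms t \<union> syms u \<subseteq> Sy"
  then have "syms t \<inter> range PosC = {}" "syms u \<inter> range PosC = {}" using Sy_simps by auto
  then show "\<exists>\<sigma>'. pmap \<pi> (subst \<sigma> t) = subst \<sigma>' t \<and> pmap \<pi> (subst \<sigma> u) = subst \<sigma>' u"
    by (intro exI[of _ "\<lambda>x. pmap \<pi> (\<sigma> x)"] conjI pmap_subst)
qed

lemma inst_Ob_coll:
  assumes "(tri c d b', tri c' d' b) \<in> inst Ob" "\<And>f. f \<in> Sy \<Longrightarrow> P f"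
  shows "(tri c d (coll P H b'), tri c' d' (coll P H b)) \<in> inst Ob"
proof (rule inst_Ob_map[OF assms(1)])
  fix t u \<sigma>
  assume tu: "free_flow (t, u)" "syms t \<union> syms u \<subseteq> Sy" "size t \<le> H" "size u \<le> H"
  \<comment> \<open>The common height of the occurrences of \<open>x\<close> on both sides; for a
    variable without occurrences the value is arbitrary.\<close>
  define height where "height x = (SOME k. k \<in> occ_heights t x \<union> occ_heights u x)" for x
  define \<sigma>' where "\<sigma>' x = coll P (H - height x) (\<sigma> x)" for x
  have height: "height x = k" if "k \<in> occ_heights t x \<union> occ_heights u x" for x k
  proof -
    have "height x \<in> occ_heights t x \<union> occ_heights u x" unfolding height_def using that by (rule someI)
    then show ?thesis using tu(1) that by (simp add: free_flow_def balanced_def)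
  qed
  have "coll P H (subst \<sigma> t) = subst \<sigma>' t"
    by (rule coll_subst) (use tu assms(2) height in \<open>auto simp: free_flow_def is_flow_def \<sigma>'_def\<close>)
  moreover have "coll P H (subst \<sigma> u) = subst \<sigma>' u"
    by (rule coll_subst) (use tu assms(2) height in \<open>auto simp: free_flow_def is_flow_def \<sigma>'_def\<close>)
  ultimately show "\<exists>\<sigma>'. coll P H (subst \<sigma> t) = subst \<sigma>' t \<and> coll P H (subst \<sigma> u) = subst \<sigma>' u" by blast
qed

text \<open>A flow without position constants and without new variables on the left creates no
  position constants, so the pointers of a result can be copied from existing ones.\<close>

lemma inst_Ob_positions:
  assumes "(tri c1 d1 b', tri c2 d2 b) \<in> inst Ob"
  shows "positions b' \<subseteq> positions b"
  using assms
proof (cases rule: inst_ObE)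
  case (1 c d t c' d' u \<sigma>)
  then have "vars t \<subseteq> vars u" "syms t \<inter> range PosC = {}" "syms u \<inter> range PosC = {}"
    by (auto simp: free_flow_def is_flow_def)
  then show ?thesis using 1 by (auto simp: positions_subst)
qed

text \<open>The vertex \<open>PhA c d s\<close> with pointers \<open>v\<close> stands for the term \<open>c \<bullet> d \<bullet> s\<close>, where each
  variable \<open>k\<close> of the skeleton \<open>s\<close> is replaced by the position constant that \<open>v ! k\<close> points to.
  In \<open>PhB d s\<close>, which follows a step of the word, the letter is the one read by pointer \<open>K0\<close>. The
  flows do not mention position constants, so whether a step of the observation from a skeleton is
  possible depends only on which pointers are equal; its effect is therefore described by an
  arbitrary list \<open>v0\<close> with the same equality pattern.\<close>

fun gm :: "vertex prog" where
  "gm (PhA c d s) rd = {(PhB (opposite d) (activate K0 s), map (\<lambda>k. (k, Stay)) [0..<K0] @ [(k, turn d)]) | k x y.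
     s = bul x (bul y (App Msym [Var k])) \<and> k < K0 \<and> letter (fst (rd ! k)) = c}"
| "gm (PhB d s) rd = {(PhA c' d' s', map (\<lambda>k. (k, Stay)) ks) | c' d' s' ks v0.
     c' \<in> letters \<and> d' \<in> {Lsym, Rsym} \<and> s' \<in> Sk \<and> length ks = Suc K0 \<and> set ks \<subseteq> {..<Suc K0} \<and>
     length v0 = Suc K0 \<and> map snd rd = map (\<lambda>x. map (\<lambda>y. y = x) v0) v0 \<and>
     (tri c' d' (fill (map (\<lambda>k. v0 ! k) ks) s'), tri (letter (fst (rd ! K0))) d (fill v0 s)) \<in> inst Ob}"

definition vertices :: "vertex set" where
  "vertices = (\<lambda>(c, d, s). PhA c d s) ` (letters \<times> {Lsym, Rsym} \<times> Sk) \<union>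
     (\<lambda>(d, s). PhB d s) ` ({Lsym, Rsym} \<times> activate K0 ` Sk)"

lemma in_vertices [simp]:
  "PhA c d s \<in> vertices \<longleftrightarrow> c \<in> letters \<and> d \<in> {Lsym, Rsym} \<and> s \<in> Sk"
  "PhB d s \<in> vertices \<longleftrightarrow> d \<in> {Lsym, Rsym} \<and> s \<in> activate K0 ` Sk"
  by (auto simp: vertices_def image_iff)

lemma finite_vertices: "finite vertices"
  unfolding vertices_def using finite_Sk finite_Sig by (simp add: letters_def)

lemma opposite_in: "opposite d \<in> {Lsym, Rsym}"
  by (simp add: opposite_def)

lemma gm_prog:
  assumes "s \<in> vertices" "(s', ops) \<in> gm s rd"
  shows "s' \<in> vertices \<and> length ops = Suc K0 \<and> fst ` set ops \<subseteq> {..<Suc K0}"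
proof (cases s)
  case (PhA c d t)
  then show ?thesis using assms opposite_in[of d] by (auto simp: image_image)
next
  case (PhB d t)
  then show ?thesis using assms by (auto simp: image_image)
qed

lemma activate_props:
  assumes "s \<in> activate K0 ` Sk"
  shows "vars s \<subseteq> {..<Suc K0}" "syms s \<inter> range PosC = {}" "wf_trm s"
proof -
  obtain t where t: "s = activate K0 t" "t \<in> Sk" using assms by blast
  have "vars s \<subseteq> {..<Suc K0} \<and> syms s \<inter> range PosC = {} \<and> wf_trm s"
    using Sk_props[OF t(2)] unfolding t(1)
    by (cases "(K0, t)" rule: activate.cases) (auto simp: bul_def)
  then show "vars s \<subseteq> {..<Suc K0}" "syms s \<inter> range PosC = {}" "wf_trm s" by auto
qed

text \<open>Determinism of \<open>Ob\<close> fixes the resulting term, not its presentation by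
  skeleton and pointers; one presentation is chosen, depending only on the state and on what the
  program reads.\<close>

definition pick :: "vertex prog" where
  "pick s rd = (if gm s rd = {} then {} else {SOME e. e \<in> gm s rd})"

lemma pick_subset: "pick s rd \<subseteq> gm s rd"
  by (auto simp: pick_def some_in_eq)

lemma pick_unique: "x \<in> pick s rd \<Longrightarrow> y \<in> pick s rd \<Longrightarrow> x = y"
  by (auto simp: pick_def split: if_splits)

end

section \<open>Correctness of the pointer program\<close>

locale observation_run = observation Sig Ob for Sig Ob +
  fixes w :: "fsym list" and p :: "nat list"
  assumes w: "set w \<subseteq> Sig" and p: "length p = length w + 1" "distinct p"
begin

abbreviation n where "n \<equiv> length w"

fun val :: "vertex \<times> nat list \<Rightarrow> trm" where
  "val (PhA c d s, v) = tri c d (fill (map ((!) p) v) s)"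
| "val (PhB d s, v) = tri (letter (read_inp w (v ! K0))) d (fill (map ((!) p) v) s)"

definition valid :: "vertex \<times> nat list \<Rightarrow> bool" where
  "valid x \<longleftrightarrow> fst x \<in> vertices \<and> length (snd x) = Suc K0 \<and> (\<forall>k\<in>set (snd x). k \<le> n)"

lemma letter_in: "j \<le> n \<Longrightarrow> letter (read_inp w j) \<in> letters"
  using w nth_mem[of "j - 1" w] by (auto simp: read_inp_def letters_def subset_iff)

lemma valid_pstep:
  assumes "valid x" "pstep gm w x y"
  shows "valid y"
proof -
  obtain ops where ops: "(fst y, ops) \<in> gm (fst x) (info w (snd x))" "snd y = upd n ops (snd x)"
    using assms(2) by (auto simp: pstep_def)
  have *: "fst y \<in> vertices" "length ops = Suc K0" "fst ` set ops \<subseteq> {..<Suc K0}"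
    using gm_prog[OF _ ops(1)] assms(1) by (auto simp: valid_def)
  have "k \<le> n" if k: "k \<in> set (snd y)" for k
  proof -
    obtain l m where lm: "(l, m) \<in> set ops" "k = mv n m (snd x ! l)"
      using k by (auto simp: ops(2) upd_def)
    then have "l < length (snd x)" using *(3) assms(1) by (force simp: valid_def)
    then show ?thesis using assms(1) lm(2) by (simp add: mv_le valid_def)
  qed
  then show ?thesis using * by (simp add: valid_def ops(2) upd_def)
qed

lemma fill_cell: "fill v (bul x (bul y (App Msym [Var k]))) = bul (fill v x) (bul (fill v y) (App Msym [const (PosC (v ! k))]))"
  by (simp add: fill_def bul_def)

lemma fill_cong: "vars s \<subseteq> V \<Longrightarrow> (\<And>k. k \<in> V \<Longrightarrow> v ! k = v' ! k) \<Longrightarrow> fill v s = fill v' s"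
  unfolding fill_def by (intro subst_cong_vars) auto

lemma fill_bulE:
  assumes "fill v s = bul x y"
  obtains s1 s2 where "s = bul s1 s2" "x = fill v s1" "y = fill v s2"
  using assms by (cases s) (auto simp: fill_def bul_def const_def)

lemma upd_turn:
  assumes "length v = Suc K0" "k < K0"
  shows "upd n (map (\<lambda>k. (k, Stay)) [0..<K0] @ [(k, turn d)]) v = take K0 v @ [mv n (turn d) (v ! k)]"
  using assms by (auto simp: upd_def list_eq_iff_nth_eq nth_append)

lemma val_turn:
  assumes "length v = Suc K0" "\<forall>k\<in>set v. k \<le> n" "k < K0" "bul x (bul y (App Msym [Var k])) \<in> Sk"
  shows "val (PhB d (activate K0 (bul x (bul y (App Msym [Var k])))), take K0 v @ [j]) =
    cell (letter (read_inp w j)) d (fill (map ((!) p) v) x) (fill (map ((!) p) v) y) (p ! j)"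
proof -
  let ?v = "map ((!) p) (take K0 v @ [j])"
  have vars: "vars x \<subseteq> {..<K0}" "vars y \<subseteq> {..<K0}" using Sk_props[OF assms(4)] by (auto simp: bul_def)
  have eq: "?v ! l = map ((!) p) v ! l" if "l \<in> {..<K0}" for l
    using that assms(1) by (simp add: nth_append)
  have "fill ?v x = fill (map ((!) p) v) x" "fill ?v y = fill (map ((!) p) v) y"
    using fill_cong[OF vars(1) eq] fill_cong[OF vars(2) eq] by simp_all
  moreover have "activate K0 (bul x (bul y (App Msym [Var k]))) = bul x (bul y (App Msym [Var K0]))"
    by (simp add: bul_def)
  ultimately show ?thesis using assms(1) by (simp add: cell_def fill_cell nth_append)
qed

lemma stepA_sound:
  assumes "valid (PhA c d s, v)" "pstep gm w (PhA c d s, v) y"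
  shows "(\<exists>d' s'. fst y = PhB d' s') \<and> (val y, val (PhA c d s, v)) \<in> inst (wordrep w p)"
proof -
  have v: "length v = Suc K0" "\<forall>k\<in>set v. k \<le> n" "s \<in> Sk" "d \<in> {Lsym, Rsym}" using assms(1) by (auto simp: valid_def)
  obtain k t u where s: "s = bul t (bul u (App Msym [Var k]))" and k: "k < K0" "letter (fst (info w v ! k)) = c"
    and y: "y = (PhB (opposite d) (activate K0 s), upd n (map (\<lambda>k. (k, Stay)) [0..<K0] @ [(k, turn d)]) v)"
    using assms(2) by (cases y) (auto simp: pstep_def)
  have c: "c = letter (read_inp w (v ! k))" using k v(1) by (simp add: info_def)
  have "val y = cell (letter (read_inp w (mv n (turn d) (v ! k)))) (opposite d)
      (fill (map ((!) p) v) t) (fill (map ((!) p) v) u) (p ! mv n (turn d) (v ! k))"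
    unfolding y upd_turn[OF v(1) k(1)] s using v k s by (intro val_turn) auto
  moreover have "val (PhA c d s, v) = cell (letter (read_inp w (v ! k))) d
      (fill (map ((!) p) v) t) (fill (map ((!) p) v) u) (p ! (v ! k))"
    using k v(1) by (simp add: s fill_cell cell_def c)
  moreover have "v ! k \<le> n" using v k(1) by simp
  ultimately show ?thesis unfolding inst_wordrep[OF p(1)] using v(4) y
    by (intro conjI exI[of _ "v ! k"] exI[of _ d] exI) auto
qed

lemma stepA_complete:
  assumes "valid (PhA c d s, v)" "(b, val (PhA c d s, v)) \<in> inst (wordrep w p)"
  shows "\<exists>y. pstep gm w (PhA c d s, v) y \<and> val y = b"
proof -
  have v: "length v = Suc K0" "\<forall>k\<in>set v. k \<le> n" "s \<in> Sk" using assms(1) by (auto simp: valid_def)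
  let ?v = "map ((!) p) v"
  obtain j d' x y where j: "j \<le> n" "tri c d (fill ?v s) = cell (letter (read_inp w j)) d' x y (p ! j)"
    and b: "b = cell (letter (read_inp w (mv n (turn d') j))) (opposite d') x y (p ! mv n (turn d') j)"
    using assms(2) unfolding inst_wordrep[OF p(1)] val.simps by blast
  have cd: "c = letter (read_inp w j)" "d' = d" "fill ?v s = bul x (bul y (App Msym [const (PosC (p ! j))]))"
    using j(2) by (auto simp: cell_def)
  obtain t s1 where s: "s = bul t s1" "x = fill ?v t" "bul y (App Msym [const (PosC (p ! j))]) = fill ?v s1"
    using cd(3) by (rule fill_bulE)
  obtain u s2 where s1: "s1 = bul u s2" "y = fill ?v u" "App Msym [const (PosC (p ! j))] = fill ?v s2"
    using s(3)[symmetric] by (rule fill_bulE)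
  obtain s3 where s2: "s2 = App Msym [s3]" "const (PosC (p ! j)) = fill ?v s3"
    using s1(3) by (cases s2) (auto simp: fill_def const_def)
  \<comment> \<open>Skeletons contain no position constants, so the argument of \<open>Msym\<close>
    must come from a variable, the one that becomes active.\<close>
  obtain k where s3: "s3 = Var k"
  proof (cases s3)
    case (App f ts)
    then have "f = PosC (p ! j)" using s2(2) by (auto simp: fill_def const_def)
    then show thesis using Sk_props[OF v(3)] App by (auto simp: s s1 s2 bul_def)
  qed
  have s': "s = bul t (bul u (App Msym [Var k]))" using s s1 s2 s3 by simp
  then have k: "k < K0" using Sk_props[OF v(3)] by (auto simp: bul_def)
  have vk: "v ! k \<le> n" using v k by simp
  have "p ! j = p ! (v ! k)" using s2(2) s3 k v(1) by (simp add: fill_def const_def)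
  \<comment> \<open>Distinctness of \<open>p\<close> recovers the pointer from the position
    constant.\<close>
  then have vj: "v ! k = j" using p j(1) vk by (simp add: nth_eq_iff_index_eq)
  let ?y = "(PhB (opposite d) (activate K0 s), upd n (map (\<lambda>k. (k, Stay)) [0..<K0] @ [(k, turn d)]) v)"
  have "letter (fst (info w v ! k)) = c" using k v(1) vj cd(1) by (simp add: info_def)
  then have "pstep gm w (PhA c d s, v) ?y" using k s' by (auto simp: pstep_def)
  moreover have "val ?y = b"
    unfolding upd_turn[OF v(1) k] vj s' b cd(2) s(2) s1(2) using v k s' by (intro val_turn) auto
  ultimately show ?thesis by blast
qed

lemma stepB_sound:
  assumes "valid (PhB d s, v)" "pstep gm w (PhB d s, v) y"
  shows "(\<exists>c d s. fst y = PhA c d s) \<and> (val y, val (PhB d s, v)) \<in> inst Ob"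
proof -
  have v: "length v = Suc K0" "s \<in> activate K0 ` Sk" using assms(1) by (auto simp: valid_def)
  obtain y1 ops where ops: "(y1, ops) \<in> gm (PhB d s) (info w v)" "y = (y1, upd n ops v)"
    using assms(2) by (rule pstepE)
  obtain c' d' s' ks v0 where y': "(y1, ops) = (PhA c' d' s', map (\<lambda>k. (k, Stay)) ks)" "s' \<in> Sk"
    and ks: "length ks = Suc K0" "set ks \<subseteq> {..<Suc K0}"
    and v0: "length v0 = Suc K0" "map snd (info w v) = map (\<lambda>x. map (\<lambda>y. y = x) v0) v0"
    and step: "(tri c' d' (fill (map ((!) v0) ks) s'), tri (letter (fst (info w v ! K0))) d (fill v0 s)) \<in> inst Ob"
    using ops(1) unfolding gm.simps mem_Collect_eq by (elim exE conjE) (rule that, assumption+)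
  have y: "y = (PhA c' d' s', upd n (map (\<lambda>k. (k, Stay)) ks) v)" "s' \<in> Sk"
    using y' ops(2) by simp_all
  have pat: "v0 ! k = v0 ! l \<longleftrightarrow> v ! k = v ! l" if "k < Suc K0" "l < Suc K0" for k l
  proof -
    have "snd (info w v ! l) ! k = (map (\<lambda>x. map (\<lambda>y. y = x) v0) v0) ! l ! k"
      using arg_cong[OF v0(2), of "\<lambda>L. L ! l ! k"] that v by (simp add: info_def)
    then show ?thesis using that v v0(1) by (simp add: info_def)
  qed
  \<comment> \<open>Sends the sample values \<open>v0\<close> to the actual position constants. The
    choice of \<open>k\<close> is harmless because equal entries of \<open>v0\<close> belong to
    equal pointers.\<close>
  define \<pi> where "\<pi> q = p ! (v ! (SOME k. k < Suc K0 \<and> v0 ! k = q))" for q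
  have \<pi>: "\<pi> (v0 ! k) = p ! (v ! k)" if "k < Suc K0" for k
  proof -
    define l where "l = (SOME l. l < Suc K0 \<and> v0 ! l = v0 ! k)"
    have l: "l < Suc K0 \<and> v0 ! l = v0 ! k"
      unfolding l_def by (rule someI[of _ k]) (use that in simp)
    then have "v ! l = v ! k" using pat[of l k] that by blast
    then show ?thesis unfolding \<pi>_def l_def by (rule arg_cong)
  qed
  have 1: "pmap \<pi> (fill v0 s) = fill (map ((!) p) v) s"
  proof -
    have "map \<pi> v0 = map ((!) p) v" using \<pi> v0(1) v(1) by (intro nth_equalityI) auto
    then show ?thesis using pmap_fill[of s v0 \<pi>] activate_props[OF v(2)] v0(1) by simp
  qed
  have 2: "pmap \<pi> (fill (map ((!) v0) ks) s') = fill (map ((!) p) (map ((!) v) ks)) s'"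
  proof -
    have "map \<pi> (map ((!) v0) ks) = map ((!) p) (map ((!) v) ks)"
      unfolding map_map using \<pi> ks(2) by (intro map_cong refl) (simp add: subset_iff)
    moreover have "pmap \<pi> (fill (map ((!) v0) ks) s') = fill (map \<pi> (map ((!) v0) ks)) s'"
      using Sk_props[OF y(2)] ks(1) by (intro pmap_fill) auto
    ultimately show ?thesis by (simp only:)
  qed
  have "upd n (map (\<lambda>k. (k, Stay)) ks) v = map ((!) v) ks" by (simp add: upd_def)
  then have "val y = tri c' d' (pmap \<pi> (fill (map ((!) v0) ks) s'))" using y 2 by simp
  moreover have "val (PhB d s, v) = tri (letter (fst (info w v ! K0))) d (pmap \<pi> (fill v0 s))"
    using 1 v(1) by (simp add: info_def)
  ultimately show ?thesis using inst_Ob_pmap[OF step, of \<pi>] y(1) by simp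
qed

definition U :: "trm set" where
  "U = {tri c d b | c d b. c \<in> letters \<and> d \<in> {Lsym, Rsym} \<and> b \<in> tset {} (Sy \<union> range PosC) H}"

text \<open>The actual position constants themselves serve as the sample list \<open>v0\<close>. The
  result is required to be truncated, since otherwise it need not have a skeleton in
  \<open>Sk\<close>.\<close>

lemma stepB_complete:
  assumes "valid (PhB d s, v)" "(a, val (PhB d s, v)) \<in> inst Ob" "a \<in> U"
  shows "\<exists>y. pstep gm w (PhB d s, v) y \<and> val y = a"
proof -
  have v: "length v = Suc K0" "\<forall>k\<in>set v. k \<le> n" "s \<in> activate K0 ` Sk" using assms(1) by (auto simp: valid_def)
  let ?v = "map ((!) p) v"
  obtain c' d' b where a: "a = tri c' d' b" "c' \<in> letters" "d' \<in> {Lsym, Rsym}" "b \<in> tset {} (Sy \<union> range PosC) H"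
    using assms(3) unfolding U_def by blast
  have "positions b \<subseteq> positions (fill ?v s)" using inst_Ob_positions assms(2) by (simp add: a(1))
  also have "\<dots> \<subseteq> set ?v"
    using activate_props[OF v(3)] v(1) nth_mem[of _ ?v] unfolding fill_def
    by (subst positions_subst) (auto simp: positions_def const_def)
  finally have "positions b \<subseteq> set ?v" .
  moreover have "?v ! 0 \<in> set ?v" using v(1) by (intro nth_mem) simp
  ultimately obtain s' qs where s': "s' \<in> Sk" "length qs = Suc K0" "set qs \<subseteq> set ?v" "fill qs s' = b"
    using representable[OF a(4) Sy_simps(4) card_positions_K0[OF a(4)]] unfolding Sk_def by blast
  have "\<forall>q\<in>set qs. \<exists>k<Suc K0. ?v ! k = q" using s'(3) v(1) by (metis in_set_conv_nth length_map subsetD)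
  then obtain f where f: "\<And>q. q \<in> set qs \<Longrightarrow> f q < Suc K0 \<and> ?v ! f q = q" by metis
  define ks where "ks = map f qs"
  have qs: "map ((!) ?v) ks = qs" using f by (simp add: ks_def map_idI)
  have ks: "length ks = Suc K0" "set ks \<subseteq> {..<Suc K0}" using f s'(2) by (auto simp: ks_def)
  have pat: "map snd (info w v) = map (\<lambda>x. map (\<lambda>y. y = x) ?v) ?v"
  proof -
    have "p ! y = p ! x \<longleftrightarrow> y = x" if "x \<in> set v" "y \<in> set v" for x y
      using that v(2) p by (simp add: nth_eq_iff_index_eq less_Suc_eq_le)
    then show ?thesis by (simp add: info_def)
  qed
  let ?y = "(PhA c' d' s', upd n (map (\<lambda>k. (k, Stay)) ks) v)"
  have "(tri c' d' (fill (map ((!) ?v) ks) s'), tri (letter (fst (info w v ! K0))) d (fill ?v s)) \<in> inst Ob"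
    using assms(2) v(1) unfolding qs s'(4) by (simp add: a(1) info_def)
  then have "(PhA c' d' s', map (\<lambda>k. (k, Stay)) ks) \<in> gm (PhB d s) (info w v)"
    using a(2,3) s'(1) ks pat v(1) unfolding gm.simps
    by (intro CollectI exI[of _ c'] exI[of _ d'] exI[of _ s'] exI[of _ ks] exI[of _ ?v]) simp
  then have "pstep gm w (PhB d s, v) ?y" by (auto simp: pstep_def)
  moreover have "val ?y = a"
  proof -
    have "map ((!) p) (upd n (map (\<lambda>k. (k, Stay)) ks) v) = map ((!) ?v) ks"
      using ks(2) v(1) by (auto simp: upd_def)
    then show ?thesis using qs s'(4) a(1) by simp
  qed
  ultimately show ?thesis by blast
qed

text \<open>Position constants outside \<open>p\<close> are cut as well: they can occur in
  instances, but no pointer into the word denotes them.\<close>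

definition kept :: "fsym \<Rightarrow> bool" where
  "kept f \<longleftrightarrow> f \<in> Sy \<union> PosC ` set p"

fun collapse :: "trm \<Rightarrow> trm" where
  "collapse (App f [x, App g [y, b]]) = App f [x, App g [y, coll kept H b]]"
| "collapse t = t"

lemma collapse_tri [simp]: "collapse (tri c d b) = tri c d (coll kept H b)"
  by (simp add: tri_def bul_def)

lemma coll_kept:
  "coll kept H b \<in> tset {} (Sy \<union> range PosC) H" "positions (coll kept H b) \<subseteq> set p"
proof -
  show "coll kept H b \<in> tset {} (Sy \<union> range PosC) H" by (rule coll_tset) (auto simp: kept_def)
  have "coll kept H b \<in> tset {} (Sy \<union> PosC ` set p) H" by (rule coll_tset) (simp add: kept_def)
  then have "syms (coll kept H b) \<subseteq> insert Star (Sy \<union> PosC ` set p)" using tset_props by blast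
  then show "positions (coll kept H b) \<subseteq> set p" using Sy_simps(5) by (auto simp: positions_def)
qed

lemma inst_Ob_collapse:
  assumes "(a', a) \<in> inst Ob"
  shows "(collapse a', collapse a) \<in> inst Ob \<and> collapse a' \<in> U"
  using assms
proof (cases rule: inst_ObE)
  case (1 c d t c' d' u \<sigma>)
  then have "(tri c d (coll kept H (subst \<sigma> t)), tri c' d' (coll kept H (subst \<sigma> u))) \<in> inst Ob"
    using assms by (intro inst_Ob_coll) (auto simp: kept_def)
  then show ?thesis using 1 coll_kept by (auto simp: U_def)
qed

lemma inst_word_collapse:
  assumes "(a', a) \<in> inst (wordrep w p)"
  shows "(collapse a', collapse a) \<in> inst (wordrep w p)"
proof -
  obtain j d x y where j: "j \<le> n" "d \<in> {Lsym, Rsym}" "a = cell (letter (read_inp w j)) d x y (p ! j)"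
    "a' = cell (letter (read_inp w (mv n (turn d) j))) (opposite d) x y (p ! mv n (turn d) j)"
    using assms unfolding inst_wordrep[OF p(1)] by blast
  \<comment> \<open>Four levels leave the frame of a word cell intact; only \<open>x\<close> and
    \<open>y\<close> get truncated.\<close>
  obtain h where h: "H = Suc (Suc (Suc (Suc h)))" by (simp add: H_def)
  have nth: "p ! k \<in> set p" if "k \<le> n" for k using that p(1) by simp
  have "p ! j \<in> set p" "p ! mv n (turn d) j \<in> set p" using nth[OF j(1)] nth[OF mv_le[OF j(1)]] .
  then have "kept Bul" "kept Msym" "kept (PosC (p ! j))" "kept (PosC (p ! mv n (turn d) j))"
    using Sy_simps by (auto simp: kept_def)
  then have "collapse a = cell (letter (read_inp w j)) d (coll kept (Suc (Suc (Suc h))) x) (coll kept (Suc (Suc h)) y) (p ! j)"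
    "collapse a' = cell (letter (read_inp w (mv n (turn d) j))) (opposite d)
      (coll kept (Suc (Suc (Suc h))) x) (coll kept (Suc (Suc h)) y) (p ! mv n (turn d) j)"
    unfolding j(3,4) cell_def collapse_tri h by (simp_all add: bul_def const_def)
  then show ?thesis unfolding inst_wordrep[OF p(1)] using j(1,2) by blast
qed

definition rel :: "(trm \<times> trm) set" where
  "rel = inst Ob O inst (wordrep w p)"

text \<open>Restricting the results of \<open>Ob\<close> to truncated terms keeps each step within
  the scope of \<open>stepB_complete\<close>.\<close>

definition urel :: "(trm \<times> trm) set" where
  "urel = (inst Ob \<inter> U \<times> UNIV) O inst (wordrep w p)"

lemma rel_collapse: "(a', a) \<in> rel \<Longrightarrow> (collapse a', collapse a) \<in> urel"
  unfolding rel_def urel_def using inst_word_collapse inst_Ob_collapse by blast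

lemma relpow_collapse: "(a', a) \<in> rel ^^ m \<Longrightarrow> (collapse a', collapse a) \<in> urel ^^ m"
proof (induction m arbitrary: a)
  case (Suc m)
  then obtain b where "(b, a) \<in> rel" "(a', b) \<in> rel ^^ m" by auto
  then show ?case using Suc.IH rel_collapse by auto
qed simp

lemma nilpotent_rel: "nilpotent (wprod Ob (wordrep w p)) \<longleftrightarrow> (\<exists>m. rel ^^ Suc m = {})"
  unfolding nilpotent_iff inst_wprod rel_def ..

lemma start_vertex:
  assumes "(a', a) \<in> rel"
  shows "\<exists>c d s v. valid (PhA c d s, v) \<and> val (PhA c d s, v) = collapse a"
proof -
  obtain b where "(b, a) \<in> inst (wordrep w p)" using assms unfolding rel_def by blast
  then obtain j d x y where j: "j \<le> n" "d \<in> {Lsym, Rsym}" "a = cell (letter (read_inp w j)) d x y (p ! j)"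
    unfolding inst_wordrep[OF p(1)] by blast
  define c where "c = letter (read_inp w j)"
  define t where "t = coll kept H (bul x (bul y (App Msym [const (PosC (p ! j))])))"
  have a: "collapse a = tri c d t" by (simp add: j(3) cell_def c_def t_def)
  have t: "t \<in> tset {} (Sy \<union> range PosC) H" "positions t \<subseteq> set p" unfolding t_def by (rule coll_kept)+
  have "p ! 0 \<in> set p" using p(1) by (intro nth_mem) simp
  then obtain s qs where s: "s \<in> Sk" "length qs = Suc K0" "set qs \<subseteq> set p" "fill qs s = t"
    using representable[OF t(1) Sy_simps(4) card_positions_K0[OF t(1)] t(2)] unfolding Sk_def by blast
  have "\<forall>q\<in>set qs. \<exists>k\<le>n. p ! k = q"
    using s(3) p(1) by (metis Suc_eq_plus1 in_set_conv_nth less_Suc_eq_le subsetD)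
  then obtain f where f: "\<And>q. q \<in> set qs \<Longrightarrow> f q \<le> n \<and> p ! f q = q" by metis
  have "map ((!) p) (map f qs) = qs" using f by (simp add: map_idI)
  then have "val (PhA c d s, map f qs) = collapse a" using s(4) a by simp
  moreover have "valid (PhA c d s, map f qs)"
    using f s(1,2) j(1,2) letter_in by (auto simp: valid_def c_def)
  ultimately show ?thesis by blast
qed

text \<open>A subprogram may drop transitions as long as another one leads to a vertex that denotes
  the same term.\<close>

definition adequate :: "vertex prog \<Rightarrow> bool" where
  "adequate \<delta> \<longleftrightarrow> (\<forall>s rd. \<delta> s rd \<subseteq> gm s rd) \<and>
     (\<forall>x y. valid x \<longrightarrow> pstep gm w x y \<longrightarrow> (\<exists>y'. pstep \<delta> w x y' \<and> val y' = val y))"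

lemma adequate_pstep: "adequate \<delta> \<Longrightarrow> pstep \<delta> w x y \<Longrightarrow> pstep gm w x y"
  unfolding adequate_def pstep_def by blast

text \<open>One step of \<open>urel\<close> becomes two program steps: the word in phase A, the
  observation in phase B. The vertices reached may differ from those that completeness of
  \<open>gm\<close> provides; the induction only needs their terms.\<close>

lemma walk_lift:
  assumes "adequate \<delta>"
  shows "(z, val (PhA c d s, v)) \<in> urel ^^ m \<Longrightarrow> valid (PhA c d s, v) \<Longrightarrow>
    \<exists>y. (pstep \<delta> w ^^ (2 * m)) (PhA c d s, v) y"
proof (induction m arbitrary: c d s v)
  case (Suc m)
  let ?x = "(PhA c d s, v)"
  obtain a b where b: "(b, val ?x) \<in> inst (wordrep w p)" "(a, b) \<in> inst Ob" "a \<in> U" "(z, a) \<in> urel ^^ m"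
    using Suc.prems(1) unfolding relpow.simps urel_def by blast
  obtain y1 where y1: "pstep gm w ?x y1" "val y1 = b" using stepA_complete[OF Suc.prems(2) b(1)] by blast
  then obtain y2 where y2: "pstep \<delta> w ?x y2" "val y2 = b" using assms Suc.prems(2) unfolding adequate_def by metis
  note g2 = adequate_pstep[OF assms y2(1)]
  have v2: "valid y2" by (rule valid_pstep[OF Suc.prems(2) g2])
  obtain d' s' where f2: "fst y2 = PhB d' s'" using stepA_sound[OF Suc.prems(2) g2] by blast
  then have e2: "y2 = (PhB d' s', snd y2)" by (metis prod.collapse)
  obtain y3 where y3: "pstep gm w y2 y3" "val y3 = a"
    using stepB_complete[of d' s' "snd y2" a] v2 b(2,3) y2(2) e2 by metis
  then obtain y4 where y4: "pstep \<delta> w y2 y4" "val y4 = a" using assms v2 unfolding adequate_def by metis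
  note g4 = adequate_pstep[OF assms y4(1)]
  have v4: "valid y4" by (rule valid_pstep[OF v2 g4])
  obtain c4 d4 s4 where "fst y4 = PhA c4 d4 s4" using stepB_sound[of d' s' "snd y2" y4] v2 g4 e2 by metis
  then have e4: "y4 = (PhA c4 d4 s4, snd y4)" by (metis prod.collapse)
  obtain y where "(pstep \<delta> w ^^ (2 * m)) y4 y" using Suc.IH[of c4 d4 s4 "snd y4"] b(4) y4(2) v4 e4 by metis
  then have "(pstep \<delta> w ^^ Suc (Suc (2 * m))) ?x y"
    using y2(1) y4(1) by (intro relpowp_Suc_I2)
  moreover have "2 * Suc m = Suc (Suc (2 * m))" by simp
  ultimately show ?case by metis
qed auto

lemma walk_project:
  assumes "\<And>x y. pstep \<delta> w x y \<Longrightarrow> pstep gm w x y"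
  shows "(pstep \<delta> w ^^ (2 * m)) (PhA c d s, v) y \<Longrightarrow> valid (PhA c d s, v) \<Longrightarrow>
    (val y, val (PhA c d s, v)) \<in> rel ^^ m"
proof (induction m arbitrary: c d s v)
  case (Suc m)
  let ?x = "(PhA c d s, v)"
  have "2 * Suc m = Suc (Suc (2 * m))" by simp
  then obtain y1 y2 where y1: "pstep \<delta> w ?x y1" and y2: "pstep \<delta> w y1 y2" "(pstep \<delta> w ^^ (2 * m)) y2 y"
    using Suc.prems(1) by (metis relpowp_Suc_D2)
  note g1 = assms[OF y1] and g2 = assms[OF y2(1)]
  have v1: "valid y1" by (rule valid_pstep[OF Suc.prems(2) g1])
  have v2: "valid y2" by (rule valid_pstep[OF v1 g2])
  obtain d' s' where "fst y1 = PhB d' s'" and r1: "(val y1, val ?x) \<in> inst (wordrep w p)"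
    using stepA_sound[OF Suc.prems(2) g1] by blast
  then have e1: "y1 = (PhB d' s', snd y1)" by (metis prod.collapse)
  obtain c2 d2 s2 where "fst y2 = PhA c2 d2 s2" and r2: "(val y2, val y1) \<in> inst Ob"
    using stepB_sound[of d' s' "snd y1" y2] v1 g2 e1 by metis
  then have e2: "y2 = (PhA c2 d2 s2, snd y2)" by (metis prod.collapse)
  have "(val y, val y2) \<in> rel ^^ m" using Suc.IH[of c2 d2 s2 "snd y2"] y2(2) v2 e2 by metis
  moreover have "(val y2, val ?x) \<in> rel" unfolding rel_def using r1 r2 by blast
  ultimately show ?case by auto
qed simp

lemma card_valid: "finite {x. valid x}" "card {x. valid x} \<le> card vertices * Suc n ^ Suc K0"
proof -
  have V: "{x. valid x} = vertices \<times> {v. set v \<subseteq> {..n} \<and> length v = Suc K0}"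
    by (auto simp: valid_def)
  show "finite {x. valid x}" unfolding V
    using finite_vertices finite_lists_length_eq[of "{..n}" "Suc K0"] by blast
  show "card {x. valid x} \<le> card vertices * Suc n ^ Suc K0"
    unfolding V card_cartesian_product by (simp add: card_lists_length_eq)
qed

text \<open>A long walk has at least as many steps as there are valid vertices, so it can be pumped,
  and decoding makes every power of \<open>rel\<close> nonempty. Conversely, a chain from a high
  power is truncated and lifted to a walk. The left side does not depend on
  \<open>p\<close>.\<close>

lemma long_walk_iff:
  assumes "adequate \<delta>" "set Sl = vertices" "searching \<delta> Sl (Suc K0)"
  shows "searching_run.long_walk \<delta> Sl (Suc K0) w \<longleftrightarrow> \<not> nilpotent (wprod Ob (wordrep w p))"
proof -
  interpret sr: searching_run \<delta> Sl "Suc K0" w using assms(3) by (rule searching_run.intro)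
  have arith: "c \<le> L - 1" if "c \<le> l" "1 \<le> b" "L = b + l" for b c l L :: nat using that by simp
  have card: "card {x. valid x} \<le> sr.\<Lambda> - 1"
  proof (rule arith)
    show "card {x. valid x} \<le> length Sl * Suc n ^ Suc K0"
      using card_valid(2) card_length[of Sl] unfolding assms(2)
      by (meson le_trans mult_le_mono1)
    show "1 \<le> Suc n ^ Suc K0" by (rule one_le_power) simp
    show "sr.\<Lambda> = Suc n ^ Suc K0 + length Sl * Suc n ^ Suc K0"
      by (simp only: sr.\<Lambda>_def sr.Z_def mult_Suc)
  qed
  show ?thesis
  proof
    assume sr.long_walk
    then obtain s x y where start: "s \<in> vertices" "length x = Suc K0" "\<forall>e\<in>set x. e \<le> n"
      and walk: "(pstep \<delta> w ^^ (sr.\<Lambda> - 1)) (s, x) y"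
      unfolding sr.long_walk_def assms(2) by blast
    have in_valid: "(s, x) \<in> {x. valid x}" using start by (simp add: valid_def)
    have closed: "b \<in> {x. valid x}" if "a \<in> {x. valid x}" "pstep \<delta> w a b" for a b
      using that valid_pstep adequate_pstep[OF assms(1)] by blast
    have "rel ^^ Suc m \<noteq> {}" for m
    proof -
      \<comment> \<open>One extra step: the pumped walk may begin in phase B, and dropping its first
        step aligns it with phase A.\<close>
      obtain x y where x: "valid x" "(pstep \<delta> w ^^ Suc (2 * Suc m)) x y"
        using relpowp_pump[where R = "pstep \<delta> w" and k = "Suc (2 * Suc m)",
            OF card_valid(1) in_valid _ walk card] closed by blast
      have "\<exists>c d s v z. valid (PhA c d s, v) \<and> (pstep \<delta> w ^^ (2 * Suc m)) (PhA c d s, v) z"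
      proof (cases "fst x")
        case (PhA c d s)
        then have e: "x = (PhA c d s, snd x)" by (metis prod.collapse)
        have "2 * Suc m \<le> Suc (2 * Suc m)" by simp
        then obtain z where "(pstep \<delta> w ^^ (2 * Suc m)) x z" using relpowp_prefix[OF x(2)] by blast
        then show ?thesis using x(1) e by metis
      next
        case (PhB d s)
        then have e: "x = (PhB d s, snd x)" by (metis prod.collapse)
        obtain x1 where x1: "pstep \<delta> w x x1" "(pstep \<delta> w ^^ (2 * Suc m)) x1 y"
          using relpowp_Suc_D2[OF x(2)] by blast
        note g1 = adequate_pstep[OF assms(1) x1(1)]
        have v1: "valid x1" by (rule valid_pstep[OF x(1) g1])
        obtain c d' s' where "fst x1 = PhA c d' s'" using stepB_sound[of d s "snd x" x1] x(1) g1 e by metis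
        then have "x1 = (PhA c d' s', snd x1)" by (metis prod.collapse)
        then show ?thesis using x1(2) v1 by metis
      qed
      then obtain c d s v z where v: "valid (PhA c d s, v)" "(pstep \<delta> w ^^ (2 * Suc m)) (PhA c d s, v) z" by blast
      have "(val z, val (PhA c d s, v)) \<in> rel ^^ Suc m"
        by (rule walk_project[OF adequate_pstep[OF assms(1)] v(2,1)])
      then show ?thesis by blast
    qed
    then show "\<not> nilpotent (wprod Ob (wordrep w p))" unfolding nilpotent_rel by blast
  next
    assume "\<not> nilpotent (wprod Ob (wordrep w p))"
    \<comment> \<open>Any exponent would do whose lifted walk has at least
      \<open>\<Lambda> - 1\<close> steps.\<close>
    then have "rel ^^ Suc sr.\<Lambda> \<noteq> {}" unfolding nilpotent_rel by blast
    then obtain z a where za: "(z, a) \<in> rel ^^ Suc sr.\<Lambda>" by auto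
    then obtain a1 where "(a1, a) \<in> rel" by auto
    then obtain c d s v where v: "valid (PhA c d s, v)" "val (PhA c d s, v) = collapse a"
      using start_vertex by blast
    have "(collapse z, val (PhA c d s, v)) \<in> urel ^^ Suc sr.\<Lambda>" unfolding v(2) by (rule relpow_collapse[OF za])
    then obtain y where y: "(pstep \<delta> w ^^ (2 * Suc sr.\<Lambda>)) (PhA c d s, v) y" using walk_lift[OF assms(1) _ v(1)] by blast
    have "sr.\<Lambda> - 1 \<le> 2 * Suc sr.\<Lambda>" by simp
    then obtain y' where y': "(pstep \<delta> w ^^ (sr.\<Lambda> - 1)) (PhA c d s, v) y'"
      using relpowp_prefix[OF y] by blast
    have "PhA c d s \<in> vertices" "length v = Suc K0" "\<forall>e\<in>set v. e \<le> n"
      using v(1) unfolding valid_def by simp_all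
    then show sr.long_walk unfolding sr.long_walk_def assms(2) using y' by blast
  qed
qed

lemma adequate_gm: "adequate gm"
  by (auto simp: adequate_def)

text \<open>Phase A offers at most one transition anyway. In phase B the current term is closed and
  well-formed, so determinism of \<open>Ob\<close> gives all transitions the same resulting
  term.\<close>

lemma adequate_pick:
  assumes "deterministic Ob"
  shows "adequate pick"
  unfolding adequate_def
proof (intro conjI allI impI)
  fix x y assume x: "valid x" "pstep gm w x y"
  obtain s v where sv: "x = (s, v)" by force
  have "gm s (info w v) \<noteq> {}" using x(2) unfolding pstep_def sv by auto
  then have "pick s (info w v) \<noteq> {}" by (simp add: pick_def)
  then obtain s' ops where "(s', ops) \<in> pick s (info w v)" by fastforce
  then have y': "pstep pick w x (s', upd n ops v)" unfolding pstep_def sv by auto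
  then have g: "pstep gm w x (s', upd n ops v)" using pick_subset unfolding pstep_def by blast
  have "val (s', upd n ops v) = val y"
  proof (cases s)
    case (PhA c d t)
    have "e1 = e2" if "e1 \<in> gm s (info w v)" "e2 \<in> gm s (info w v)" for e1 e2
      using that unfolding PhA by (auto simp: bul_def)
    then show ?thesis using g x(2) unfolding pstep_def sv by (cases y) fastforce
  next
    case (PhB d t)
    have "t \<in> activate K0 ` Sk" "d \<in> {Lsym, Rsym}" "v ! K0 \<le> n" using x(1) by (auto simp: valid_def sv PhB)
    moreover have "arity (letter (read_inp w (v ! K0))) = 0"
      using letter_in[OF calculation(3)] arity_Sig by (auto simp: letters_def)
    ultimately have "wf_trm (val (PhB d t, v))" "closed (val (PhB d t, v))"
      using wf_fill[OF activate_props(3)] closed_fill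
      by (auto simp: tri_def bul_def const_def closed_def)
    then show ?thesis
      using deterministic_inst[OF assms is_flow_Ob] stepB_sound[of d t v] x g unfolding sv PhB by blast
  qed
  then show "\<exists>y'. pstep pick w x y' \<and> val y' = val y" using y' by blast
qed (rule pick_subset)

end

section \<open>The complexity of observations\<close>

lemma (in observation) decides:
  fixes a :: "vertex search"
  assumes "searching \<delta> Sl (Suc K0)" and Sl: "set Sl = vertices"
    and adequate: "\<And>w p. observation_run Sig Ob w p \<Longrightarrow> observation_run.adequate Sig Ob w p \<delta>"
    and a: "a = Found \<or> a = Done \<and> (\<forall>s\<in>set Sl. \<forall>rd. \<forall>x\<in>\<delta> s rd. \<forall>y\<in>\<delta> s rd. x = y)"
  shows "\<exists>M. valid_tm M \<and> (a = Done \<longrightarrow> deterministic_tm M) \<and> (\<forall>w\<in>lists Sig. log_space M 2 w \<and>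
    halts M w \<and> (accepts M w \<longleftrightarrow> (w \<notin> lang Sig Ob \<longleftrightarrow> a = Found)))"
proof -
  interpret s: searching \<delta> Sl "Suc K0" by fact
  interpret sim: simulation s.srch s.sstates "3 * Suc K0" Begin a Sig
    by unfold_locales (use s.finite_sstates a finite_Sig s.srch_prog in auto)
  have det: "a = Done \<longrightarrow> deterministic_tm sim.M"
  proof
    assume "a = Done"
    then have d: "x = y" if "s \<in> set Sl" "x \<in> \<delta> s rd" "y \<in> \<delta> s rd" for s rd x y
      using a that by auto
    show "deterministic_tm sim.M"
      by (rule sim.deterministic_M) (rule s.srch_deterministic[OF d])
  qed
  have run: "log_space sim.M 2 w \<and> halts sim.M w \<and> (accepts sim.M w \<longleftrightarrow> (w \<notin> lang Sig Ob \<longleftrightarrow> a = Found))"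
    if "w \<in> lists Sig" for w
  proof -
    have w: "set w \<subseteq> Sig" using that by auto
    interpret r: simulation_run s.srch s.sstates "3 * Suc K0" Begin a Sig w
      by unfold_locales (rule w)
    interpret sr: searching_run \<delta> Sl "Suc K0" w ..
    have walk: "sr.long_walk \<longleftrightarrow> \<not> nilpotent (wprod Ob (wordrep w p))"
      if "length p = length w + 1" "distinct p" for p
    proof -
      interpret o: observation_run Sig Ob w p by unfold_locales (use w that in auto)
      have "o.adequate \<delta>" by (rule adequate) (rule o.observation_run_axioms)
      then show ?thesis by (rule o.long_walk_iff) fact+
    qed
    \<comment> \<open>The language asks about all \<open>p\<close>, and \<open>walk\<close> gives
      the same answer for each; this list shows that there is at least one.\<close>
    have "length [0..<length w + 1] = length w + 1" "distinct [0..<length w + 1]" by simp_all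
    then have "sr.long_walk \<longleftrightarrow> w \<notin> lang Sig Ob"
      unfolding lang_def mem_Collect_eq using walk w by blast
    moreover have out: "outcome s.srch a w (Begin, replicate (3 * Suc K0) 0) (sr.long_walk \<longleftrightarrow> a = Found)"
      by (rule sr.outcome_srch) (rule a)
    ultimately show ?thesis using r.simulates[OF out] by simp
  qed
  show ?thesis using sim.valid_M det run by blast
qed

theorem mainTheorem2:
  fixes Sig :: "fsym set" and Ob :: wiring
  assumes "finite Sig"
    and "\<forall>c\<in>Sig. arity c = 0"
    and "Star \<notin> Sig"
    and "Ob \<in> observations Sig"
  shows "in_coNL Sig (lang Sig Ob) \<and> (deterministic Ob \<longrightarrow> in_L Sig (lang Sig Ob))"
proof -
  interpret observation Sig Ob by unfold_locales fact+
  obtain Sl where Sl: "set Sl = vertices" using finite_list[OF finite_vertices] by blast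
  have lang: "lang Sig Ob \<subseteq> lists Sig" by (auto simp: lang_def)
  have gm: "searching gm Sl (Suc K0)"
    by unfold_locales (use gm_prog Sl in blast)
  have pick: "searching pick Sl (Suc K0)"
    by unfold_locales (use gm_prog pick_subset Sl in blast)
  have "in_NL Sig (lists Sig - lang Sig Ob)"
    using decides[OF gm Sl observation_run.adequate_gm, of Found] unfolding in_NL_def by auto
  moreover have "in_L Sig (lang Sig Ob)" if "deterministic Ob"
  proof -
    have "\<exists>M. valid_tm M \<and> ((Done :: vertex search) = Done \<longrightarrow> deterministic_tm M) \<and> (\<forall>w\<in>lists Sig. log_space M 2 w \<and>
      halts M w \<and> (accepts M w \<longleftrightarrow> (w \<notin> lang Sig Ob \<longleftrightarrow> (Done :: vertex search) = Found)))"
      by (rule decides[OF pick Sl observation_run.adequate_pick]) (use that pick_unique in auto)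
    then obtain M where "valid_tm M" "deterministic_tm M"
      "\<forall>w\<in>lists Sig. log_space M 2 w \<and> halts M w \<and> (w \<in> lang Sig Ob \<longleftrightarrow> accepts M w)" by auto
    then show ?thesis unfolding in_L_def using lang by blast
  qed
  ultimately show ?thesis using lang by (simp add: in_coNL_def)
qed

end
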